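(* For any graph $G$ there is a homotopy equivalence $$\mathrm{Cl}(T(G))\simeq \mathrm{Cl}(G)\vee\bigvee^{\mathrm{t}(G)}S^2,$$ where $\mathrm{t}(G)$ denotes the number of triangles in $G$.
   Context: All graphs are finite, simple and undirected. $S(G)$ is the graph obtained from $G$ by subdividing every edge with one vertex. The total graph of $G$ is $T(G)=S(G)^2$, where for a graph $H$ the square $H^2$ is the graph with vertex set $V(H)$ in which two distinct vertices are adjacent if and only if their distance in $H$ is at most $2$. $\mathrm{Cl}(H)$ is the clique complex of $H$: the simplicial complex whose vertices are the vertices of $H$ and whose simplices are the cliques (complete subgraphs) of $H$. A triangle in $G$ is a set of three pairwise adjacent vertices. $\bigvee^k X$ denotes a wedge of $k$ copies of a space $X$, and $\simeq$ denotes homotopy equivalence.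
   Formalization: For disconnected graphs the one-base-point wedge formula fails (two disjoint triangles), so each sphere is attached at any point in the component of Cl(G) containing its triangle; for connected graphs the formula is proved literally for every base point. *)

theory Defs
  imports "HOL-Analysis.Analysis" "HOL-Library.Extended_Nat"
begin

section \<open>Graphs\<close>

text \<open>A graph is a pair of a vertex set and a set of edges, each edge being a two-element set of
  vertices.\<close>

type_synonym 'a graph = "'a set \<times> 'a set set"

abbreviation verts :: "'a graph \<Rightarrow> 'a set" where
  "verts G \<equiv> fst G"

abbreviation edges :: "'a graph \<Rightarrow> 'a set set" where
  "edges G \<equiv> snd G"

definition finite_simple_graph :: "'a graph \<Rightarrow> bool" where
  "finite_simple_graph G \<longleftrightarrow>
     finite (verts G) \<and> (\<forall>e\<in>edges G. e \<subseteq> verts G \<and> card e = 2)"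

definition adj :: "'a graph \<Rightarrow> 'a \<Rightarrow> 'a \<Rightarrow> bool" where
  "adj G u v \<longleftrightarrow> {u, v} \<in> edges G"

text \<open>The distance is the least length of a walk, and \<open>\<infinity>\<close> (the infimum of the empty set) if there
  is no walk.\<close>

definition graph_dist :: "'a graph \<Rightarrow> 'a \<Rightarrow> 'a \<Rightarrow> enat" where
  "graph_dist G u v = Inf (enat ` {n. (u, v) \<in> {(x, y). adj G x y} ^^ n})"

definition connected_graph :: "'a graph \<Rightarrow> bool" where
  "connected_graph G \<longleftrightarrow> (\<forall>u\<in>verts G. \<forall>v\<in>verts G. graph_dist G u v \<noteq> \<infinity>)"

text \<open>In the subdivision, \<open>Inl v\<close> is an original vertex and \<open>Inr e\<close> is the vertex subdividing the
  edge \<open>e\<close>.\<close>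

definition subdivision :: "'a graph \<Rightarrow> ('a + 'a set) graph" where
  "subdivision G = (verts G <+> edges G, {{Inl v, Inr e} |v e. e \<in> edges G \<and> v \<in> e})"

definition graph_square :: "'a graph \<Rightarrow> 'a graph" where
  "graph_square H =
     (verts H, {{u, v} |u v. u \<in> verts H \<and> v \<in> verts H \<and> u \<noteq> v \<and> graph_dist H u v \<le> 2})"

definition total_graph :: "'a graph \<Rightarrow> ('a + 'a set) graph" where
  "total_graph G = graph_square (subdivision G)"

definition clique :: "'a graph \<Rightarrow> 'a set \<Rightarrow> bool" where
  "clique G C \<longleftrightarrow> C \<subseteq> verts G \<and> pairwise (adj G) C"

definition triangles :: "'a graph \<Rightarrow> 'a set set" where
  "triangles G = {t. clique G t \<and> card t = 3}"


section \<open>Clique complexes\<close>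

definition clique_complex :: "'a graph \<Rightarrow> 'a set set" where
  "clique_complex G = {C. C \<noteq> {} \<and> finite C \<and> clique G C}"

text \<open>Geometric realization in barycentric coordinates. The topology is induced from the product
  topology on functions; for a complex with finitely many vertices (the only case used) this is
  the usual topology of the realization.\<close>

definition realization :: "'v set set \<Rightarrow> ('v \<Rightarrow> real) topology" where
  "realization K = top_of_set
     {f. (\<forall>v. 0 \<le> f v) \<and> {v. f v \<noteq> 0} \<in> K \<and> (\<Sum>v | f v \<noteq> 0. f v) = 1}"

abbreviation Cl :: "'a graph \<Rightarrow> ('a \<Rightarrow> real) topology" where
  "Cl G \<equiv> realization (clique_complex G)"

definition vertex_point :: "'v \<Rightarrow> 'v \<Rightarrow> real" where
  "vertex_point v = (\<lambda>w. if w = v then 1 else 0)"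

lemma vertex_point_in_Cl:
  assumes "v \<in> verts G"
  shows "vertex_point v \<in> topspace (Cl G)"
proof -
  have "{w. vertex_point v w \<noteq> 0} = {v}"
    by (auto simp: vertex_point_def)
  then show ?thesis
    using assms
    by (auto simp: realization_def clique_complex_def clique_def vertex_point_def)
qed


section \<open>Disjoint sums, quotients and wedges\<close>

definition disjoint_sum :: "'a topology \<Rightarrow> 'b topology \<Rightarrow> ('a + 'b) topology" where
  "disjoint_sum X Y = topology (\<lambda>U. U \<subseteq> topspace X <+> topspace Y \<and>
     openin X (Inl -` U) \<and> openin Y (Inr -` U))"

lemma openin_disjoint_sum:
  "openin (disjoint_sum X Y) U \<longleftrightarrow>
     U \<subseteq> topspace X <+> topspace Y \<and> openin X (Inl -` U) \<and> openin Y (Inr -` U)"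
proof -
  have "istopology (\<lambda>U. U \<subseteq> topspace X <+> topspace Y \<and>
     openin X (Inl -` U) \<and> openin Y (Inr -` U))"
    unfolding istopology_def vimage_Int vimage_Union by blast
  then show ?thesis
    by (simp add: disjoint_sum_def topology_inverse')
qed

lemma topspace_disjoint_sum [simp]:
  "topspace (disjoint_sum X Y) = topspace X <+> topspace Y"
proof -
  have "Inl -` (topspace X <+> topspace Y) = topspace X"
       "Inr -` (topspace X <+> topspace Y) = topspace Y"
    by auto
  then have "openin (disjoint_sum X Y) (topspace X <+> topspace Y)"
    by (simp add: openin_disjoint_sum)
  then show ?thesis
    by (meson openin_disjoint_sum openin_subset openin_topspace subset_antisym)
qed

text \<open>The finest topology on the image of \<open>X\<close> under \<open>q\<close> making \<open>q\<close> continuous, that is, the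
  quotient of \<open>X\<close> by the fibres of \<open>q\<close>.\<close>

definition quotient_topology :: "'a topology \<Rightarrow> ('a \<Rightarrow> 'b) \<Rightarrow> 'b topology" where
  "quotient_topology X q = topology (\<lambda>U. U \<subseteq> q ` topspace X \<and>
     openin X {x \<in> topspace X. q x \<in> U})"

lemma openin_quotient_topology:
  "openin (quotient_topology X q) U \<longleftrightarrow>
     U \<subseteq> q ` topspace X \<and> openin X {x \<in> topspace X. q x \<in> U}"
proof -
  have 1: "{x \<in> topspace X. q x \<in> S \<inter> T} =
      {x \<in> topspace X. q x \<in> S} \<inter> {x \<in> topspace X. q x \<in> T}" for S T
    by auto
  have 2: "{x \<in> topspace X. q x \<in> \<Union>\<K>} = (\<Union>K\<in>\<K>. {x \<in> topspace X. q x \<in> K})" for \<K>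
    by auto
  have "istopology (\<lambda>U. U \<subseteq> q ` topspace X \<and> openin X {x \<in> topspace X. q x \<in> U})"
    unfolding istopology_def 1 2 by blast
  then show ?thesis
    by (simp add: quotient_topology_def topology_inverse')
qed

lemma topspace_quotient_topology [simp]:
  "topspace (quotient_topology X q) = q ` topspace X"
proof -
  have "{x \<in> topspace X. q x \<in> q ` topspace X} = topspace X"
    by auto
  then have "openin (quotient_topology X q) (q ` topspace X)"
    by (simp add: openin_quotient_topology)
  then show ?thesis
    by (meson openin_quotient_topology openin_subset openin_topspace subset_antisym)
qed

lemma quotient_map_quotient_topology: "quotient_map X (quotient_topology X q) q"
  by (auto simp: quotient_map_def openin_quotient_topology)

text \<open>The disjoint union of \<open>X\<close> and one copy of the pointed space \<open>(Y, y)\<close> for every \<open>i \<in> I\<close>,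
  with the base point of the \<open>i\<close>-th copy identified with the point \<open>b i\<close> of \<open>X\<close>.\<close>

definition attach_copies ::
  "'a topology \<Rightarrow> 'i set \<Rightarrow> ('i \<Rightarrow> 'a) \<Rightarrow> 'b topology \<Rightarrow> 'b \<Rightarrow> ('a + 'i \<times> 'b) topology" where
  "attach_copies X I b Y y =
     quotient_topology (disjoint_sum X (sum_topology (\<lambda>_. Y) I))
       (\<lambda>z. case z of Inl p \<Rightarrow> Inl p
                    | Inr (i, s) \<Rightarrow> if s = y then Inl (b i) else Inr (i, s))"

text \<open>The wedge of \<open>(X, x)\<close> with \<open>k\<close> copies of \<open>(Y, y)\<close>; all base points are identified.\<close>

definition wedge_copies ::
  "'a topology \<Rightarrow> 'a \<Rightarrow> nat \<Rightarrow> 'b topology \<Rightarrow> 'b \<Rightarrow> ('a + nat \<times> 'b) topology" where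
  "wedge_copies X x k Y y = attach_copies X {..<k} (\<lambda>_. x) Y y"

abbreviation S2 :: "(real ^ 3) topology" where
  "S2 \<equiv> top_of_set (sphere 0 1)"

text \<open>For a disconnected graph the homotopy type of a wedge with \<open>Cl G\<close> depends on where the
  spheres are attached, and with a single base point the equivalence fails in general: for two
  disjoint triangles, \<open>Cl (total_graph G)\<close> is a disjoint union of two spheres. The sphere
  belonging to a triangle has to be attached in the component of that triangle. An admissible
  choice \<open>b\<close> of attaching points is one respecting this; for a connected graph every choice,
  in particular every constant one, is admissible.\<close>

definition admissible_attaching :: "'a graph \<Rightarrow> ('a set \<Rightarrow> 'a \<Rightarrow> real) \<Rightarrow> bool" where
  "admissible_attaching G b \<longleftrightarrow>
     (\<forall>t\<in>triangles G. \<forall>v\<in>t. path_component_of (Cl G) (vertex_point v) (b t))"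

end

theory Submission
  imports Defs
begin

text \<open>A clique of the total graph is a clique of \<open>G\<close>, or consists of an edge and endpoints of it,
  or lies in the star of a vertex \<open>v\<close> (\<open>v\<close> and edges at \<open>v\<close>), or is the set of the three edges of
  a triangle. The simplices of the last kind are maximal. The complex of all other cliques deforms
  onto the clique complex of \<open>G\<close>: first push the mass inside every star towards its centre until it
  lies on segments from \<open>v\<close> to edges at \<open>v\<close>, then send each edge vertex to the midpoint of its edge.
  The remaining simplices are discs, one per triangle \<open>t\<close>, and the deformation carries the boundary
  of such a disc into the simplex \<open>t\<close>. Hence all attaching maps are homotopic to constants, and
  attaching discs along constant maps yields the spheres.\<close>

section \<open>Attaching cones\<close>

text \<open>Both sides are presented as a base with the same family of cones glued on:
  \<open>Cl (total_graph G)\<close> over the skeleton, and the wedge over \<open>Cl G\<close>. The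
  cones have the same domain because the sphere is written as a cone over the boundary of a triangle
  with its base shrunk to a point. The homotopy type of such a gluing survives a deformation of the
  base and a homotopy of the attaching maps. The explicit maps that show this fit together at the
  seams only if the deformation keeps \<open>Cl G\<close> pointwise fixed, so both of its stages are
  homotopies relative to that subcomplex. Two stages are needed because sending edge vertices to
  midpoints at once would spread a point in the star of \<open>v\<close> over several neighbours of
  \<open>v\<close>, which need not form a clique; concentrating the mass leaves at most one edge
  vertex in play. The choice of the attaching points enters only at the end, through a path from a
  corner of each triangle to the chosen point.\<close>

abbreviation unit_interval :: "real topology" where
  "unit_interval \<equiv> top_of_set {0..1}"

section \<open>Continuity on disjoint sums and by cases\<close>

lemma continuous_map_disjoint_sum:
  assumes "continuous_map X Z (f \<circ> Inl)" "continuous_map Y Z (f \<circ> Inr)"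
  shows "continuous_map (disjoint_sum X Y) Z f"
  unfolding continuous_map_def
proof (intro conjI allI impI)
  show "f \<in> topspace (disjoint_sum X Y) \<rightarrow> topspace Z"
    using assms by (fastforce simp: continuous_map_def)
  fix U assume U: "openin Z U"
  have "Inl -` {x \<in> topspace (disjoint_sum X Y). f x \<in> U} = {x \<in> topspace X. (f \<circ> Inl) x \<in> U}"
       "Inr -` {x \<in> topspace (disjoint_sum X Y). f x \<in> U} = {x \<in> topspace Y. (f \<circ> Inr) x \<in> U}"
    by auto
  with U assms show "openin (disjoint_sum X Y) {x \<in> topspace (disjoint_sum X Y). f x \<in> U}"
    unfolding openin_disjoint_sum continuous_map_def by auto
qed

lemma continuous_map_Inl_disjoint_sum: "continuous_map X (disjoint_sum X Y) Inl"
proof -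
  have "{x \<in> topspace X. Inl x \<in> U} = Inl -` U" if "openin X (Inl -` U)" for U :: "('a + 'b) set"
    using openin_subset[OF that] by auto
  then show ?thesis
    by (auto simp: continuous_map_def openin_disjoint_sum)
qed

lemma continuous_map_Inr_disjoint_sum: "continuous_map Y (disjoint_sum X Y) Inr"
proof -
  have "{y \<in> topspace Y. Inr y \<in> U} = Inr -` U" if "openin Y (Inr -` U)" for U :: "('b + 'a) set"
    using openin_subset[OF that] by auto
  then show ?thesis
    by (auto simp: continuous_map_def openin_disjoint_sum)
qed

text \<open>The parts \<open>L\<close> and \<open>R\<close> of the product over the two summands are
  open and cover it, so the map is pasted from its restrictions.\<close>

lemma continuous_map_prod_disjoint_sum:
  fixes T :: "'a topology" and X :: "'b topology" and Y :: "'d topology"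
  assumes X: "continuous_map (prod_topology T X) Z (\<lambda>(t, x). f (t, Inl x))"
    and Y: "continuous_map (prod_topology T Y) Z (\<lambda>(t, y). f (t, Inr y))"
  shows "continuous_map (prod_topology T (disjoint_sum X Y)) Z f"
proof -
  let ?S = "prod_topology T (disjoint_sum X Y)"
  define L :: "('a \<times> ('b + 'd)) set" where "L = topspace T \<times> (Inl ` topspace X)"
  define R :: "('a \<times> ('b + 'd)) set" where "R = topspace T \<times> (Inr ` topspace Y)"
  have projl: "continuous_map (subtopology (disjoint_sum X Y) (Inl ` topspace X)) X projl"
    unfolding continuous_map_def
  proof (intro conjI allI impI)
    fix U assume U: "openin X U"
    have *: "{x \<in> topspace (subtopology (disjoint_sum X Y) (Inl ` topspace X)). projl x \<in> U}
       = Inl ` U \<inter> Inl ` topspace X"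
      using openin_subset[OF U] by auto
    have "openin (disjoint_sum X Y) (Inl ` U)"
      using U openin_subset[OF U] by (auto simp: openin_disjoint_sum vimage_def image_iff)
    then show "openin (subtopology (disjoint_sum X Y) (Inl ` topspace X))
      {x \<in> topspace (subtopology (disjoint_sum X Y) (Inl ` topspace X)). projl x \<in> U}"
      unfolding * openin_subtopology by blast
  qed auto
  have projr: "continuous_map (subtopology (disjoint_sum X Y) (Inr ` topspace Y)) Y projr"
    unfolding continuous_map_def
  proof (intro conjI allI impI)
    fix U assume U: "openin Y U"
    have *: "{x \<in> topspace (subtopology (disjoint_sum X Y) (Inr ` topspace Y)). projr x \<in> U}
       = Inr ` U \<inter> Inr ` topspace Y"
      using openin_subset[OF U] by auto
    have "openin (disjoint_sum X Y) (Inr ` U)"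
      using U openin_subset[OF U] by (auto simp: openin_disjoint_sum vimage_def image_iff)
    then show "openin (subtopology (disjoint_sum X Y) (Inr ` topspace Y))
      {x \<in> topspace (subtopology (disjoint_sum X Y) (Inr ` topspace Y)). projr x \<in> U}"
      unfolding * openin_subtopology by blast
  qed auto
  have opens: "openin (disjoint_sum X Y) (Inl ` topspace X)" "openin (disjoint_sum X Y) (Inr ` topspace Y)"
    by (auto simp: openin_disjoint_sum vimage_def image_iff)
  have subL: "subtopology ?S L = prod_topology T (subtopology (disjoint_sum X Y) (Inl ` topspace X))"
    unfolding L_def by (metis prod_topology_subtopology(2) subtopology_Times subtopology_topspace)
  have subR: "subtopology ?S R = prod_topology T (subtopology (disjoint_sum X Y) (Inr ` topspace Y))"
    unfolding R_def by (metis prod_topology_subtopology(2) subtopology_Times subtopology_topspace)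
  have cL: "continuous_map (subtopology ?S L) Z (\<lambda>z. f (fst z, Inl (projl (snd z))))"
    using continuous_map_compose[OF continuous_map_pairedI[OF continuous_map_fst
         continuous_map_compose[OF continuous_map_snd projl]] X]
    unfolding subL by (simp add: o_def case_prod_unfold)
  have cR: "continuous_map (subtopology ?S R) Z (\<lambda>z. f (fst z, Inr (projr (snd z))))"
    using continuous_map_compose[OF continuous_map_pairedI[OF continuous_map_fst
         continuous_map_compose[OF continuous_map_snd projr]] Y]
    unfolding subR by (simp add: o_def case_prod_unfold)
  show ?thesis
  proof (rule pasting_lemma[where I = UNIV and T = "\<lambda>b. if b then L else R"
        and f = "\<lambda>b z. if b then f (fst z, Inl (projl (snd z))) else f (fst z, Inr (projr (snd z)))"])
    show "openin ?S (if b then L else R)" for b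
      using opens by (auto simp: L_def R_def openin_prod_Times_iff)
    show "continuous_map (subtopology ?S (if b then L else R)) Z
       (\<lambda>z. if b then f (fst z, Inl (projl (snd z))) else f (fst z, Inr (projr (snd z))))" for b
      using cL cR by (cases b) auto
    show "(if b then f (fst z, Inl (projl (snd z))) else f (fst z, Inr (projr (snd z)))) =
          (if b' then f (fst z, Inl (projl (snd z))) else f (fst z, Inr (projr (snd z))))"
      if "z \<in> topspace ?S \<inter> (if b then L else R) \<inter> (if b' then L else R)" for b b' z
      using that by (cases b; cases b') (auto simp: L_def R_def)
    show "\<exists>b. b \<in> UNIV \<and> z \<in> (if b then L else R) \<and>
        f z = (if b then f (fst z, Inl (projl (snd z))) else f (fst z, Inr (projr (snd z))))"
      if "z \<in> topspace ?S" for z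
    proof (cases z)
      case (Pair t w)
      then show ?thesis using that by (cases w) (auto simp: L_def R_def)
    qed
  qed
qed

text \<open>Both branches have to be continuous on all of \<open>X\<close>. This is why later uses
  truncate a parameter by \<open>min\<close> or \<open>max\<close>: the truncation is invisible
  where the branch applies and keeps it defined elsewhere.\<close>

lemma continuous_map_split_at:
  assumes "continuous_map X euclideanreal p" "continuous_map X Y f" "continuous_map X Y g"
    and "\<And>x. \<lbrakk>x \<in> topspace X; p x = k\<rbrakk> \<Longrightarrow> f x = g x"
  shows "continuous_map X Y (\<lambda>x. if p x \<le> k then f x else g x)"
proof (rule continuous_map_cases_le)
  show "continuous_map X euclideanreal p" by fact
  show "continuous_map X euclideanreal (\<lambda>x. k)" by simp
  show "continuous_map (subtopology X {x \<in> topspace X. p x \<le> k}) Y f"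
    by (rule continuous_map_from_subtopology) fact
  show "continuous_map (subtopology X {x \<in> topspace X. k \<le> p x}) Y g"
    by (rule continuous_map_from_subtopology) fact
qed (fact assms(4))

lemma continuous_map_unit_interval_iff:
  "continuous_map X unit_interval f \<longleftrightarrow>
     continuous_map X euclideanreal f \<and> (\<forall>x\<in>topspace X. 0 \<le> f x \<and> f x \<le> 1)"
  by (auto simp: continuous_map_in_subtopology)

text \<open>The space \<open>X\<close> arises from \<open>L\<close> by gluing a cone along \<open>\<phi>\<close> onto each fibre of \<open>p\<close> in \<open>A\<close>; the
  point \<open>c (a, r)\<close> is the apex of the cone for \<open>r = 0\<close> and the point \<open>\<phi> a\<close> for \<open>r = 1\<close>.\<close>

locale cone_attachment =
  fixes X :: "'x topology" and L :: "'l topology" and A :: "'c topology"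
    and \<phi> :: "'c \<Rightarrow> 'l" and p :: "'c \<Rightarrow> 'i" and i :: "'l \<Rightarrow> 'x" and c :: "'c \<times> real \<Rightarrow> 'x"
  assumes quotient: "quotient_map (disjoint_sum L (prod_topology A unit_interval)) X (case_sum i c)"
    and cont_attaching: "continuous_map A L \<phi>"
    and inj_base: "inj_on i (topspace L)"
    and base_eq_cone_iff: "\<lbrakk>l \<in> topspace L; a \<in> topspace A; 0 \<le> r; r \<le> 1\<rbrakk>
      \<Longrightarrow> i l = c (a, r) \<longleftrightarrow> r = 1 \<and> l = \<phi> a"
    and cone_eq_cone_iff: "\<lbrakk>a \<in> topspace A; a' \<in> topspace A; 0 \<le> r; r < 1; 0 \<le> r'; r' < 1\<rbrakk>
      \<Longrightarrow> c (a, r) = c (a', r') \<longleftrightarrow> r = r' \<and> (a = a' \<or> r = 0 \<and> p a = p a')"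
begin

lemma cont_base: "continuous_map L X i"
  using continuous_map_compose[OF continuous_map_Inl_disjoint_sum quotient_imp_continuous_map[OF quotient]]
  by (simp add: o_def)

lemma cont_cone: "continuous_map (prod_topology A unit_interval) X c"
  using continuous_map_compose[OF continuous_map_Inr_disjoint_sum quotient_imp_continuous_map[OF quotient]]
  by (simp add: o_def)

lemma attaching_in: "a \<in> topspace A \<Longrightarrow> \<phi> a \<in> topspace L"
  using cont_attaching by (auto simp: continuous_map_def)

lemma cone_1 [simp]: "a \<in> topspace A \<Longrightarrow> c (a, 1) = i (\<phi> a)"
  using base_eq_cone_iff[of "\<phi> a" a 1] attaching_in by auto

lemma cone_0: "\<lbrakk>a \<in> topspace A; a' \<in> topspace A; p a = p a'\<rbrakk> \<Longrightarrow> c (a, 0) = c (a', 0)"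
  using cone_eq_cone_iff[of a a' 0 0] by auto

lemma point_cases:
  assumes "x \<in> topspace X"
  obtains (base) l where "l \<in> topspace L" "x = i l"
  | (cone) a r where "a \<in> topspace A" "0 \<le> r" "r \<le> 1" "x = c (a, r)"
proof -
  have "x \<in> case_sum i c ` topspace (disjoint_sum L (prod_topology A unit_interval))"
    using assms quotient_imp_surjective_map[OF quotient] by simp
  then show thesis
    using base cone by auto
qed

text \<open>Homotopies on \<open>X\<close> are built piecewise on base and cones. The premises
  \<open>glue\<close> and \<open>apex\<close> express compatibility with the only identifications
  made in \<open>X\<close>: the end of a cone with its attaching point, and the apices over one
  fibre of \<open>p\<close>.\<close>

lemma homotopy_lift:
  assumes L: "continuous_map (prod_topology unit_interval L) Z fL"
    and P: "continuous_map (prod_topology unit_interval (prod_topology A unit_interval)) Z fP"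
    and glue: "\<And>s a. \<lbrakk>0 \<le> s; s \<le> 1; a \<in> topspace A\<rbrakk> \<Longrightarrow> fP (s, a, 1) = fL (s, \<phi> a)"
    and apex: "\<And>s a a'. \<lbrakk>0 \<le> s; s \<le> 1; a \<in> topspace A; a' \<in> topspace A; p a = p a'\<rbrakk>
      \<Longrightarrow> fP (s, a, 0) = fP (s, a', 0)"
  shows "\<exists>F. continuous_map (prod_topology unit_interval X) Z F \<and>
    (\<forall>s\<in>{0..1}. \<forall>l\<in>topspace L. F (s, i l) = fL (s, l)) \<and>
    (\<forall>s\<in>{0..1}. \<forall>a\<in>topspace A. \<forall>r\<in>{0..1}. F (s, c (a, r)) = fP (s, a, r))"
proof -
  let ?D = "disjoint_sum L (prod_topology A unit_interval)"
  define h where "h = (\<lambda>(s, w). case_sum (\<lambda>l. fL (s, l)) (\<lambda>q. fP (s, q)) w)"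
  define \<kappa> :: "real \<times> ('l + 'c \<times> real) \<Rightarrow> real \<times> 'x" where "\<kappa> = (\<lambda>(s, w). (s, case_sum i c w))"
  \<comment> \<open>The interval is locally compact Hausdorff, so its product with a quotient map is
    again a quotient map, and a homotopy may be defined upstairs.\<close>
  have q: "quotient_map (prod_topology unit_interval ?D) (prod_topology unit_interval X) \<kappa>"
    unfolding \<kappa>_def by (intro quotient_map_prod_right quotient disjI1 compact_imp_locally_compact_space
        Hausdorff_space_subtopology Hausdorff_space_euclidean) (simp add: compact_space_subtopology)
  have h: "continuous_map (prod_topology unit_interval ?D) Z h"
    by (rule continuous_map_prod_disjoint_sum) (use L P in \<open>simp_all add: h_def case_prod_unfold\<close>)
  have cone: "fP (s, a, r) = fP (s, a', r')"
    if "0 \<le> s" "s \<le> 1" "a \<in> topspace A" "a' \<in> topspace A" "0 \<le> r" "r \<le> 1" "0 \<le> r'" "r' \<le> 1"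
      and eq: "c (a, r) = c (a', r')" for s a r a' r'
  proof (cases "r = 1 \<or> r' = 1")
    \<comment> \<open>A cone point with parameter 1 lies in the base, and a cone point equal to a
      base point has parameter 1 itself.\<close>
    case True
    then have "r = 1 \<and> r' = 1 \<and> \<phi> a = \<phi> a'"
      using base_eq_cone_iff[of "\<phi> a" a' r'] base_eq_cone_iff[of "\<phi> a'" a r] that attaching_in
        cone_1 by metis
    then show ?thesis using that glue by simp
  next
    case False
    then show ?thesis using that cone_eq_cone_iff[of a a' r r'] apex by auto
  qed
  have h_eq: "h u = h v" if "u \<in> topspace (prod_topology unit_interval ?D)"
      "v \<in> topspace (prod_topology unit_interval ?D)"
      "\<kappa> u = \<kappa> v" for u v
  proof -
    obtain s w s' w' where [simp]: "u = (s, w)" "v = (s', w')" by (metis surj_pair)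
    have [simp]: "s' = s" using that by (simp add: \<kappa>_def)
    have eq: "case_sum i c w = case_sum i c w'" using that by (simp add: \<kappa>_def)
    have s: "0 \<le> s" "s \<le> 1" using that by auto
    have mixed: "fL (s, l) = fP (s, a, r)"
      if "l \<in> topspace L" "a \<in> topspace A" "0 \<le> r" "r \<le> 1" "i l = c (a, r)" for l a r
      using that base_eq_cone_iff[of l a r] glue[OF s, of a] by simp
    show ?thesis
    proof (cases w)
      case w: (Inl l)
      show ?thesis
      proof (cases w')
        case (Inl l')
        with w that(1,2) eq have "l = l'" by (auto dest: inj_onD[OF inj_base])
        with w Inl show ?thesis by simp
      next
        case (Inr q')
        with w that(1,2) eq have "fL (s, l) = fP (s, fst q', snd q')"
          by (intro mixed) auto
        with w Inr show ?thesis by (simp add: h_def)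
      qed
    next
      case w: (Inr q)
      show ?thesis
      proof (cases w')
        case (Inl l')
        with w that(1,2) eq have "fL (s, l') = fP (s, fst q, snd q)"
          by (intro mixed) auto
        with w Inl show ?thesis by (simp add: h_def)
      next
        case (Inr q')
        with w that(1,2) eq have "fP (s, fst q, snd q) = fP (s, fst q', snd q')"
          by (intro cone s) auto
        with w Inr show ?thesis by (simp add: h_def)
      qed
    qed
  qed
  have "\<exists>F. continuous_map (prod_topology unit_interval X) Z F \<and>
      (\<forall>u \<in> topspace (prod_topology unit_interval ?D). F (\<kappa> u) = h u)"
    by (rule quotient_map_lift_exists[OF q h])
      (erule (2) h_eq, rule exI, intro conjI ballI, assumption, simp only:)
  then obtain F where F: "continuous_map (prod_topology unit_interval X) Z F"
    and eq: "\<forall>u \<in> topspace (prod_topology unit_interval ?D). F (\<kappa> u) = h u"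
    by auto
  have "F (s, i l) = fL (s, l)" if "s \<in> {0..1}" "l \<in> topspace L" for s l
    using bspec[OF eq, of "(s, Inl l)"] that by (simp add: h_def \<kappa>_def InlI InrI)
  moreover have "F (s, c (a, r)) = fP (s, a, r)"
    if "s \<in> {0..1}" "a \<in> topspace A" "r \<in> {0..1}" for s a r
    using bspec[OF eq, of "(s, Inr (a, r))"] that by (simp add: h_def \<kappa>_def InlI InrI)
  ultimately show ?thesis
    using F by (intro exI[of _ F]) simp
qed

text \<open>A map is a homotopy that does not depend on time, read off at time 0.\<close>

lemma map_lift:
  assumes L: "continuous_map L Z fL"
    and P: "continuous_map (prod_topology A unit_interval) Z fP"
    and glue: "\<And>a. a \<in> topspace A \<Longrightarrow> fP (a, 1) = fL (\<phi> a)"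
    and apex: "\<And>a a'. \<lbrakk>a \<in> topspace A; a' \<in> topspace A; p a = p a'\<rbrakk> \<Longrightarrow> fP (a, 0) = fP (a', 0)"
  shows "\<exists>F. continuous_map X Z F \<and> (\<forall>l\<in>topspace L. F (i l) = fL l) \<and>
    (\<forall>a\<in>topspace A. \<forall>r\<in>{0..1}. F (c (a, r)) = fP (a, r))"
proof -
  have "\<exists>F. continuous_map (prod_topology unit_interval X) Z F \<and>
    (\<forall>s\<in>{0..1}. \<forall>l\<in>topspace L. F (s, i l) = (fL \<circ> snd) (s, l)) \<and>
    (\<forall>s\<in>{0..1}. \<forall>a\<in>topspace A. \<forall>r\<in>{0..1}. F (s, c (a, r)) = (fP \<circ> snd) (s, a, r))"
  proof (rule homotopy_lift)
    show "continuous_map (prod_topology unit_interval L) Z (fL \<circ> snd)"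
      by (rule continuous_map_compose[OF continuous_map_snd L])
    show "continuous_map (prod_topology unit_interval (prod_topology A unit_interval)) Z (fP \<circ> snd)"
      by (rule continuous_map_compose[OF continuous_map_snd P])
    show "(fP \<circ> snd) (s, a, 1) = (fL \<circ> snd) (s, \<phi> a)" if "a \<in> topspace A" for s :: real and a
      using glue[OF that] by simp
    show "(fP \<circ> snd) (s, a, 0) = (fP \<circ> snd) (s, a', 0)"
      if "a \<in> topspace A" "a' \<in> topspace A" "p a = p a'" for s :: real and a a'
      using apex[OF that] by simp
  qed
  then obtain F where F: "continuous_map (prod_topology unit_interval X) Z F"
    "\<forall>s\<in>{0..1}. \<forall>l\<in>topspace L. F (s, i l) = (fL \<circ> snd) (s, l)"
    "\<forall>s\<in>{0..1}. \<forall>a\<in>topspace A. \<forall>r\<in>{0..1}. F (s, c (a, r)) = (fP \<circ> snd) (s, a, r)"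
    by auto
  have "continuous_map X Z (F \<circ> Pair 0)"
    by (rule continuous_map_o_Pair[OF F(1)]) simp
  then show ?thesis
    using F(2,3) by (intro exI[of _ "F \<circ> Pair 0"]) simp
qed

end

section \<open>Homotopy invariance of cone attachments\<close>

text \<open>The parameter runs through [0, 2]: up to 1 it follows the cone, beyond 1 the track of
  \<open>H\<close>, which acts as a collar around the base of the cone.\<close>

definition lengthened_cone :: "('c \<times> real \<Rightarrow> 'x) \<Rightarrow> (real \<times> 'c \<Rightarrow> 'x) \<Rightarrow> 'c \<Rightarrow> real \<Rightarrow> 'x" where
  "lengthened_cone c H a r = (if r \<le> 1 then c (a, r) else H (r - 1, a))"

lemma continuous_map_lengthened_cone:
  assumes c: "continuous_map (prod_topology A unit_interval) X c"
    and H: "continuous_map (prod_topology unit_interval A) X H"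
    and eq: "\<And>a. a \<in> topspace A \<Longrightarrow> c (a, 1) = H (0, a)"
    and \<alpha>: "continuous_map Z A \<alpha>" and \<rho>: "continuous_map Z euclideanreal \<rho>"
    and bounds: "\<And>z. z \<in> topspace Z \<Longrightarrow> 0 \<le> \<rho> z \<and> \<rho> z \<le> 2"
  shows "continuous_map Z X (\<lambda>z. lengthened_cone c H (\<alpha> z) (\<rho> z))"
proof -
  have "continuous_map Z (prod_topology A unit_interval) (\<lambda>z. (\<alpha> z, min 1 (\<rho> z)))"
    using \<rho> bounds by (intro continuous_map_pairedI \<alpha>)
      (auto simp: continuous_map_unit_interval_iff intro!: continuous_map_real_min)
  from continuous_map_compose[OF this c]
  have 1: "continuous_map Z X (\<lambda>z. c (\<alpha> z, min 1 (\<rho> z)))"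
    by (simp add: o_def)
  have "continuous_map Z (prod_topology unit_interval A) (\<lambda>z. (max 0 (\<rho> z - 1), \<alpha> z))"
    using \<rho> bounds by (intro continuous_map_pairedI \<alpha>)
      (auto simp: continuous_map_unit_interval_iff intro!: continuous_map_real_max continuous_map_diff)
  from continuous_map_compose[OF this H]
  have 2: "continuous_map Z X (\<lambda>z. H (max 0 (\<rho> z - 1), \<alpha> z))"
    by (simp add: o_def)
  have "\<alpha> z \<in> topspace A" if "z \<in> topspace Z" for z
    using \<alpha> that by (auto simp: continuous_map_def)
  then have "continuous_map Z X
      (\<lambda>z. if \<rho> z \<le> 1 then c (\<alpha> z, min 1 (\<rho> z)) else H (max 0 (\<rho> z - 1), \<alpha> z))"
    by (intro continuous_map_split_at 1 2 \<rho>) (simp add: eq)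
  then show ?thesis
    by (rule continuous_map_eq) (auto simp: lengthened_cone_def)
qed

text \<open>The equivalences \<open>F\<close> and \<open>G\<close> map the inner half of a cone onto the whole cone, and follow in the
  outer half the homotopy between the attaching maps. Up to the deformation of \<open>L\<close>, both composites
  run along the lengthened cone forth and back, as described by \<open>m\<close>, and are thus homotopic to the
  identity by the straight line from \<open>m\<close> to the identity of the interval.\<close>

theorem cone_attachment_homotopy_equivalent:
  assumes X: "cone_attachment X L A \<phi> p i c" and X': "cone_attachment X' Y A \<psi> p i' c'"
    and g: "continuous_map Y L g" and h: "continuous_map L Y h"
    and hg: "\<And>y. y \<in> topspace Y \<Longrightarrow> h (g y) = y"
    and defo: "homotopic_with (\<lambda>k. \<forall>y\<in>topspace Y. k (g y) = g y) L L id (g \<circ> h)"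
    and attaching: "homotopic_with (\<lambda>k. True) A L \<phi> (g \<circ> \<psi>)"
  shows "X homotopy_equivalent_space X'"
proof -
  interpret X: cone_attachment X L A \<phi> p i c by fact
  interpret X': cone_attachment X' Y A \<psi> p i' c' by fact
  obtain D where D: "continuous_map (prod_topology unit_interval L) L D"
    "\<And>l. D (0, l) = l" "\<And>l. D (1, l) = g (h l)"
    and D_rel: "\<And>s y. \<lbrakk>0 \<le> s; s \<le> 1; y \<in> topspace Y\<rbrakk> \<Longrightarrow> D (s, g y) = g y"
    using defo unfolding homotopic_with_def by auto
  obtain K where K: "continuous_map (prod_topology unit_interval A) L K"
    "\<And>a. K (0, a) = \<phi> a" "\<And>a. K (1, a) = g (\<psi> a)"
    using attaching unfolding homotopic_with_def by auto
  have K_in: "K (s, a) \<in> topspace L" if "0 \<le> s" "s \<le> 1" "a \<in> topspace A" for s a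
    using K(1) that by (auto simp: continuous_map_def Pi_iff)
  have in_simps: "y \<in> topspace Y \<Longrightarrow> g y \<in> topspace L" "l \<in> topspace L \<Longrightarrow> h l \<in> topspace Y" for y l
    using g h by (auto simp: continuous_map_def)
  define C where "C = lengthened_cone c (\<lambda>z. i (K z))"
  \<comment> \<open>The homotopy is run backwards and projected by \<open>h\<close>, so that the
    collar starts at \<open>h (g (\<psi> a)) = \<psi> a\<close>, where \<open>c'\<close> ends, and
    finishes at \<open>h (\<phi> a)\<close>, where \<open>F\<close> has to meet the base.\<close>
  define C' where "C' = lengthened_cone c' (\<lambda>(s, a). i' (h (K (1 - s, a))))"
  have C: "continuous_map Z X (\<lambda>z. C (\<alpha> z) (\<rho> z))"
    if "continuous_map Z A \<alpha>" "continuous_map Z euclideanreal \<rho>"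
      "\<And>z. z \<in> topspace Z \<Longrightarrow> 0 \<le> \<rho> z \<and> \<rho> z \<le> 2" for Z :: "'z topology" and \<alpha> \<rho>
    unfolding C_def
    by (rule continuous_map_lengthened_cone[OF X.cont_cone _ _ that])
      (use continuous_map_compose[OF K(1) X.cont_base] K(2) in \<open>simp_all add: o_def\<close>)
  have "continuous_map (prod_topology unit_interval A) L (\<lambda>(s, a). K (1 - s, a))"
  proof -
    have "continuous_map (prod_topology unit_interval A) (prod_topology unit_interval A)
        (\<lambda>z. (1 - fst z, snd z))"
      by (intro continuous_map_pairedI continuous_map_snd)
        (auto simp: continuous_map_unit_interval_iff
          intro!: continuous_map_diff continuous_map_into_fulltopology[OF continuous_map_fst])
    from continuous_map_compose[OF this K(1)] show ?thesis
      by (simp add: o_def case_prod_unfold)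
  qed
  from continuous_map_compose[OF continuous_map_compose[OF this h] X'.cont_base]
  have "continuous_map (prod_topology unit_interval A) X' (\<lambda>(s, a). i' (h (K (1 - s, a))))"
    by (simp add: o_def case_prod_unfold)
  then have C': "continuous_map Z X' (\<lambda>z. C' (\<alpha> z) (\<rho> z))"
    if "continuous_map Z A \<alpha>" "continuous_map Z euclideanreal \<rho>"
      "\<And>z. z \<in> topspace Z \<Longrightarrow> 0 \<le> \<rho> z \<and> \<rho> z \<le> 2" for Z :: "'z topology" and \<alpha> \<rho>
    unfolding C'_def
    by (rule continuous_map_lengthened_cone[OF X'.cont_cone _ _ that])
      (use hg X'.attaching_in K(3) in simp_all)
  have C_simps: "r \<le> 1 \<Longrightarrow> C a r = c (a, r)" "r > 1 \<Longrightarrow> C a r = i (K (r - 1, a))"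
    "a \<in> topspace A \<Longrightarrow> r \<ge> 1 \<Longrightarrow> C a r = i (K (r - 1, a))" for a r
    using K(2)[of a] by (auto simp: C_def lengthened_cone_def le_less)
  have C'_simps: "r \<le> 1 \<Longrightarrow> C' a r = c' (a, r)" "r > 1 \<Longrightarrow> C' a r = i' (h (K (2 - r, a)))"
    "a \<in> topspace A \<Longrightarrow> r \<ge> 1 \<Longrightarrow> C' a r = i' (h (K (2 - r, a)))" for a r
    using K(3)[of a] hg[OF X'.attaching_in, of a] by (auto simp: C'_def lengthened_cone_def le_less)
  have real_fst: "continuous_map (prod_topology unit_interval T) euclideanreal fst"
    and real_snd: "continuous_map (prod_topology T unit_interval) euclideanreal snd"
    for T :: "'z topology"
    by (auto intro: continuous_map_into_fulltopology continuous_map_fst continuous_map_snd)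
  have cont_A: "continuous_map (prod_topology unit_interval (prod_topology A unit_interval)) A (\<lambda>z. fst (snd z))"
    and cont_r: "continuous_map (prod_topology unit_interval (prod_topology A unit_interval))
      euclideanreal (\<lambda>z. snd (snd z))"
    using continuous_map_compose[OF continuous_map_snd continuous_map_fst]
      continuous_map_compose[OF continuous_map_snd real_snd] by (fastforce simp: o_def)+
  \<comment> \<open>Doubling the parameter stretches a cone of length 1 over the lengthened cone of
    length 2.\<close>
  define FA where "FA z = C' (fst z) (2 * snd z)" for z
  have FA: "continuous_map (prod_topology A unit_interval) X' FA"
    unfolding FA_def by (rule C') (auto intro!: continuous_map_fst continuous_map_real_mult_left real_snd)
  have "FA (a, 1) = (i' \<circ> h) (\<phi> a)" if "a \<in> topspace A" for a
    using that by (simp add: FA_def C'_simps K)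
  moreover have "FA (a, 0) = FA (a', 0)" if "a \<in> topspace A" "a' \<in> topspace A" "p a = p a'" for a a'
    using X'.cone_0[OF that] by (simp add: FA_def C'_simps)
  ultimately obtain F where F: "continuous_map X X' F"
    "\<forall>l\<in>topspace L. F (i l) = (i' \<circ> h) l"
    "\<forall>a\<in>topspace A. \<forall>r\<in>{0..1}. F (c (a, r)) = FA (a, r)"
    using X.map_lift[OF continuous_map_compose[OF h X'.cont_base] FA] by blast
  have Fi: "F (i l) = i' (h l)" if "l \<in> topspace L" for l
    using F(2) that by simp
  have Fc: "F (c (a, r)) = C' a (2 * r)" if "a \<in> topspace A" "0 \<le> r" "r \<le> 1" for a r
    using F(3) that by (simp add: FA_def)
  define GA where "GA z = C (fst z) (2 * snd z)" for z
  have GA: "continuous_map (prod_topology A unit_interval) X GA"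
    unfolding GA_def by (rule C) (auto intro!: continuous_map_fst continuous_map_real_mult_left real_snd)
  have "GA (a, 1) = (i \<circ> g) (\<psi> a)" if "a \<in> topspace A" for a
    using that by (simp add: GA_def C_simps K)
  moreover have "GA (a, 0) = GA (a', 0)" if "a \<in> topspace A" "a' \<in> topspace A" "p a = p a'" for a a'
    using X.cone_0[OF that] by (simp add: GA_def C_simps)
  ultimately obtain G where G: "continuous_map X' X G"
    "\<forall>y\<in>topspace Y. G (i' y) = (i \<circ> g) y"
    "\<forall>a\<in>topspace A. \<forall>r\<in>{0..1}. G (c' (a, r)) = GA (a, r)"
    using X'.map_lift[OF continuous_map_compose[OF g X.cont_base] GA] by blast
  have Gi: "G (i' y) = i (g y)" if "y \<in> topspace Y" for y
    using G(2) that by simp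
  have Gc: "G (c' (a, r)) = C a (2 * r)" if "a \<in> topspace A" "0 \<le> r" "r \<le> 1" for a r
    using G(3) that by (simp add: GA_def)
  have FC: "F (C a r) = C' a (2 * r)" if "a \<in> topspace A" "0 \<le> r" "r \<le> 1" for a r
    using that Fc by (simp add: C_simps)
  \<comment> \<open>The composite of the two doublings gives \<open>4 * r\<close> up to parameter 2
    at \<open>r = 1/2\<close>. Beyond that, \<open>G\<close> is in the collar at time
    \<open>2 * r - 1\<close> of \<open>K\<close>, which sits in \<open>C'\<close> at the parameter
    \<open>q\<close> with \<open>2 - q = 2 * r - 1\<close>, that is
    \<open>3 - 2 * r\<close>.\<close>
  define m :: "real \<Rightarrow> real" where "m r = min (4 * r) (3 - 2 * r)" for r
  define w :: "real \<times> 'c \<times> real \<Rightarrow> real"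
    where "w z = (1 - fst z) * m (snd (snd z)) + fst z * snd (snd z)" for z
  have w: "continuous_map (prod_topology unit_interval (prod_topology A unit_interval)) euclideanreal w"
    unfolding w_def m_def
    by (intro continuous_map_add continuous_map_real_mult continuous_map_diff continuous_map_real_min
        real_fst cont_r continuous_map_const[THEN iffD2]) auto
  have w_bounds: "0 \<le> w z \<and> w z \<le> 2"
    if "z \<in> topspace (prod_topology unit_interval (prod_topology A unit_interval))" for z
  proof -
    obtain s a r where z: "z = (s, a, r)" by (metis surj_pair)
    have sr: "0 \<le> s" "s \<le> 1" "0 \<le> r" "r \<le> 1" using that z by auto
    then have "0 \<le> m r" "m r \<le> 2" by (auto simp: m_def)
    then have "0 \<le> (1 - s) * m r" "(1 - s) * m r \<le> (1 - s) * 2" "0 \<le> s * r" "s * r \<le> s * 2"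
      using sr mult_left_mono[of "m r" 2 "1 - s"] mult_left_mono[of r 2 s] by simp_all
    then show ?thesis by (simp add: w_def z)
  qed
  \<comment> \<open>The values at \<open>r = 0\<close> and \<open>r = 1\<close> do not move with
    \<open>s\<close>; hence the interpolation respects apices and gluing.\<close>
  have w_simps: "w (s, a, 0) = 0" "w (s, a, 1) = 1" "w (0, a, r) = m r" "w (1, a, r) = r" for s a r
    by (auto simp: w_def m_def)

  have FG: "homotopic_with (\<lambda>x. True) X' X' (F \<circ> G) id"
  proof -
    define HA where "HA z = C' (fst (snd z)) (w z)" for z
    have HA: "continuous_map (prod_topology unit_interval (prod_topology A unit_interval)) X' HA"
      unfolding HA_def by (rule C'[OF cont_A w w_bounds])
    have glue: "HA (s, a, 1) = (i' \<circ> snd) (s, \<psi> a)" if "a \<in> topspace A" for s a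
      using that by (simp add: HA_def C'_simps w_simps)
    have apex: "HA (s, a, 0) = HA (s, a', 0)"
      if "a \<in> topspace A" "a' \<in> topspace A" "p a = p a'" for s a a'
      using X'.cone_0[OF that] by (simp add: HA_def C'_simps w_simps)
    have "\<exists>H. continuous_map (prod_topology unit_interval X') X' H \<and>
        (\<forall>s\<in>{0..1}. \<forall>l\<in>topspace Y. H (s, i' l) = (i' \<circ> snd) (s, l)) \<and>
        (\<forall>s\<in>{0..1}. \<forall>a\<in>topspace A. \<forall>r\<in>{0..1}. H (s, c' (a, r)) = HA (s, a, r))"
      by (rule X'.homotopy_lift[OF continuous_map_compose[OF continuous_map_snd X'.cont_base] HA])
        (rule glue, assumption+, rule apex, assumption+)
    then obtain H where H: "continuous_map (prod_topology unit_interval X') X' H"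
      "\<forall>s\<in>{0..1}. \<forall>l\<in>topspace Y. H (s, i' l) = (i' \<circ> snd) (s, l)"
      "\<forall>s\<in>{0..1}. \<forall>a\<in>topspace A. \<forall>r\<in>{0..1}. H (s, c' (a, r)) = HA (s, a, r)"
      by auto
    have Hi: "H (s, i' l) = i' l" if "0 \<le> s" "s \<le> 1" "l \<in> topspace Y" for s l
      using H(2) that by simp
    have Hc: "H (s, c' (a, r)) = C' a (w (s, a, r))"
      if "0 \<le> s" "s \<le> 1" "a \<in> topspace A" "0 \<le> r" "r \<le> 1" for s a r
      using H(3) that by (simp add: HA_def)
    have ends: "H (0, x) = (F \<circ> G) x \<and> H (1, x) = id x" if "x \<in> topspace X'" for x
      using that
    proof (cases rule: X'.point_cases)
      case (base l)
      then show ?thesis by (simp add: Hi Fi Gi hg in_simps)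
    next
      case (cone a r)
      have "C' a (m r) = F (C a (2 * r))"
      proof (cases "r \<le> 1/2")
        case True
        then have "m r = 2 * (2 * r)" by (simp add: m_def)
        with True cone show ?thesis by (simp add: FC)
      next
        case False
        then have "m r = 3 - 2 * r" using cone by (simp add: m_def)
        with False cone show ?thesis by (simp add: C_simps C'_simps Fi K_in)
      qed
      with cone show ?thesis by (simp add: Hc Gc w_simps C'_simps)
    qed
    show ?thesis
      by (subst homotopic_with) (use H(1) ends in auto)
  qed
  \<comment> \<open>Unlike \<open>h \<circ> g\<close>, the composite \<open>g \<circ> h\<close> is
    not the identity, so a further homotopy \<open>J\<close> has to undo the deformation
    \<open>D\<close> before the parameter can be straightened by \<open>H\<close>.\<close>
  have GF: "homotopic_with (\<lambda>x. True) X X (G \<circ> F) id"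
  proof -
    define HA where "HA z = C (fst (snd z)) (w z)" for z
    have HA: "continuous_map (prod_topology unit_interval (prod_topology A unit_interval)) X HA"
      unfolding HA_def by (rule C[OF cont_A w w_bounds])
    have glue: "HA (s, a, 1) = (i \<circ> snd) (s, \<phi> a)" if "a \<in> topspace A" for s a
      using that by (simp add: HA_def C_simps w_simps)
    have apex: "HA (s, a, 0) = HA (s, a', 0)"
      if "a \<in> topspace A" "a' \<in> topspace A" "p a = p a'" for s a a'
      using X.cone_0[OF that] by (simp add: HA_def C_simps w_simps)
    have "\<exists>H. continuous_map (prod_topology unit_interval X) X H \<and>
        (\<forall>s\<in>{0..1}. \<forall>l\<in>topspace L. H (s, i l) = (i \<circ> snd) (s, l)) \<and>
        (\<forall>s\<in>{0..1}. \<forall>a\<in>topspace A. \<forall>r\<in>{0..1}. H (s, c (a, r)) = HA (s, a, r))"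
      by (rule X.homotopy_lift[OF continuous_map_compose[OF continuous_map_snd X.cont_base] HA])
        (rule glue, assumption+, rule apex, assumption+)
    then obtain H where H: "continuous_map (prod_topology unit_interval X) X H"
      "\<forall>s\<in>{0..1}. \<forall>l\<in>topspace L. H (s, i l) = (i \<circ> snd) (s, l)"
      "\<forall>s\<in>{0..1}. \<forall>a\<in>topspace A. \<forall>r\<in>{0..1}. H (s, c (a, r)) = HA (s, a, r)"
      by auto
    have Hi: "H (s, i l) = i l" if "0 \<le> s" "s \<le> 1" "l \<in> topspace L" for s l
      using H(2) that by simp
    have Hc: "H (s, c (a, r)) = C a (w (s, a, r))"
      if "0 \<le> s" "s \<le> 1" "a \<in> topspace A" "0 \<le> r" "r \<le> 1" for s a r
      using H(3) that by (simp add: HA_def)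
    \<comment> \<open>On the outer half, \<open>G \<circ> F\<close> yields
      \<open>g (h k) = D (1, k)\<close> for \<open>k = K (2 - 2 * r, a)\<close>, and running
      \<open>D\<close> backwards leads to \<open>k\<close>. At \<open>r = 1/2\<close> the point is
      \<open>g (\<psi> a)\<close>, which \<open>D\<close> fixes, so the inner half can stay at rest;
      at \<open>r = 1\<close> it is \<open>\<phi> a\<close>, in agreement with \<open>D\<close> on
      the base.\<close>
    define E where "E z = (if snd (snd z) \<le> 1/2 then C (fst (snd z)) (min 2 (4 * snd (snd z)))
        else i (D (1 - fst z, K (min 1 (2 - 2 * snd (snd z)), fst (snd z)))))"
      for z :: "real \<times> 'c \<times> real"
    have E: "continuous_map (prod_topology unit_interval (prod_topology A unit_interval)) X E"
      unfolding E_def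
    proof (rule continuous_map_split_at[OF cont_r])
      show "continuous_map (prod_topology unit_interval (prod_topology A unit_interval)) X
          (\<lambda>z. C (fst (snd z)) (min 2 (4 * snd (snd z))))"
        by (rule C[OF cont_A])
          (auto intro!: continuous_map_real_min continuous_map_real_mult_left cont_r)
      have "continuous_map (prod_topology unit_interval (prod_topology A unit_interval))
          (prod_topology unit_interval A) (\<lambda>z. (min 1 (2 - 2 * snd (snd z)), fst (snd z)))"
        by (intro continuous_map_pairedI cont_A)
          (auto simp: continuous_map_unit_interval_iff
            intro!: continuous_map_real_min continuous_map_diff continuous_map_real_mult_left cont_r)
      from continuous_map_compose[OF this K(1)]
      have "continuous_map (prod_topology unit_interval (prod_topology A unit_interval))
          (prod_topology unit_interval L)
          (\<lambda>z. (1 - fst z, K (min 1 (2 - 2 * snd (snd z)), fst (snd z))))"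
        by (intro continuous_map_pairedI)
          (auto simp: continuous_map_unit_interval_iff o_def intro!: continuous_map_diff real_fst)
      from continuous_map_compose[OF continuous_map_compose[OF this D(1)] X.cont_base]
      show "continuous_map (prod_topology unit_interval (prod_topology A unit_interval)) X
          (\<lambda>z. i (D (1 - fst z, K (min 1 (2 - 2 * snd (snd z)), fst (snd z)))))"
        by (simp add: o_def)
    qed (auto simp: C_simps K D_rel X'.attaching_in)
    have "continuous_map (prod_topology unit_interval L) (prod_topology unit_interval L)
        (\<lambda>z. (1 - fst z, snd z))"
      by (intro continuous_map_pairedI continuous_map_snd)
        (auto simp: continuous_map_unit_interval_iff intro!: continuous_map_diff real_fst)
    from continuous_map_compose[OF continuous_map_compose[OF this D(1)] X.cont_base]
    have EL: "continuous_map (prod_topology unit_interval L) X (i \<circ> (D \<circ> (\<lambda>z. (1 - fst z, snd z))))"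
      by simp
    have glue: "E (s, a, 1) = (i \<circ> (D \<circ> (\<lambda>z. (1 - fst z, snd z)))) (s, \<phi> a)" for s a
      by (simp add: E_def K)
    have apex: "E (s, a, 0) = E (s, a', 0)"
      if "a \<in> topspace A" "a' \<in> topspace A" "p a = p a'" for s a a'
      using X.cone_0[OF that] by (simp add: E_def C_simps)
    have "\<exists>J. continuous_map (prod_topology unit_interval X) X J \<and>
        (\<forall>s\<in>{0..1}. \<forall>l\<in>topspace L. J (s, i l) = (i \<circ> (D \<circ> (\<lambda>z. (1 - fst z, snd z)))) (s, l)) \<and>
        (\<forall>s\<in>{0..1}. \<forall>a\<in>topspace A. \<forall>r\<in>{0..1}. J (s, c (a, r)) = E (s, a, r))"
      by (rule X.homotopy_lift[OF EL E])
        (rule glue, rule apex, assumption+)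
    then obtain J where J: "continuous_map (prod_topology unit_interval X) X J"
      "\<forall>s\<in>{0..1}. \<forall>l\<in>topspace L. J (s, i l) = (i \<circ> (D \<circ> (\<lambda>z. (1 - fst z, snd z)))) (s, l)"
      "\<forall>s\<in>{0..1}. \<forall>a\<in>topspace A. \<forall>r\<in>{0..1}. J (s, c (a, r)) = E (s, a, r)"
      by auto
    have Ji: "J (s, i l) = i (D (1 - s, l))" if "0 \<le> s" "s \<le> 1" "l \<in> topspace L" for s l
      using J(2) that by simp
    have Jc: "J (s, c (a, r)) = E (s, a, r)"
      if "0 \<le> s" "s \<le> 1" "a \<in> topspace A" "0 \<le> r" "r \<le> 1" for s a r
      using J(3) that by simp
    have ends: "J (0, x) = (G \<circ> F) x \<and> J (1, x) = H (0, x) \<and> H (1, x) = id x"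
      if "x \<in> topspace X" for x
      using that
    proof (cases rule: X.point_cases)
      case (base l)
      then show ?thesis by (simp add: Hi Ji Fi Gi D in_simps)
    next
      case (cone a r)
      have "E (0, a, r) = G (C' a (2 * r)) \<and> E (1, a, r) = C a (m r)"
      proof (cases "r \<le> 1/2")
        case True
        then have "m r = 4 * r" by (simp add: m_def)
        with True cone show ?thesis by (simp add: E_def Gc C'_simps)
      next
        case False
        then have "m r = 3 - 2 * r" using cone by (simp add: m_def)
        with False cone show ?thesis by (simp add: E_def Gi C_simps C'_simps D K_in in_simps)
      qed
      with cone show ?thesis by (simp add: Hc Jc Fc w_simps C_simps)
    qed
    have "homotopic_with (\<lambda>x. True) X X (G \<circ> F) (H \<circ> Pair 0)"
      by (subst homotopic_with) (use J(1) ends in auto)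
    moreover have "homotopic_with (\<lambda>x. True) X X (H \<circ> Pair 0) id"
      by (subst homotopic_with) (use H(1) ends in auto)
    ultimately show ?thesis
      by (rule homotopic_with_trans)
  qed
  show ?thesis
    unfolding homotopy_equivalent_space_def using F(1) G(1) FG GF by blast
qed

section \<open>Attached copies of a pointed space as attached cones\<close>

lemma quotient_map_map_sum:
  assumes "quotient_map Y Y' f"
  shows "quotient_map (disjoint_sum X Y) (disjoint_sum X Y') (map_sum id f)"
  unfolding quotient_map_def
proof (intro conjI allI impI)
  have im: "f ` topspace Y = topspace Y'"
    using assms by (simp add: quotient_map_def)
  show "map_sum id f ` topspace (disjoint_sum X Y) = topspace (disjoint_sum X Y')"
    using im by (force simp: image_iff)
  fix U :: "('c + 'b) set"
  assume U: "U \<subseteq> topspace (disjoint_sum X Y')"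
  have "Inl -` {x \<in> topspace (disjoint_sum X Y). map_sum id f x \<in> U} = Inl -` U"
    using U by auto
  moreover have "Inr -` {x \<in> topspace (disjoint_sum X Y). map_sum id f x \<in> U}
      = {y \<in> topspace Y. f y \<in> Inr -` U}"
    by auto
  moreover have "Inr -` U \<subseteq> topspace Y'"
    using U by auto
  ultimately show "openin (disjoint_sum X Y) {x \<in> topspace (disjoint_sum X Y). map_sum id f x \<in> U}
      = openin (disjoint_sum X Y') U"
    using assms U by (auto simp: openin_disjoint_sum quotient_map_def)
qed

text \<open>Over a discrete index set openness can be tested on each slice separately, and on the
  slice over \<open>t\<close> it is the quotient property of \<open>\<kappa>\<close>;
  \<open>V t\<close> is that slice of the preimage.\<close>

lemma quotient_map_copies:
  assumes "quotient_map (prod_topology A T) Y \<kappa>"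
  shows "quotient_map (prod_topology (prod_topology (discrete_topology I) A) T) (sum_topology (\<lambda>_. Y) I)
    (\<lambda>((t, a), r). (t, \<kappa> (a, r)))" (is "quotient_map ?P ?Y ?q")
  unfolding quotient_map_def
proof (intro conjI allI impI)
  have im: "\<kappa> ` (topspace A \<times> topspace T) = topspace Y"
    using assms by (simp add: quotient_map_def)
  then have "\<kappa> (a, r) \<in> topspace Y" if "a \<in> topspace A" "r \<in> topspace T" for a r
    using that by blast
  then have in_Y: "?q ` topspace ?P \<subseteq> topspace ?Y"
    by auto
  moreover have "(t, y) \<in> ?q ` topspace ?P" if t: "t \<in> I" and y: "y \<in> topspace Y" for t y
  proof -
    have "y \<in> \<kappa> ` (topspace A \<times> topspace T)" using y im by simp
    then obtain a r where "a \<in> topspace A" "r \<in> topspace T" "y = \<kappa> (a, r)"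
      by auto
    with t show ?thesis
      by (intro image_eqI[of _ _ "((t, a), r)"]) auto
  qed
  ultimately show "?q ` topspace ?P = topspace ?Y"
    by auto
  fix U assume U: "U \<subseteq> topspace ?Y"
  define V where "V t = {x \<in> topspace (prod_topology A T). \<kappa> x \<in> {y. (t, y) \<in> U}}" for t
  have V: "openin (prod_topology A T) (V t) \<longleftrightarrow> openin Y {y. (t, y) \<in> U}" for t
  proof -
    have "{y. (t, y) \<in> U} \<subseteq> topspace Y" using U by auto
    then show ?thesis using assms unfolding V_def quotient_map_def by blast
  qed
  show "openin ?P {x \<in> topspace ?P. ?q x \<in> U} = openin ?Y U"
  proof
    assume open_P: "openin ?P {x \<in> topspace ?P. ?q x \<in> U}"
    have "openin (prod_topology A T) (V t)" if t: "t \<in> I" for t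
    proof -
      have "continuous_map (prod_topology A T) ?P (\<lambda>(a, r). ((t, a), r))"
        unfolding case_prod_unfold
        by (intro continuous_map_pairedI continuous_map_fst continuous_map_snd) (simp add: t)
      from openin_continuous_map_preimage[OF this open_P]
      have "openin (prod_topology A T)
          {x \<in> topspace (prod_topology A T). (\<lambda>(a, r). ((t, a), r)) x \<in> {x \<in> topspace ?P. ?q x \<in> U}}" .
      also have "{x \<in> topspace (prod_topology A T). (\<lambda>(a, r). ((t, a), r)) x \<in> {x \<in> topspace ?P. ?q x \<in> U}} = V t"
        using t by (auto simp: V_def)
      finally show ?thesis .
    qed
    then show "openin ?Y U"
      using U V by (auto simp: openin_sum_topology)
  next
    assume open_Y: "openin ?Y U"
    have cont: "continuous_map ?P (discrete_topology I) (\<lambda>z. fst (fst z))"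
      "continuous_map ?P (prod_topology A T) (\<lambda>z. (snd (fst z), snd z))"
    proof -
      note fst2 = continuous_map_compose[OF continuous_map_fst[of "prod_topology (discrete_topology I) A" T]]
      show "continuous_map ?P (discrete_topology I) (\<lambda>z. fst (fst z))"
        using fst2[OF continuous_map_fst] by (simp add: o_def)
      show "continuous_map ?P (prod_topology A T) (\<lambda>z. (snd (fst z), snd z))"
        using fst2[OF continuous_map_snd]
        by (intro continuous_map_pairedI continuous_map_snd) (simp add: o_def)
    qed
    have "openin ?P ({z \<in> topspace ?P. fst (fst z) \<in> {t}} \<inter> {z \<in> topspace ?P. (snd (fst z), snd z) \<in> V t})"
      if t: "t \<in> I" for t
      using open_Y t V
      by (intro openin_Int openin_continuous_map_preimage[OF cont(1)] openin_continuous_map_preimage[OF cont(2)])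
        (auto simp: openin_sum_topology)
    then have "openin ?P (\<Union>t\<in>I. {z \<in> topspace ?P. fst (fst z) \<in> {t}} \<inter> {z \<in> topspace ?P. (snd (fst z), snd z) \<in> V t})"
      by blast
    also have "(\<Union>t\<in>I. {z \<in> topspace ?P. fst (fst z) \<in> {t}} \<inter> {z \<in> topspace ?P. (snd (fst z), snd z) \<in> V t})
        = {x \<in> topspace ?P. ?q x \<in> U}"
      by (auto simp: V_def)
    finally show "openin ?P {x \<in> topspace ?P. ?q x \<in> U}" .
  qed
qed

text \<open>If \<open>Y\<close> is a cone whose base is shrunk to the point \<open>y\<close>, then
  attaching \<open>Y\<close> at \<open>b t\<close> is the same as attaching the cone along the
  constant map to \<open>b t\<close>. Each copy has its own apex, hence \<open>p\<close> is
  \<open>fst\<close>.\<close>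

lemma cone_attachment_attach_copies:
  assumes \<kappa>: "quotient_map (prod_topology A unit_interval) Y \<kappa>"
    and base: "\<And>a r. \<lbrakk>a \<in> topspace A; 0 \<le> r; r \<le> 1\<rbrakk> \<Longrightarrow> \<kappa> (a, r) = y \<longleftrightarrow> r = 1"
    and fibres: "\<And>a a' r r'. \<lbrakk>a \<in> topspace A; a' \<in> topspace A; 0 \<le> r; r < 1; 0 \<le> r'; r' < 1\<rbrakk>
      \<Longrightarrow> \<kappa> (a, r) = \<kappa> (a', r') \<longleftrightarrow> r = r' \<and> (a = a' \<or> r = 0)"
    and b: "b \<in> I \<rightarrow> topspace X"
  shows "cone_attachment (attach_copies X I b Y y) X (prod_topology (discrete_topology I) A)
    (b \<circ> fst) fst Inl (\<lambda>((t, a), r). if r = 1 then Inl (b t) else Inr (t, \<kappa> (a, r)))"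
proof
  let ?P = "prod_topology (prod_topology (discrete_topology I) A) unit_interval"
  let ?q = "\<lambda>z. case z of Inl p \<Rightarrow> Inl p | Inr (i, s) \<Rightarrow> if s = y then Inl (b i) else Inr (i, s)"
  let ?c = "\<lambda>((t, a), r). if r = 1 then Inl (b t) else Inr (t, \<kappa> (a, r))"
  have "quotient_map (disjoint_sum X ?P) (attach_copies X I b Y y)
      (?q \<circ> map_sum id (\<lambda>((t, a), r). (t, \<kappa> (a, r))))"
    unfolding attach_copies_def
    by (rule quotient_map_compose[OF quotient_map_map_sum[OF quotient_map_copies[OF \<kappa>]]
          quotient_map_quotient_topology])
  then show "quotient_map (disjoint_sum X ?P) (attach_copies X I b Y y) (case_sum Inl ?c)"
  proof (rule quotient_map_eq)
    fix z assume "z \<in> topspace (disjoint_sum X ?P)"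
    then show "(?q \<circ> map_sum id (\<lambda>((t, a), r). (t, \<kappa> (a, r)))) z = case_sum Inl ?c z"
      by (auto simp: base)
  qed
  show "continuous_map (prod_topology (discrete_topology I) A) X (b \<circ> fst)"
    using b by (intro continuous_map_compose[OF continuous_map_fst]) auto
  show "inj_on Inl (topspace X)"
    by simp
  show "Inl l = ?c (a, r) \<longleftrightarrow> r = 1 \<and> l = (b \<circ> fst) a"
    if "a \<in> topspace (prod_topology (discrete_topology I) A)" for l a r
    by (cases a) auto
  show "?c (a, r) = ?c (a', r') \<longleftrightarrow> r = r' \<and> (a = a' \<or> r = 0 \<and> fst a = fst a')"
    if "a \<in> topspace (prod_topology (discrete_topology I) A)"
      "a' \<in> topspace (prod_topology (discrete_topology I) A)" "0 \<le> r" "r < 1" "0 \<le> r'" "r' < 1" for a a' r r'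
    using that fibres[of "snd a" "snd a'" r r'] by (cases a; cases a') auto
qed

section \<open>The sphere as a quotient of a cone\<close>

text \<open>The boundary of the standard 2-simplex in barycentric coordinates; the three coordinates
  will be the weights of the three sides of a triangle of \<open>G\<close>.\<close>

definition triangle_boundary :: "(real ^ 3) set" where
  "triangle_boundary = {y. (\<forall>k. 0 \<le> y $ k) \<and> (\<Sum>k\<in>UNIV. y $ k) = 1 \<and> (\<exists>k. y $ k = 0)}"

definition triangle_center :: "real ^ 3" where
  "triangle_center = (\<chi> k. 1 / 3)"

lemma compact_triangle_boundary: "compact triangle_boundary"
proof -
  \<comment> \<open>The vanishing of some coordinate is rewritten as the vanishing of a product,
    which is visibly a closed condition.\<close>
  have eq: "triangle_boundary = (\<Inter>k. {y. 0 \<le> y $ k}) \<inter> {y. (\<Sum>k\<in>UNIV. y $ k) = 1} \<inter> {y. (\<Prod>k\<in>UNIV. y $ k) = 0}"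
    by (auto simp: triangle_boundary_def)
  have "closed triangle_boundary"
    unfolding eq by (intro closed_Int closed_INT ballI closed_Collect_le closed_Collect_eq continuous_intros)
  moreover have "triangle_boundary \<subseteq> cbox 0 1"
  proof
    fix y :: "real ^ 3" assume y: "y \<in> triangle_boundary"
    have "y $ k \<le> (\<Sum>k\<in>UNIV. y $ k)" for k
      using y by (intro member_le_sum) (auto simp: triangle_boundary_def)
    with y show "y \<in> cbox 0 1"
      by (auto simp: triangle_boundary_def mem_box_cart)
  qed
  ultimately show ?thesis
    by (metis bounded_cbox bounded_subset compact_eq_bounded_closed)
qed

lemma triangle_center_notin_boundary: "triangle_center \<notin> triangle_boundary"
  by (auto simp: triangle_boundary_def triangle_center_def)

text \<open>Moving from the centre in a nonzero direction of coordinate sum 0, some coordinate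
  decreases; the ray leaves the simplex when the fastest decreasing one reaches 0.\<close>

lemma triangle_boundary_ray:
  assumes "(\<Sum>k\<in>UNIV. d $ k) = 0" "d \<noteq> 0"
  obtains c where "0 < c" "triangle_center + c *\<^sub>R d \<in> triangle_boundary"
proof -
  define m where "m = - Min (range (($) d))"
  have "Min (range (($) d)) \<in> range (($) d)" by (intro Min_in) auto
  then obtain k0 where k0: "d $ k0 = - m"
    by (metis imageE m_def minus_minus)
  have le: "- m \<le> d $ k" for k
    unfolding m_def minus_minus by (rule Min_le) auto
  have "m > 0"
  proof (rule ccontr)
    assume "\<not> m > 0"
    then have "\<forall>k. 0 \<le> d $ k" using le by (meson le_minus_iff dual_order.trans linorder_not_less neg_0_le_iff_le)
    with assms(1) have "\<forall>k. d $ k = 0" by (simp add: sum_nonneg_eq_0_iff)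
    with assms(2) show False by (simp add: vec_eq_iff)
  qed
  show thesis
  proof
    \<comment> \<open>The smallest entry of \<open>d\<close> is \<open>- m\<close>, and the
      corresponding coordinate starts at 1/3, so it vanishes after the time
      \<open>1 / (3 * m)\<close>.\<close>
    show "0 < 1 / (3 * m)" using \<open>m > 0\<close> by simp
    have nonneg: "0 \<le> 1 / 3 + 1 / (3 * m) * d $ k" for k
      using \<open>m > 0\<close> le[of k] by (simp add: field_simps)
    have zero: "1 / 3 + 1 / (3 * m) * d $ k0 = 0"
      using \<open>m > 0\<close> k0 by (simp add: field_simps)
    have "(\<Sum>k\<in>UNIV. 1 / 3 + 1 / (3 * m) * d $ k) = 1"
      using assms(1) by (simp add: sum.distrib flip: sum_divide_distrib sum_distrib_left)
    with nonneg zero show "triangle_center + (1 / (3 * m)) *\<^sub>R d \<in> triangle_boundary"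
      by (auto simp: triangle_boundary_def triangle_center_def)
  qed
qed

text \<open>Radial projection from the centre identifies the triangle boundary with a unit circle; a
  rotation turns this circle into the equator orthogonal to \<open>s\<close>, and each segment of
  the cone becomes a meridian ending in \<open>s\<close>.\<close>

lemma sphere_as_cone:
  fixes s :: "real ^ 3"
  assumes s: "norm s = 1"
  shows "\<exists>\<kappa>. quotient_map (prod_topology (top_of_set triangle_boundary) unit_interval)
      (top_of_set (sphere 0 1)) \<kappa> \<and>
    (\<forall>a\<in>triangle_boundary. \<forall>r\<in>{0..1}. \<kappa> (a, r) = s \<longleftrightarrow> r = 1) \<and>
    (\<forall>a\<in>triangle_boundary. \<forall>a'\<in>triangle_boundary. \<forall>r\<in>{0..<1}. \<forall>r'\<in>{0..<1}.
      \<kappa> (a, r) = \<kappa> (a', r') \<longleftrightarrow> r = r' \<and> (a = a' \<or> r = 0))"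
proof -
  \<comment> \<open>The unit normal of the plane of vectors with coordinate sum 0, in which the
    boundary lies after moving its centre to the origin.\<close>
  define e :: "real ^ 3" where "e = sgn (\<chi> k. 1)"
  have e: "norm e = 1"
    by (simp add: e_def norm_sgn vec_eq_iff)
  have e_inner: "x \<bullet> e = 0 \<longleftrightarrow> (\<Sum>k\<in>UNIV. x $ k) = 0" for x
  proof -
    have "x \<bullet> e = (x \<bullet> (\<chi> k. 1)) / norm ((\<chi> k. 1) :: real ^ 3)"
      by (simp add: e_def sgn_div_norm divide_inverse)
    then show ?thesis by (simp add: inner_vec_def vec_eq_iff)
  qed
  obtain R where R: "orthogonal_transformation R" "R e = s"
    using orthogonal_transformation_exists_1[OF e s] .
  have linR: "linear R" using R(1) orthogonal_transformation_linear by blast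
  define u where "u a = R (sgn (a - triangle_center))" for a
  have ne: "a \<noteq> triangle_center" if "a \<in> triangle_boundary" for a
    using that triangle_center_notin_boundary by auto
  have norm_u: "norm (u a) = 1" if "a \<in> triangle_boundary" for a
    using ne[OF that] R(1) by (simp add: u_def orthogonal_transformation_norm norm_sgn)
  have u_s: "u a \<bullet> s = 0" if "a \<in> triangle_boundary" for a
  proof -
    have "(a - triangle_center) \<bullet> e = 0"
      using that by (simp add: e_inner triangle_boundary_def triangle_center_def sum_subtractf)
    then have "sgn (a - triangle_center) \<bullet> e = 0"
      by (simp add: sgn_div_norm)
    then show ?thesis
      using R by (metis orthogonal_transformation_def u_def)
  qed
  have u_inj: "a = a'" if a: "a \<in> triangle_boundary" and a': "a' \<in> triangle_boundary" and "u a = u a'" for a a'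
  proof -
    \<comment> \<open>A ray meets the boundary only once: a boundary point pulled strictly towards
      the centre has all coordinates positive, so none of them can vanish.\<close>
    have aux: False if a: "a \<in> triangle_boundary" and a': "a' \<in> triangle_boundary"
      and c: "c < 1" "0 < c" "a - triangle_center = c *\<^sub>R (a' - triangle_center)" for a a' c
    proof -
      obtain k where k: "a $ k = 0" using a by (auto simp: triangle_boundary_def)
      have "a $ k - 1 / 3 = c * (a' $ k - 1 / 3)"
        using arg_cong[OF c(3), of "\<lambda>v. v $ k"] by (simp add: triangle_center_def)
      then have "c * a' $ k = (c - 1) / 3" using k by (simp add: algebra_simps)
      moreover have "0 \<le> c * a' $ k" using a' c by (auto simp: triangle_boundary_def)
      ultimately show False using c by simp
    qed
    have inj: "inj R" using R(1) by (rule orthogonal_transformation_inj)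
    have "sgn (a - triangle_center) = sgn (a' - triangle_center)"
      using that(3) injD[OF inj] by (simp add: u_def)
    then have eq: "(a - triangle_center) /\<^sub>R norm (a - triangle_center) = (a' - triangle_center) /\<^sub>R norm (a' - triangle_center)"
      by (simp add: sgn_div_norm)
    define c where "c = norm (a - triangle_center) / norm (a' - triangle_center)"
    have pos: "0 < norm (a - triangle_center)" "0 < norm (a' - triangle_center)"
      using ne[OF a] ne[OF a'] by auto
    then have "c > 0" by (simp add: c_def)
    have ac: "a - triangle_center = c *\<^sub>R (a' - triangle_center)"
    proof -
      have "a - triangle_center = norm (a - triangle_center) *\<^sub>R ((a - triangle_center) /\<^sub>R norm (a - triangle_center))"
        using pos by simp
      also have "\<dots> = c *\<^sub>R (a' - triangle_center)"
        unfolding eq by (simp add: c_def divide_inverse)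
      finally show ?thesis .
    qed
    then have ca: "a' - triangle_center = (1 / c) *\<^sub>R (a - triangle_center)"
      using \<open>c > 0\<close> by simp
    have "c = 1"
      using aux[OF a a' _ \<open>c > 0\<close> ac] aux[OF a' a _ _ ca] \<open>c > 0\<close> by (cases c "1 :: real" rule: linorder_cases) auto
    with ac show ?thesis by simp
  qed
  have u_surj: "\<exists>a\<in>triangle_boundary. u a = v" if "norm v = 1" "v \<bullet> s = 0" for v
  proof -
    obtain d where d: "R d = v"
      using orthogonal_transformation_surj[OF R(1)] by (metis surjD)
    have nd: "norm d = 1" using d that(1) R(1) by (metis orthogonal_transformation_norm)
    have "d \<bullet> e = 0" using d that(2) R by (metis orthogonal_transformation_def)
    moreover have "d \<noteq> 0" using nd by auto
    ultimately obtain c where c: "0 < c" "triangle_center + c *\<^sub>R d \<in> triangle_boundary"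
      using triangle_boundary_ray e_inner by metis
    have "u (triangle_center + c *\<^sub>R d) = R (sgn d)"
      using c by (simp add: u_def sgn_scaleR)
    also have "\<dots> = v" using nd d by (simp add: sgn_div_norm)
    finally show ?thesis using c(2) by blast
  qed
  \<comment> \<open>The apex goes to \<open>-s\<close>, the base to \<open>s\<close>, and the slice at height \<open>r\<close> to a circle of latitude.\<close>
  define \<kappa> where "\<kappa> = (\<lambda>(a, r). (2 * r\<^sup>2 - 1) *\<^sub>R s + (2 * r * sqrt (1 - r\<^sup>2)) *\<^sub>R u a)"
  have ss: "s \<bullet> s = 1" using s by (simp add: dot_square_norm)
  have height: "\<kappa> (a, r) \<bullet> s = 2 * r\<^sup>2 - 1" if "a \<in> triangle_boundary" for a r
    using u_s[OF that] by (simp add: \<kappa>_def inner_add_left ss)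
  have norm_\<kappa>: "norm (\<kappa> (a, r)) = 1" if a: "a \<in> triangle_boundary" and r: "0 \<le> r" "r \<le> 1" for a r
  proof -
    have "r\<^sup>2 \<le> 1" using r by (simp add: power_le_one)
    then have sq: "(sqrt (1 - r\<^sup>2))\<^sup>2 = 1 - r\<^sup>2" by simp
    have uu: "u a \<bullet> u a = 1" using norm_u[OF a] by (simp add: dot_square_norm)
    have "\<kappa> (a, r) \<bullet> \<kappa> (a, r) = (2 * r\<^sup>2 - 1)\<^sup>2 + (2 * r * sqrt (1 - r\<^sup>2))\<^sup>2"
      using u_s[OF a] by (simp add: \<kappa>_def inner_add_left inner_add_right ss uu inner_commute power2_eq_square)
    also have "\<dots> = 1" using sq by (simp add: power_mult_distrib) (simp add: power2_eq_square algebra_simps)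
    finally show ?thesis by (simp add: norm_eq_1)
  qed
  have cont_u: "continuous_on triangle_boundary u"
    unfolding u_def
    by (intro linear_continuous_on_compose[OF _ linR] continuous_on_sgn continuous_intros) (use ne in auto)
  have cont: "continuous_on (triangle_boundary \<times> {0..1}) \<kappa>"
    unfolding \<kappa>_def case_prod_unfold
    by (intro continuous_intros continuous_on_compose2[OF cont_u]) auto
  have onto: "\<kappa> ` (triangle_boundary \<times> {0..1}) = sphere 0 1"
  proof
    show "\<kappa> ` (triangle_boundary \<times> {0..1}) \<subseteq> sphere 0 1"
      using norm_\<kappa> by auto
    show "sphere 0 1 \<subseteq> \<kappa> ` (triangle_boundary \<times> {0..1})"
    proof
      fix x :: "real ^ 3" assume "x \<in> sphere 0 1"
      then have x: "norm x = 1" by simp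
      define h where "h = x \<bullet> s"
      define q where "q = x - h *\<^sub>R s"
      have h: "\<bar>h\<bar> \<le> 1" using Cauchy_Schwarz_ineq2[of x s] x s by (simp add: h_def)
      have qs: "q \<bullet> s = 0" by (simp add: q_def inner_diff_left ss h_def)
      have xx: "x \<bullet> x = 1" using x by (simp add: dot_square_norm)
      have "q \<bullet> q = 1 - h\<^sup>2"
        by (simp add: q_def inner_diff_left inner_diff_right ss xx h_def inner_commute power2_eq_square algebra_simps)
      then have nq: "norm q = sqrt (1 - h\<^sup>2)" by (simp add: norm_eq_sqrt_inner)
      \<comment> \<open>The solution of \<open>2 * r\<^sup>2 - 1 = h\<close>, since the height of a
        point on a slice is \<open>2 * r\<^sup>2 - 1\<close>.\<close>
      define r where "r = sqrt ((1 + h) / 2)"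
      have r: "0 \<le> r" "r \<le> 1" "r\<^sup>2 = (1 + h) / 2" using h by (auto simp: r_def)
      have "2 * r * sqrt (1 - r\<^sup>2) = sqrt 4 * sqrt ((1 + h) / 2) * sqrt (1 - (1 + h) / 2)"
        unfolding r(3) by (simp add: r_def)
      also have "\<dots> = sqrt (4 * ((1 + h) / 2) * (1 - (1 + h) / 2))"
        by (simp only: real_sqrt_mult)
      also have "4 * ((1 + h) / 2) * (1 - (1 + h) / 2) = 1 - h\<^sup>2"
        by (simp add: power2_eq_square field_simps)
      finally have rq: "2 * r * sqrt (1 - r\<^sup>2) = norm q" using nq by simp
      obtain a where a: "a \<in> triangle_boundary" "norm q *\<^sub>R u a = q"
      proof (cases "q = 0")
        \<comment> \<open>At a pole the direction is irrelevant, and a corner of the triangle serves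
          as \<open>a\<close>.\<close>
        case True
        have "axis 1 1 \<in> triangle_boundary"
          by (auto simp: triangle_boundary_def axis_def intro: exI[of _ 2])
        with True that show ?thesis by simp
      next
        case False
        have "norm (sgn q) = 1" "sgn q \<bullet> s = 0"
          using False qs by (simp_all add: norm_sgn) (simp add: sgn_div_norm qs)
        from u_surj[OF this] obtain a where "a \<in> triangle_boundary" "u a = sgn q" by auto
        with that False show ?thesis by (auto simp: sgn_div_norm)
      qed
      have "\<kappa> (a, r) = x"
        using r(3) by (simp add: \<kappa>_def rq a(2)) (simp add: q_def)
      then show "x \<in> \<kappa> ` (triangle_boundary \<times> {0..1})"
        using a(1) r by (intro image_eqI[of _ _ "(a, r)"]) auto
    qed
  qed
  have top: "prod_topology (top_of_set triangle_boundary) unit_interval = top_of_set (triangle_boundary \<times> {0..1})"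
    by (simp add: prod_topology_subtopology_eu)
  have "quotient_map (top_of_set (triangle_boundary \<times> {0..1})) (top_of_set (sphere 0 1)) \<kappa>"
  proof (rule continuous_closed_imp_quotient_map)
    show cm: "continuous_map (top_of_set (triangle_boundary \<times> {0..1})) (top_of_set (sphere 0 1)) \<kappa>"
      using cont onto by auto
    show "closed_map (top_of_set (triangle_boundary \<times> {0..1})) (top_of_set (sphere 0 1)) \<kappa>"
      by (rule continuous_imp_closed_map[OF cm])
        (auto simp: compact_space_subtopology compact_Times compact_triangle_boundary
          intro!: Hausdorff_space_subtopology)
    show "\<kappa> ` topspace (top_of_set (triangle_boundary \<times> {0..1})) = topspace (top_of_set (sphere 0 1))"
      using onto by simp
  qed
  moreover have "\<kappa> (a, r) = s \<longleftrightarrow> r = 1" if a: "a \<in> triangle_boundary" and r: "0 \<le> r" "r \<le> 1" for a r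
  proof
    assume "\<kappa> (a, r) = s"
    with height[OF a, of r] ss have "r\<^sup>2 = 1" by simp
    with r show "r = 1" by (simp add: power2_eq_1_iff)
  qed (simp add: \<kappa>_def)
  moreover have "\<kappa> (a, r) = \<kappa> (a', r') \<longleftrightarrow> r = r' \<and> (a = a' \<or> r = 0)"
    if a: "a \<in> triangle_boundary" and a': "a' \<in> triangle_boundary" and r: "0 \<le> r" "r < 1" "0 \<le> r'" "r' < 1" for a a' r r'
  proof
    assume eq: "\<kappa> (a, r) = \<kappa> (a', r')"
    with height[OF a, of r] height[OF a', of r'] have "r\<^sup>2 = r'\<^sup>2" by simp
    then have [simp]: "r' = r" using r by simp
    have "r\<^sup>2 < 1" using r by (simp add: power_less_one_iff abs_square_less_1)
    moreover have "(2 * r * sqrt (1 - r\<^sup>2)) *\<^sub>R u a = (2 * r * sqrt (1 - r\<^sup>2)) *\<^sub>R u a'"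
      using eq by (simp add: \<kappa>_def)
    ultimately have "r = 0 \<or> u a = u a'" by auto
    with u_inj[OF a a'] show "r = r' \<and> (a = a' \<or> r = 0)" by auto
  qed (auto simp: \<kappa>_def)
  ultimately show ?thesis
    unfolding top by (intro exI[of _ \<kappa>] conjI ballI) simp_all
qed

section \<open>Maps into realizations\<close>

lemma realization_iff:
  "f \<in> topspace (realization K) \<longleftrightarrow>
     (\<forall>v. 0 \<le> f v) \<and> {v. f v \<noteq> 0} \<in> K \<and> (\<Sum>v | f v \<noteq> 0. f v) = 1"
  by (simp add: realization_def)

lemma continuous_map_realization_iff:
  "continuous_map Z (realization K) f \<longleftrightarrow>
     (\<forall>v. continuous_map Z euclideanreal (\<lambda>z. f z v)) \<and>
     (\<forall>z\<in>topspace Z. f z \<in> topspace (realization K))"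
proof -
  have "continuous_map Z euclidean f \<longleftrightarrow> (\<forall>v. continuous_map Z euclideanreal (\<lambda>z. f z v))"
    unfolding euclidean_product_topology[symmetric]
    by (simp add: continuous_map_componentwise_UNIV)
  then show ?thesis
    unfolding realization_def continuous_map_in_subtopology by (auto simp: Pi_iff)
qed

lemma continuous_map_coordinate: "continuous_map (realization K) euclideanreal (\<lambda>x. x v)"
  using continuous_map_realization_iff[of "realization K" K "\<lambda>x. x"] by simp

definition simplicial_complex :: "'v set set \<Rightarrow> bool" where
  "simplicial_complex K \<longleftrightarrow> (\<forall>\<sigma>\<in>K. finite \<sigma> \<and> (\<forall>\<tau>. \<tau> \<noteq> {} \<and> \<tau> \<subseteq> \<sigma> \<longrightarrow> \<tau> \<in> K))"

lemma simplicial_complex_clique_complex: "simplicial_complex (clique_complex G)"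
  by (auto simp: simplicial_complex_def clique_complex_def clique_def intro: finite_subset pairwise_subset)

lemma realization_sum_eq_1:
  assumes "f \<in> topspace (realization K)" "{v. f v \<noteq> 0} \<subseteq> W" "finite W"
  shows "sum f W = 1"
proof -
  have "sum f W = (\<Sum>v | f v \<noteq> 0. f v)"
    by (rule sum.mono_neutral_right) (use assms in auto)
  then show ?thesis using assms(1) by (simp add: realization_iff)
qed

lemma realization_le_1:
  assumes "f \<in> topspace (realization K)"
  shows "f v \<le> 1"
proof (cases "f v = 0")
  case False
  have "finite {v. f v \<noteq> 0}"
    using assms by (metis (mono_tags, lifting) realization_iff sum.infinite zero_neq_one)
  then have "f v \<le> (\<Sum>v | f v \<noteq> 0. f v)"
    using False assms by (intro member_le_sum) (auto simp: realization_iff)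
  then show ?thesis using assms by (simp add: realization_iff)
qed simp

text \<open>The simplex \<open>\<sigma>\<close> that bounds the support and the set \<open>W\<close>
  over which the sum is computed are kept apart, because total mass is often easiest to control over
  all vertices.\<close>

lemma realizationI:
  assumes K: "simplicial_complex K" and \<sigma>: "\<sigma> \<in> K" and supp: "{v. f v \<noteq> 0} \<subseteq> \<sigma>"
    and nonneg: "\<And>v. 0 \<le> f v" and sum1: "sum f W = 1" and W: "finite W" "{v. f v \<noteq> 0} \<subseteq> W"
  shows "f \<in> topspace (realization K)"
proof -
  have eq: "(\<Sum>v | f v \<noteq> 0. f v) = sum f W"
    by (rule sum.mono_neutral_left) (use W in auto)
  then have "{v. f v \<noteq> 0} \<noteq> {}"
    using sum1 by (metis sum.empty zero_neq_one)
  then show ?thesis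
    using K \<sigma> supp nonneg eq sum1 by (simp add: realization_iff simplicial_complex_def)
qed

text \<open>The segment between the two images stays in the closed simplex \<open>\<sigma>\<close>.
  It is stationary wherever the maps agree, which makes the homotopy relative to
  \<open>S\<close>.\<close>

lemma contiguous_imp_homotopic:
  assumes K: "simplicial_complex K"
    and f: "continuous_map Z (realization K) f" and g: "continuous_map Z (realization K) g"
    and contiguous: "\<And>z. z \<in> topspace Z \<Longrightarrow> \<exists>\<sigma>\<in>K. {v. f z v \<noteq> 0} \<union> {v. g z v \<noteq> 0} \<subseteq> \<sigma>"
    and S: "\<And>z. z \<in> S \<Longrightarrow> f z = g z"
  shows "homotopic_with (\<lambda>k. \<forall>z\<in>S. k z = f z) Z (realization K) f g"
proof -
  define h where "h = (\<lambda>(t, z) v. (1 - t) * f z v + t * g z v)"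
  have fz: "f z \<in> topspace (realization K)" "g z \<in> topspace (realization K)" if "z \<in> topspace Z" for z
    using f g that by (auto simp: continuous_map_def)
  have "continuous_map (prod_topology unit_interval Z) (realization K) h"
    unfolding continuous_map_realization_iff
  proof (intro conjI allI ballI)
    fix v
    have "continuous_map (prod_topology unit_interval Z) euclideanreal fst"
      by (rule continuous_map_into_fulltopology[OF continuous_map_fst])
    moreover have "continuous_map (prod_topology unit_interval Z) euclideanreal (\<lambda>x. f (snd x) v)"
      "continuous_map (prod_topology unit_interval Z) euclideanreal (\<lambda>x. g (snd x) v)"
      using f g continuous_map_compose[OF continuous_map_snd]
      unfolding continuous_map_realization_iff o_def by blast+
    ultimately show "continuous_map (prod_topology unit_interval Z) euclideanreal (\<lambda>x. h x v)"
      unfolding h_def case_prod_unfold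
      by (intro continuous_map_add continuous_map_real_mult continuous_map_diff) auto
  next
    fix x assume "x \<in> topspace (prod_topology unit_interval Z)"
    then obtain t z where x: "x = (t, z)" and t: "0 \<le> t" "t \<le> 1" and z: "z \<in> topspace Z"
      by auto
    obtain \<sigma> where \<sigma>: "\<sigma> \<in> K" "{v. f z v \<noteq> 0} \<union> {v. g z v \<noteq> 0} \<subseteq> \<sigma>"
      using contiguous[OF z] by auto
    have fin: "finite \<sigma>" using K \<sigma>(1) by (simp add: simplicial_complex_def)
    have "f z v \<noteq> 0 \<or> g z v \<noteq> 0" if "h x v \<noteq> 0" for v
      using that by (auto simp: h_def x)
    then have supp: "{v. h x v \<noteq> 0} \<subseteq> \<sigma>" using \<sigma>(2) by blast
    show "h x \<in> topspace (realization K)"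
    proof (rule realizationI[OF K \<sigma>(1) supp _ _ fin supp])
      show "0 \<le> h x v" for v
        using fz[OF z] t by (auto simp: h_def x realization_iff)
      have "sum (f z) \<sigma> = 1" "sum (g z) \<sigma> = 1"
        by (rule realization_sum_eq_1; use fz[OF z] \<sigma>(2) fin in auto)+
      then show "sum (h x) \<sigma> = 1"
        by (simp add: h_def x sum.distrib flip: sum_distrib_left)
    qed
  qed
  then show ?thesis
    unfolding homotopic_with_def
    by (intro exI[of _ h]) (auto simp: h_def S algebra_simps)
qed

text \<open>The preimages of single indices are open, so a family of maps indexed by triangles can
  be pasted into one map.\<close>

lemma continuous_map_from_discrete_factor:
  assumes p: "continuous_map W (discrete_topology I) p"
    and F: "\<And>i. i \<in> I \<Longrightarrow> continuous_map W Z (F i)"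
  shows "continuous_map W Z (\<lambda>w. F (p w) w)"
proof (rule pasting_lemma[where I = I and T = "\<lambda>i. {w \<in> topspace W. p w \<in> {i}}" and f = F])
  show "openin W {w \<in> topspace W. p w \<in> {i}}" if "i \<in> I" for i
    by (rule openin_continuous_map_preimage[OF p]) (use that in simp)
  show "continuous_map (subtopology W {w \<in> topspace W. p w \<in> {i}}) Z (F i)" if "i \<in> I" for i
    by (rule continuous_map_from_subtopology[OF F[OF that]])
  show "\<exists>j. j \<in> I \<and> w \<in> {w \<in> topspace W. p w \<in> {j}} \<and> F (p w) w = F j w" if "w \<in> topspace W" for w
    using p that by (auto simp: continuous_map_def)
qed auto

lemma Hausdorff_space_realization: "Hausdorff_space (realization K)"
  unfolding realization_def euclidean_product_topology[symmetric]
  by (intro Hausdorff_space_subtopology) (simp add: Hausdorff_space_product_topology)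

section \<open>Cliques of the total graph\<close>

lemma graph_dist_le_2_iff:
  "graph_dist H u v \<le> 2 \<longleftrightarrow> u = v \<or> adj H u v \<or> (\<exists>w. adj H u w \<and> adj H w v)"
proof -
  let ?R = "{(x, y). adj H x y}"
  have "graph_dist H u v \<le> 2 \<longleftrightarrow> (\<exists>n\<le>2. (u, v) \<in> ?R ^^ n)"
  proof
    assume le: "graph_dist H u v \<le> 2"
    \<comment> \<open>The infimum of the empty set is infinite, so a bound by 2 yields a walk, and
      an infimum of a nonempty set of extended naturals is attained.\<close>
    have "enat ` {n. (u, v) \<in> ?R ^^ n} \<noteq> {}"
    proof
      assume "enat ` {n. (u, v) \<in> ?R ^^ n} = {}"
      then have "graph_dist H u v = \<infinity>"
        by (simp only: graph_dist_def Inf_empty top_enat_def)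
      with le show False by simp
    qed
    then have "Inf (enat ` {n. (u, v) \<in> ?R ^^ n}) \<in> enat ` {n. (u, v) \<in> ?R ^^ n}"
      unfolding Inf_enat_def by (metis (mono_tags, lifting) LeastI_ex all_not_in_conv)
    then obtain n where "(u, v) \<in> ?R ^^ n" "graph_dist H u v = enat n"
      by (auto simp: graph_dist_def)
    with le show "\<exists>n\<le>2. (u, v) \<in> ?R ^^ n"
      by (auto simp: numeral_eq_enat)
  next
    assume "\<exists>n\<le>2. (u, v) \<in> ?R ^^ n"
    then obtain n where n: "n \<le> 2" "(u, v) \<in> ?R ^^ n" by auto
    then have "graph_dist H u v \<le> enat n"
      by (auto simp: graph_dist_def intro!: Inf_lower)
    also have "enat n \<le> 2" using n by (simp add: numeral_eq_enat)
    finally show "graph_dist H u v \<le> 2" .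
  qed
  also have "\<dots> \<longleftrightarrow> (u, v) \<in> ?R ^^ 0 \<or> (u, v) \<in> ?R ^^ 1 \<or> (u, v) \<in> ?R ^^ 2"
  proof -
    have "(\<exists>n\<le>2. P n) \<longleftrightarrow> P 0 \<or> P 1 \<or> P 2" for P :: "nat \<Rightarrow> bool"
      by (auto simp: le_Suc_eq numeral_2_eq_2)
    then show ?thesis .
  qed
  also have "\<dots> \<longleftrightarrow> u = v \<or> adj H u v \<or> (\<exists>w. adj H u w \<and> adj H w v)"
    by (auto simp: numeral_2_eq_2 relcomp_unfold)
  finally show ?thesis .
qed

lemma adj_sym: "adj H u v \<longleftrightarrow> adj H v u"
  by (simp add: adj_def insert_commute)

lemma adj_subdivision:
  "adj (subdivision G) (Inl v) (Inr e) \<longleftrightarrow> e \<in> edges G \<and> v \<in> e"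
  "adj (subdivision G) (Inr e) (Inl v) \<longleftrightarrow> e \<in> edges G \<and> v \<in> e"
  "adj (subdivision G) (Inl v) (Inl u) \<longleftrightarrow> False"
  "adj (subdivision G) (Inr e) (Inr f) \<longleftrightarrow> False"
  by (auto simp: adj_def subdivision_def doubleton_eq_iff)

lemma adj_graph_square:
  "adj (graph_square H) u v \<longleftrightarrow> u \<in> verts H \<and> v \<in> verts H \<and> u \<noteq> v \<and> graph_dist H u v \<le> 2"
proof -
  have "graph_dist H u v \<le> 2 \<longleftrightarrow> graph_dist H v u \<le> 2"
    unfolding graph_dist_le_2_iff by (metis adj_sym)
  then show ?thesis
    unfolding adj_def[of "graph_square H"] unfolding graph_square_def by (auto simp: doubleton_eq_iff)
qed

lemma verts_total_graph: "verts (total_graph G) = verts G <+> edges G"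
  by (simp add: total_graph_def graph_square_def subdivision_def)

locale simple_graph =
  fixes G :: "'a graph"
  assumes simple: "finite_simple_graph G"
begin

lemma finite_verts: "finite (verts G)"
  using simple by (simp add: finite_simple_graph_def)

lemma edge_subset: "e \<in> edges G \<Longrightarrow> e \<subseteq> verts G"
  using simple by (simp add: finite_simple_graph_def)

lemma card_edge: "e \<in> edges G \<Longrightarrow> card e = 2"
  using simple by (simp add: finite_simple_graph_def)

lemma finite_edge: "e \<in> edges G \<Longrightarrow> finite e"
  using card_edge[of e] card.infinite[of e] by (cases "finite e") auto

lemma finite_edges: "finite (edges G)"
  by (rule finite_subset[of _ "Pow (verts G)"]) (use edge_subset finite_verts in auto)

lemma edgeE:
  assumes "e \<in> edges G" "v \<in> e"
  obtains u where "e = {v, u}" "u \<noteq> v" "u \<in> verts G"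
proof -
  obtain x y where "e = {x, y}" "x \<noteq> y"
    using card_edge[OF assms(1)] by (auto simp: card_2_iff)
  with assms(2) that[of y] that[of x] edge_subset[OF assms(1)] show thesis
    by (auto simp: insert_commute)
qed

lemma adj_imp_edge: "adj G u v \<Longrightarrow> u \<noteq> v \<and> u \<in> verts G \<and> v \<in> verts G"
  using card_edge[of "{u, v}"] edge_subset[of "{u, v}"] by (cases "u = v") (auto simp: adj_def)

text \<open>The subdivision is bipartite: vertices of different kinds are within distance 2 only if
  incident, and distinct vertices of the same kind only if they have a common neighbour, which is a
  joining edge or a shared endpoint.\<close>

lemma adj_total_graph:
  "adj (total_graph G) (Inl u) (Inl v) \<longleftrightarrow> adj G u v"
  "adj (total_graph G) (Inl u) (Inr e) \<longleftrightarrow> e \<in> edges G \<and> u \<in> e"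
  "adj (total_graph G) (Inr e) (Inl u) \<longleftrightarrow> e \<in> edges G \<and> u \<in> e"
  "adj (total_graph G) (Inr e) (Inr f) \<longleftrightarrow> e \<in> edges G \<and> f \<in> edges G \<and> e \<noteq> f \<and> e \<inter> f \<noteq> {}"
proof -
  have dist: "graph_dist (subdivision G) x y \<le> 2 \<longleftrightarrow> x = y \<or> adj (subdivision G) x y \<or>
      (\<exists>v. adj (subdivision G) x (Inl v) \<and> adj (subdivision G) (Inl v) y) \<or>
      (\<exists>e. adj (subdivision G) x (Inr e) \<and> adj (subdivision G) (Inr e) y)" for x y
    unfolding graph_dist_le_2_iff by (metis sum.exhaust)
  have verts: "Inl u \<in> verts (subdivision G) \<longleftrightarrow> u \<in> verts G"
    "Inr e \<in> verts (subdivision G) \<longleftrightarrow> e \<in> edges G" for u e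
    by (auto simp: subdivision_def)
  have ee: "e \<in> edges G \<and> u \<in> e \<and> v \<in> e \<and> u \<noteq> v \<longleftrightarrow> e = {u, v} \<and> adj G u v" for e u v
  proof
    assume a: "e \<in> edges G \<and> u \<in> e \<and> v \<in> e \<and> u \<noteq> v"
    then have "e = {u, v}" using edgeE[of e u] by auto
    with a show "e = {u, v} \<and> adj G u v" by (simp add: adj_def)
  next
    assume "e = {u, v} \<and> adj G u v"
    then show "e \<in> edges G \<and> u \<in> e \<and> v \<in> e \<and> u \<noteq> v"
      using adj_imp_edge[of u v] by (auto simp: adj_def)
  qed
  show "adj (total_graph G) (Inl u) (Inl v) \<longleftrightarrow> adj G u v"
  proof -
    have "u \<noteq> v \<and> (\<exists>e. (e \<in> edges G \<and> u \<in> e) \<and> e \<in> edges G \<and> v \<in> e) \<longleftrightarrow> adj G u v"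
      using ee[of _ u v] adj_imp_edge[of u v] by metis
    then show ?thesis
      unfolding total_graph_def adj_graph_square dist verts adj_subdivision
      using adj_imp_edge[of u v] by (simp only: sum.inject) blast
  qed
  show "adj (total_graph G) (Inl u) (Inr e) \<longleftrightarrow> e \<in> edges G \<and> u \<in> e"
    "adj (total_graph G) (Inr e) (Inl u) \<longleftrightarrow> e \<in> edges G \<and> u \<in> e"
    unfolding total_graph_def adj_graph_square dist verts adj_subdivision
    using edge_subset[of e] by (simp_all only: sum.distinct) blast+
  show "adj (total_graph G) (Inr e) (Inr f) \<longleftrightarrow> e \<in> edges G \<and> f \<in> edges G \<and> e \<noteq> f \<and> e \<inter> f \<noteq> {}"
    unfolding total_graph_def adj_graph_square dist verts adj_subdivision
    by (simp only: sum.inject) blast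
qed

section \<open>Triangles and the classification of cliques\<close>

definition medial :: "'a set \<Rightarrow> ('a + 'a set) set" where
  "medial t = Inr ` {e. e \<subseteq> t \<and> card e = 2}"

lemma triangleE:
  assumes "t \<in> triangles G"
  obtains a b c where "t = {a, b, c}" "a \<noteq> b" "b \<noteq> c" "a \<noteq> c"
    "adj G a b" "adj G b c" "adj G a c"
proof -
  obtain a b c where "t = {a, b, c}" "a \<noteq> b" "b \<noteq> c" "a \<noteq> c"
    using assms by (auto simp: triangles_def card_3_iff)
  moreover from this assms have "adj G a b" "adj G b c" "adj G a c"
    by (auto simp: triangles_def clique_def pairwise_def)
  ultimately show thesis by (rule that)
qed

lemma finite_triangles: "finite (triangles G)"
  by (rule finite_subset[of _ "Pow (verts G)"]) (auto simp: triangles_def clique_def finite_verts)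

lemma medial_triangle:
  assumes "a \<noteq> b" "b \<noteq> c" "a \<noteq> c"
  shows "{e. e \<subseteq> {a, b, c} \<and> card e = 2} = {{a, b}, {b, c}, {a, c}}"
proof
  show "{e. e \<subseteq> {a, b, c} \<and> card e = 2} \<subseteq> {{a, b}, {b, c}, {a, c}}"
  proof
    fix e assume "e \<in> {e. e \<subseteq> {a, b, c} \<and> card e = 2}"
    then obtain x y where "e = {x, y}" "x \<noteq> y" "{x, y} \<subseteq> {a, b, c}"
      by (auto simp: card_2_iff)
    then show "e \<in> {{a, b}, {b, c}, {a, c}}" by (auto simp: doubleton_eq_iff)
  qed
qed (use assms in auto)

lemma triangle_edges:
  assumes "t \<in> triangles G" "e \<subseteq> t" "card e = 2"
  shows "e \<in> edges G"
proof -
  obtain a b c where abc: "t = {a, b, c}" "a \<noteq> b" "b \<noteq> c" "a \<noteq> c"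
    "adj G a b" "adj G b c" "adj G a c"
    using triangleE[OF assms(1)] .
  have "e \<in> {{a, b}, {b, c}, {a, c}}"
    using assms abc medial_triangle[of a b c] by blast
  with abc show ?thesis by (auto simp: adj_def)
qed

text \<open>A triangle is recovered from its edge vertices, so different triangles have different
  medial simplices.\<close>

lemma Union_medial:
  assumes "t \<in> triangles G"
  shows "\<Union>(Inr -` medial t) = t"
proof -
  obtain a b c where abc: "t = {a, b, c}" "a \<noteq> b" "b \<noteq> c" "a \<noteq> c"
    using triangleE[OF assms] .
  have "Inr -` medial t = {e. e \<subseteq> t \<and> card e = 2}"
    by (auto simp: medial_def)
  with medial_triangle[OF abc(2-4)] abc(1) show ?thesis by auto
qed

lemma total_clique_iff:
  "C \<in> clique_complex (total_graph G) \<longleftrightarrow>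
     C \<noteq> {} \<and> C \<subseteq> verts G <+> edges G \<and> pairwise (adj (total_graph G)) C"
proof -
  have "finite (verts G <+> edges G)"
    using finite_verts finite_edges by (rule finite_Plus)
  then show ?thesis
    by (auto simp: clique_complex_def clique_def verts_total_graph intro: finite_subset)
qed

lemma vertex_clique:
  assumes "\<sigma> \<in> clique_complex G"
  shows "Inl ` \<sigma> \<in> clique_complex (total_graph G)"
proof -
  have "\<sigma> \<noteq> {}" "\<sigma> \<subseteq> verts G" "pairwise (adj G) \<sigma>"
    using assms by (auto simp: clique_complex_def clique_def)
  then show ?thesis
    unfolding total_clique_iff by (auto simp: pairwise_def adj_total_graph)
qed

lemma edge_clique:
  assumes "e \<in> edges G"
  shows "insert (Inr e) (Inl ` e) \<in> clique_complex (total_graph G)"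
proof -
  have "adj G u v" if "u \<in> e" "v \<in> e" "u \<noteq> v" for u v
    using edgeE[OF assms that(1)] that assms by (auto simp: adj_def)
  then have "pairwise (adj (total_graph G)) (insert (Inr e) (Inl ` e))"
    unfolding pairwise_insert using assms by (auto simp: pairwise_def adj_total_graph)
  then show ?thesis
    using assms edge_subset[OF assms] unfolding total_clique_iff by auto
qed

lemma star_clique:
  assumes "v \<in> verts G"
  shows "insert (Inl v) (Inr ` {e \<in> edges G. v \<in> e}) \<in> clique_complex (total_graph G)"
proof -
  have "pairwise (adj (total_graph G)) (insert (Inl v) (Inr ` {e \<in> edges G. v \<in> e}))"
    unfolding pairwise_insert by (auto simp: pairwise_def adj_total_graph)
  with assms show ?thesis
    unfolding total_clique_iff by auto
qed

lemma medial_clique: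
  assumes "t \<in> triangles G"
  shows "medial t \<in> clique_complex (total_graph G)"
proof -
  obtain a b c where abc: "t = {a, b, c}" "a \<noteq> b" "b \<noteq> c" "a \<noteq> c"
    using triangleE[OF assms] .
  have "medial t = Inr ` {{a, b}, {b, c}, {a, c}}"
    unfolding medial_def abc(1) medial_triangle[OF abc(2-4)] ..
  moreover have edges: "{a, b} \<in> edges G" "{b, c} \<in> edges G" "{a, c} \<in> edges G"
    by (rule triangle_edges[OF assms]; use abc in simp)+
  have "pairwise (adj (total_graph G)) (Inr ` {{a, b}, {b, c}, {a, c}})"
  proof (rule pairwise_imageI)
    fix e f assume ef: "e \<in> {{a, b}, {b, c}, {a, c}}" "f \<in> {{a, b}, {b, c}, {a, c}}" "e \<noteq> f"
    then have "e \<inter> f \<noteq> {}" by auto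
    moreover have "e \<in> edges G" "f \<in> edges G" using ef(1,2) edges by auto
    ultimately show "adj (total_graph G) (Inr e) (Inr f)"
      using ef(3) by (simp add: adj_total_graph(4))
  qed
  ultimately show ?thesis
    unfolding total_clique_iff using edges by (simp add: InrI)
qed

text \<open>The edge vertices of a clique form a family \<open>B\<close> of pairwise meeting edges.
  Such a family has a common vertex or consists of the sides of a triangle, and every original
  vertex of the clique lies on all members of \<open>B\<close>.\<close>

lemma total_clique_cases:
  assumes "C \<in> clique_complex (total_graph G)"
  obtains (vertices) \<sigma> where "\<sigma> \<in> clique_complex G" "C = Inl ` \<sigma>"
  | (edge) e where "e \<in> edges G" "C \<subseteq> insert (Inr e) (Inl ` e)"
  | (star) v where "v \<in> verts G" "C \<subseteq> insert (Inl v) (Inr ` {e \<in> edges G. v \<in> e})"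
  | (medial) t where "t \<in> triangles G" "C = medial t"
proof -
  define B where "B = Inr -` C"
  have C: "C \<noteq> {}" "C \<subseteq> verts G <+> edges G" "pairwise (adj (total_graph G)) C"
    using assms by (auto simp: total_clique_iff)
  have BE: "B \<subseteq> edges G" using C(2) by (auto simp: B_def)
  have meet: "e \<inter> f \<noteq> {}" if "e \<in> B" "f \<in> B" for e f
  proof (cases "e = f")
    case True
    with that BE card_edge[of e] show ?thesis by auto
  next
    case False
    with that pairwiseD[OF C(3), of "Inr e" "Inr f"] show ?thesis
      by (simp add: B_def adj_total_graph(4))
  qed
  have vert: "u \<in> e" if "Inl u \<in> C" "e \<in> B" for u e
    using pairwiseD[OF C(3), of "Inl u" "Inr e"] that by (auto simp: B_def adj_total_graph)
  show thesis
  proof (cases "B = {}")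
    case True
    define \<sigma> where "\<sigma> = Inl -` C"
    have "w \<in> Inl ` \<sigma>" if "w \<in> C" for w
      using that True by (cases w) (auto simp: \<sigma>_def B_def)
    then have "C = Inl ` \<sigma>" by (auto simp: \<sigma>_def)
    moreover have "\<sigma> \<in> clique_complex G"
    proof -
      have "\<sigma> \<subseteq> verts G" using C(2) by (auto simp: \<sigma>_def)
      moreover have "pairwise (adj G) \<sigma>"
        using C(3) unfolding \<open>C = Inl ` \<sigma>\<close> by (auto simp: pairwise_def adj_total_graph)
      moreover have "\<sigma> \<noteq> {}" using C(1) \<open>C = Inl ` \<sigma>\<close> by auto
      ultimately show ?thesis
        using finite_verts by (auto simp: clique_complex_def clique_def intro: finite_subset)
    qed
    ultimately show thesis by (intro vertices)
  next
    case False
    then obtain e where e: "e \<in> B" by auto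
    show thesis
    proof (cases "B = {e}")
      case True
      have "w \<in> insert (Inr e) (Inl ` e)" if "w \<in> C" for w
        using that True vert[OF _ e] by (cases w) (auto simp: B_def)
      with e BE show thesis by (intro edge[of e]) auto
    next
      case False
      with e obtain f where f: "f \<in> B" "f \<noteq> e" by auto
      obtain v where v: "v \<in> e" "v \<in> f" using meet[OF e f(1)] by auto
      obtain a where a: "e = {v, a}" "a \<noteq> v" using edgeE[of e v] e BE v by auto
      obtain b where b: "f = {v, b}" "b \<noteq> v" using edgeE[of f v] f BE v by auto
      have "a \<noteq> b" using a b f by auto
      show thesis
      proof (cases "\<forall>h\<in>B. v \<in> h")
        case True
        have "w \<in> insert (Inl v) (Inr ` {e \<in> edges G. v \<in> e})" if "w \<in> C" for w
        proof (cases w)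
          case (Inl u)
          with vert[OF _ e] vert[OF _ f(1)] that a b \<open>a \<noteq> b\<close> show ?thesis by auto
        next
          case (Inr h)
          with that True BE show ?thesis by (auto simp: B_def)
        qed
        moreover have "v \<in> verts G" using v e BE edge_subset by auto
        ultimately show thesis by (intro star[of v]) auto
      next
        case False
        then obtain h where h: "h \<in> B" "v \<notin> h" by auto
        \<comment> \<open>An edge that avoids \<open>v\<close> but meets \<open>{v, a}\<close> and
          \<open>{v, b}\<close> has to close the triangle.\<close>
        have "a \<in> h" "b \<in> h" using meet[OF e h(1)] meet[OF f(1) h(1)] a b h(2) by auto
        then have h_eq: "h = {a, b}" using edgeE[of h a] h BE \<open>a \<noteq> b\<close> by auto
        have B_sub: "k \<in> {{v, a}, {a, b}, {v, b}}" if kB: "k \<in> B" for k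
        proof -
          have k2: "card k = 2" using card_edge kB BE by blast
          then obtain x y where k: "k = {x, y}"
            by (auto simp: card_2_iff)
          \<comment> \<open>One corner lies on only two of the three sides, so an edge meeting all
            sides has both of its ends among the corners.\<close>
          have "x \<in> {v, a} \<or> y \<in> {v, a}" "x \<in> {v, b} \<or> y \<in> {v, b}" "x \<in> {a, b} \<or> y \<in> {a, b}"
            using meet[OF kB e] meet[OF kB f(1)] meet[OF kB h(1)] k a(1) b(1) h_eq by blast+
          then have "x \<in> {v, a, b}" "y \<in> {v, a, b}"
            using \<open>a \<noteq> b\<close> a(2) b(2) by auto
          with k k2 have "k \<in> {e. e \<subseteq> {v, a, b} \<and> card e = 2}" by simp
          then show ?thesis
            using medial_triangle[of v a b] \<open>a \<noteq> b\<close> a(2) b(2) by simp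
        qed
        have B_eq: "B = {{v, a}, {a, b}, {v, b}}"
        proof
          show "B \<subseteq> {{v, a}, {a, b}, {v, b}}" using B_sub by blast
          show "{{v, a}, {a, b}, {v, b}} \<subseteq> B" using e f(1) h(1) a(1) b(1) h_eq by simp
        qed
        \<comment> \<open>No vertex lies on all three sides, so the clique has no original
          vertex.\<close>
        have "Inl u \<notin> C" for u
        proof
          assume "Inl u \<in> C"
          from vert[OF this e] vert[OF this f(1)] vert[OF this h(1)] a b h_eq \<open>a \<noteq> b\<close>
          show False by auto
        qed
        then have "w \<in> Inr ` B" if "w \<in> C" for w
          using that by (cases w) (auto simp: B_def)
        then have "C = Inr ` B"
          by (auto simp: B_def)
        also have "\<dots> = medial {v, a, b}"
          unfolding medial_def B_eq using medial_triangle[of v a b] a(2) b(2) \<open>a \<noteq> b\<close> by simp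
        finally have "C = medial {v, a, b}" .
        moreover have "{v, a, b} \<in> triangles G"
        proof -
          have adj: "adj G v a" "adj G a b" "adj G v b"
            using BE unfolding B_eq adj_def by auto
          then have "pairwise (adj G) {v, a, b}"
            using adj_sym[of G a v] adj_sym[of G b a] adj_sym[of G b v] by (auto simp: pairwise_insert)
          moreover have "{v, a, b} \<subseteq> verts G"
            using adj_imp_edge[OF adj(1)] adj_imp_edge[OF adj(2)] by simp
          ultimately show ?thesis
            using a(2) b(2) \<open>a \<noteq> b\<close> by (simp add: triangles_def clique_def)
        qed
        ultimately show thesis by (intro medial)
      qed
    qed
  qed
qed

text \<open>Not a skeleton in the sense of dimension: only the simplices \<open>medial t\<close>
  themselves are removed, while their proper faces stay.\<close>

definition skeleton :: "('a + 'a set) set set" where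
  "skeleton = clique_complex (total_graph G) - medial ` triangles G"

end

section \<open>The deformation onto the clique complex of the graph\<close>

context simple_graph
begin

lemma medial_nonempty: "t \<in> triangles G \<Longrightarrow> medial t \<noteq> {}"
  using medial_clique by (auto simp: clique_complex_def)

text \<open>The removed simplices are maximal: the three sides of a triangle are distinct and have
  no common vertex, so no clique of another kind contains them all. Removing them therefore keeps
  closure under faces.\<close>

lemma simplicial_complex_skeleton: "simplicial_complex skeleton"
  unfolding simplicial_complex_def
proof (intro ballI conjI allI impI)
  fix \<sigma> assume \<sigma>: "\<sigma> \<in> skeleton"
  then have cl: "\<sigma> \<in> clique_complex (total_graph G)" and not_medial: "\<sigma> \<notin> medial ` triangles G"
    by (auto simp: skeleton_def)
  then show "finite \<sigma>" by (simp add: clique_complex_def)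
  fix \<tau> assume \<tau>: "\<tau> \<noteq> {} \<and> \<tau> \<subseteq> \<sigma>"
  have "\<tau> \<in> clique_complex (total_graph G)"
    using simplicial_complex_clique_complex[of "total_graph G"] cl \<tau>
    by (simp add: simplicial_complex_def)
  moreover have "\<tau> \<noteq> medial t" if t: "t \<in> triangles G" for t
  proof
    assume "\<tau> = medial t"
    with \<tau> have sub: "medial t \<subseteq> \<sigma>" by simp
    obtain a b c where abc: "t = {a, b, c}" "a \<noteq> b" "b \<noteq> c" "a \<noteq> c"
      using triangleE[OF t] .
    have "medial t = Inr ` {{a, b}, {b, c}, {a, c}}"
      unfolding medial_def abc(1) medial_triangle[OF abc(2-4)] ..
    with sub have mem: "Inr {a, b} \<in> \<sigma>" "Inr {b, c} \<in> \<sigma>" "Inr {a, c} \<in> \<sigma>" by auto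
    from cl show False
    proof (cases rule: total_clique_cases)
      case (vertices \<rho>)
      with mem show False by auto
    next
      case (edge e)
      with mem have "{a, b} = e" "{b, c} = e" by auto
      with abc show False by (auto simp: doubleton_eq_iff)
    next
      case (star v)
      with mem have "v \<in> {a, b}" "v \<in> {b, c}" "v \<in> {a, c}" by auto
      with abc show False by auto
    next
      case (medial t')
      with not_medial show False by auto
    qed
  qed
  ultimately show "\<tau> \<in> skeleton"
    by (auto simp: skeleton_def)
qed

lemma skeleton_cases:
  assumes "\<sigma> \<in> skeleton"
  obtains (vertices) \<tau> where "\<tau> \<in> clique_complex G" "\<sigma> = Inl ` \<tau>"
  | (edge) e where "e \<in> edges G" "\<sigma> \<subseteq> insert (Inr e) (Inl ` e)"
  | (star) v where "v \<in> verts G" "\<sigma> \<subseteq> insert (Inl v) (Inr ` {e \<in> edges G. v \<in> e})"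
proof -
  have "\<sigma> \<in> clique_complex (total_graph G)" "\<sigma> \<notin> medial ` triangles G"
    using assms by (auto simp: skeleton_def)
  from this(1) show thesis
  proof (cases rule: total_clique_cases)
    case (medial t)
    with \<open>\<sigma> \<notin> medial ` triangles G\<close> show thesis by auto
  qed (fact vertices edge star)+
qed

text \<open>Medial simplices consist of edge vertices only.\<close>

lemma in_skeletonI:
  assumes "\<sigma> \<in> clique_complex (total_graph G)" "Inl v \<in> \<sigma>"
  shows "\<sigma> \<in> skeleton"
  using assms by (auto simp: skeleton_def medial_def)

lemma vertices_in_skeleton:
  assumes "\<tau> \<in> clique_complex G"
  shows "Inl ` \<tau> \<in> skeleton"
proof -
  have "\<tau> \<noteq> {}" using assms by (simp add: clique_complex_def)
  then obtain v where "v \<in> \<tau>" by auto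
  then show ?thesis
    by (intro in_skeletonI[of _ v] vertex_clique assms) auto
qed

lemma edge_in_skeleton:
  assumes "e \<in> edges G"
  shows "insert (Inr e) (Inl ` e) \<in> skeleton"
proof -
  have "e \<noteq> {}" using card_edge[OF assms] by auto
  then obtain v where "v \<in> e" by auto
  then show ?thesis
    by (intro in_skeletonI[of _ v] edge_clique assms) auto
qed

lemma star_in_skeleton: "v \<in> verts G \<Longrightarrow> insert (Inl v) (Inr ` {e \<in> edges G. v \<in> e}) \<in> skeleton"
  by (intro in_skeletonI[of _ v] star_clique) auto

lemma edge_in_clique_complex:
  assumes "e \<in> edges G"
  shows "e \<in> clique_complex G"
proof -
  have "adj G u v" if uv: "u \<in> e" "v \<in> e" "u \<noteq> v" for u v
  proof -
    obtain w where "e = {u, w}" using edgeE[OF assms uv(1)] by metis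
    with uv have "e = {u, v}" by auto
    with assms show ?thesis by (simp add: adj_def)
  qed
  moreover have "e \<noteq> {}" using card_edge[OF assms] by auto
  ultimately show ?thesis
    using edge_subset[OF assms] finite_edge[OF assms]
    by (simp add: clique_complex_def clique_def pairwise_def)
qed

lemma vertex_in_clique_complex: "v \<in> verts G \<Longrightarrow> {v} \<in> clique_complex G"
  by (simp add: clique_complex_def clique_def)

abbreviation all_vertices :: "('a + 'a set) set" where
  "all_vertices \<equiv> verts G <+> edges G"

lemma finite_all_vertices: "finite all_vertices"
  by (rule finite_Plus[OF finite_verts finite_edges])

lemma skeleton_subset: "\<sigma> \<in> skeleton \<Longrightarrow> \<sigma> \<subseteq> all_vertices"
  unfolding skeleton_def using total_clique_iff by blast

lemma skeleton_point:
  assumes "x \<in> topspace (realization skeleton)"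
  shows "0 \<le> x w" "{w. x w \<noteq> 0} \<in> skeleton" "sum x all_vertices = 1"
    and "e \<notin> edges G \<Longrightarrow> x (Inr e) = 0"
proof -
  show "0 \<le> x w" and supp: "{w. x w \<noteq> 0} \<in> skeleton"
    using assms by (auto simp: realization_iff)
  then have sub: "{w. x w \<noteq> 0} \<subseteq> all_vertices" by (intro skeleton_subset)
  then show "sum x all_vertices = 1"
    by (intro realization_sum_eq_1[OF assms] finite_all_vertices)
  show "e \<notin> edges G \<Longrightarrow> x (Inr e) = 0"
    using sub by auto
qed

section \<open>Moving mass from edge vertices to endpoints\<close>

text \<open>The number \<open>m e v\<close> is the mass moved from the edge vertex \<open>e\<close>
  to its endpoint \<open>v\<close>; both stages of the deformation have this form.\<close>

definition push :: "('a set \<Rightarrow> 'a \<Rightarrow> real) \<Rightarrow> ('a + 'a set \<Rightarrow> real) \<Rightarrow> 'a + 'a set \<Rightarrow> real" where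
  "push m x w = (case w of
      Inl v \<Rightarrow> x (Inl v) + (\<Sum>e\<in>{e \<in> edges G. v \<in> e}. m e v)
    | Inr e \<Rightarrow> x (Inr e) - (\<Sum>v\<in>e. m e v))"

text \<open>Double counting over incident pairs: what the vertices gain is what the edge vertices
  lose.\<close>

lemma sum_push: "sum (push m x) all_vertices = sum x all_vertices"
proof -
  have "(\<Sum>v\<in>verts G. \<Sum>e\<in>{e. e \<in> edges G \<and> v \<in> e}. m e v)
      = (\<Sum>e\<in>edges G. \<Sum>v\<in>{v. v \<in> verts G \<and> v \<in> e}. m e v)"
    by (rule sum.swap_restrict[OF finite_verts finite_edges])
  also have "\<dots> = (\<Sum>e\<in>edges G. \<Sum>v\<in>e. m e v)"
    using edge_subset by (intro sum.cong refl) auto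
  finally show ?thesis
    by (simp add: sum.Plus[OF finite_verts finite_edges] push_def sum.distrib sum_subtractf)
qed

text \<open>Edge vertices never gain mass, so only the endpoints that receive some have to be
  checked.\<close>

lemma push_support:
  assumes "{w. x w \<noteq> 0} \<subseteq> S"
    and "\<And>e v. \<lbrakk>x (Inr e) = 0; v \<in> e\<rbrakk> \<Longrightarrow> m e v = 0"
    and "\<And>e v. \<lbrakk>e \<in> edges G; v \<in> e; x (Inr e) \<noteq> 0; m e v \<noteq> 0\<rbrakk> \<Longrightarrow> Inl v \<in> S"
  shows "{w. push m x w \<noteq> 0} \<subseteq> S"
proof
  fix w assume w: "w \<in> {w. push m x w \<noteq> 0}"
  show "w \<in> S"
  proof (cases w)
    case (Inl v)
    show ?thesis
    proof (cases "x (Inl v) = 0")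
      case True
      with w Inl have "(\<Sum>e\<in>{e \<in> edges G. v \<in> e}. m e v) \<noteq> 0" by (simp add: push_def)
      then obtain e where "e \<in> {e \<in> edges G. v \<in> e}" "m e v \<noteq> 0"
        by (rule sum.not_neutral_contains_not_neutral)
      with assms(2)[of e v] assms(3)[of e v] Inl show ?thesis by auto
    next
      case False
      with assms(1) Inl show ?thesis by auto
    qed
  next
    case (Inr e)
    have "x (Inr e) \<noteq> 0"
    proof
      assume "x (Inr e) = 0"
      with assms(2) have "push m x (Inr e) = 0" by (simp add: push_def)
      with w Inr show False by simp
    qed
    with assms(1) Inr show ?thesis by auto
  qed
qed

lemma push_in_skeleton:
  assumes x: "x \<in> topspace (realization skeleton)"
    and S: "S \<in> skeleton" "{w. push m x w \<noteq> 0} \<subseteq> S"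
    and nonneg: "\<And>e v. 0 \<le> m e v" and zero: "\<And>e v. \<lbrakk>x (Inr e) = 0; v \<in> e\<rbrakk> \<Longrightarrow> m e v = 0"
    and le: "\<And>e. e \<in> edges G \<Longrightarrow> (\<Sum>v\<in>e. m e v) \<le> x (Inr e)"
  shows "push m x \<in> topspace (realization skeleton)"
proof (rule realizationI[OF simplicial_complex_skeleton S])
  show "0 \<le> push m x w" for w
  proof (cases w)
    case (Inl v)
    then show ?thesis using skeleton_point(1)[OF x] nonneg by (simp add: push_def sum_nonneg)
  next
    case (Inr e)
    then show ?thesis
      using le[of e] skeleton_point(4)[OF x, of e] zero[of e] by (cases "e \<in> edges G") (auto simp: push_def)
  qed
  show "sum (push m x) all_vertices = 1"
    using skeleton_point(3)[OF x] by (simp add: sum_push)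
  show "{w. push m x w \<noteq> 0} \<subseteq> all_vertices"
    using S skeleton_subset by blast
qed (rule finite_all_vertices)

definition weight :: "('a + 'a set \<Rightarrow> real) \<Rightarrow> 'a \<Rightarrow> real" where
  "weight x v = x (Inl v) + (\<Sum>e\<in>{e \<in> edges G. v \<in> e}. x (Inr e))"

text \<open>The sum over \<open>e - {v}\<close> is just the weight of the other endpoint when
  \<open>e\<close> is an edge. Mass flows towards the heavier endpoint, by the difference of the
  weights but at most what is there. No reference is made to the simplex containing
  \<open>x\<close>, which is what makes the map continuous across simplices.\<close>

definition shift :: "('a + 'a set \<Rightarrow> real) \<Rightarrow> 'a set \<Rightarrow> 'a \<Rightarrow> real" where
  "shift x e v = max 0 (min (x (Inr e)) (weight x v - (\<Sum>u\<in>e - {v}. weight x u)))"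

text \<open>On the star of \<open>v\<close> the weight of \<open>v\<close> is the total mass, so the mass is concentrated at \<open>v\<close>
  and at the only edge vertex, if any, of mass greater than one half.\<close>

definition concentrate :: "('a + 'a set \<Rightarrow> real) \<Rightarrow> 'a + 'a set \<Rightarrow> real" where
  "concentrate x = push (shift x) x"

text \<open>In barycentric coordinates, the affine map that sends each edge vertex to the midpoint
  of its edge.\<close>

definition halve :: "('a + 'a set \<Rightarrow> real) \<Rightarrow> 'a + 'a set \<Rightarrow> real" where
  "halve x = push (\<lambda>e v. x (Inr e) / 2) x"

lemma shift_nonneg: "0 \<le> shift x e v"
  by (simp add: shift_def)

lemma shift_zero: "x (Inr e) = 0 \<Longrightarrow> shift x e v = 0"
  by (simp add: shift_def)

text \<open>The two weight differences are opposite, so at most one endpoint receives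
  anything.\<close>

lemma sum_shift_le:
  assumes "e \<in> edges G" "0 \<le> x (Inr e)"
  shows "(\<Sum>v\<in>e. shift x e v) \<le> x (Inr e)"
proof -
  obtain u v where e: "e = {u, v}" "u \<noteq> v"
    using card_edge[OF assms(1)] by (auto simp: card_2_iff)
  then have "e - {u} = {v}" "e - {v} = {u}" by auto
  then have "shift x e u = max 0 (min (x (Inr e)) (weight x u - weight x v))"
    "shift x e v = max 0 (min (x (Inr e)) (weight x v - weight x u))"
    by (simp_all add: shift_def)
  moreover have "(\<Sum>v\<in>e. shift x e v) = shift x e u + shift x e v" using e by simp
  ultimately show ?thesis using assms(2) by (simp add: max_def min_def)
qed

text \<open>The points on which \<open>halve\<close> is harmless. For a general point in a star it
  would produce a support made of several neighbours of the centre, possibly not a clique.\<close>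

definition flat :: "('a + 'a set \<Rightarrow> real) \<Rightarrow> bool" where
  "flat x \<longleftrightarrow> (\<exists>\<tau>\<in>clique_complex G. {w. x w \<noteq> 0} \<subseteq> Inl ` \<tau>) \<or>
     (\<exists>e\<in>edges G. {w. x w \<noteq> 0} \<subseteq> insert (Inr e) (Inl ` e))"

text \<open>For an edge \<open>e = {v, u}\<close> at the centre the weights are 1 at
  \<open>v\<close> and \<open>x (Inr e)\<close> at \<open>u\<close>. So \<open>e\<close> gives
  \<open>min (x (Inr e)) (1 - x (Inr e))\<close> to \<open>v\<close> and nothing to
  \<open>u\<close>, and it keeps mass only if it had more than one half.\<close>

lemma concentrate_star:
  assumes x: "x \<in> topspace (realization skeleton)" and v: "v \<in> verts G"
    and supp: "{w. x w \<noteq> 0} \<subseteq> insert (Inl v) (Inr ` {e \<in> edges G. v \<in> e})"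
  shows "{w. concentrate x w \<noteq> 0} \<subseteq> insert (Inl v) (Inr ` {e \<in> edges G. v \<in> e})"
    and "flat (concentrate x)"
proof -
  let ?E = "{e \<in> edges G. v \<in> e}"
  have finE: "finite ?E" using finite_edges by simp
  have "sum x (insert (Inl v) (Inr ` ?E)) = 1"
    by (rule realization_sum_eq_1[OF x supp]) (use finE in simp)
  then have total: "x (Inl v) + (\<Sum>e\<in>?E. x (Inr e)) = 1"
    using finE by (simp add: sum.reindex image_iff)
  then have weight_v: "weight x v = 1" by (simp add: weight_def)
  \<comment> \<open>Among the edges at \<open>u\<close> only \<open>{v, u}\<close> contains
    \<open>v\<close>, and the support of \<open>x\<close> allows no other.\<close>
  have weight_u: "weight x u = x (Inr {v, u})" if "{v, u} \<in> edges G" "u \<noteq> v" for u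
  proof -
    have "x (Inl u) = 0" using supp that by auto
    moreover have "(\<Sum>e\<in>{e \<in> edges G. u \<in> e}. x (Inr e)) = (\<Sum>e\<in>{{v, u}}. x (Inr e))"
    proof (rule sum.mono_neutral_right)
      show "\<forall>e\<in>{e \<in> edges G. u \<in> e} - {{v, u}}. x (Inr e) = 0"
      proof
        fix e assume e: "e \<in> {e \<in> edges G. u \<in> e} - {{v, u}}"
        have "v \<notin> e"
        proof
          assume "v \<in> e"
          then obtain w where "e = {v, w}" using edgeE[of e v] e by auto
          with e that(2) show False by auto
        qed
        with supp show "x (Inr e) = 0" by auto
      qed
    qed (use finite_edges that in auto)
    ultimately show ?thesis by (simp add: weight_def)
  qed
  have le1: "x w \<le> 1" and ge0: "0 \<le> x w" for w
    using realization_le_1[OF x] skeleton_point(1)[OF x] by auto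
  have edge: "\<exists>u. e = {v, u} \<and> u \<noteq> v" if "e \<in> edges G" "v \<in> e" for e
    using edgeE[OF that] by metis
  have shift_v: "shift x e v = min (x (Inr e)) (1 - x (Inr e))" if e: "e \<in> edges G" "v \<in> e" for e
  proof -
    obtain u where u: "e = {v, u}" "u \<noteq> v" using edge[OF e] by auto
    then have "e - {v} = {u}" by auto
    with u weight_u[of u] e weight_v ge0[of "Inr e"] le1[of "Inr e"] show ?thesis by (simp add: shift_def)
  qed
  have shift_u: "shift x e u = 0" if e: "e \<in> edges G" "v \<in> e" "u \<in> e" "u \<noteq> v" for e u
  proof -
    have "e = {v, u}" using edge[OF e(1,2)] e(3,4) by auto
    then have "e - {u} = {v}" using e(4) by auto
    with \<open>e = {v, u}\<close> weight_u[of u] e weight_v le1[of "Inr e"] show ?thesis by (simp add: shift_def)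
  qed
  show supp': "{w. concentrate x w \<noteq> 0} \<subseteq> insert (Inl v) (Inr ` ?E)"
    unfolding concentrate_def
  proof (rule push_support[OF supp shift_zero])
    fix e u assume e: "e \<in> edges G" "u \<in> e" "x (Inr e) \<noteq> 0" "shift x e u \<noteq> 0"
    then have "v \<in> e" using supp by auto
    then have "u = v" using shift_u e by blast
    then show "Inl u \<in> insert (Inl v) (Inr ` ?E)" by simp
  qed
  have half: "x (Inr e) > 1 / 2" if e: "e \<in> edges G" "v \<in> e" "concentrate x (Inr e) \<noteq> 0" for e
  proof -
    obtain u where u: "e = {v, u}" "u \<noteq> v" using edge[OF e(1,2)] by auto
    have "(\<Sum>w\<in>e. shift x e w) = shift x e v + shift x e u" using u by simp
    also have "shift x e u = 0" using shift_u[OF e(1,2)] u by simp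
    finally have "concentrate x (Inr e) = x (Inr e) - min (x (Inr e)) (1 - x (Inr e))"
      using shift_v[OF e(1,2)] by (simp add: concentrate_def push_def)
    with e(3) show ?thesis by (simp add: min_def split: if_splits)
  qed
  show "flat (concentrate x)"
  proof (cases "\<exists>e\<in>?E. concentrate x (Inr e) \<noteq> 0")
    case True
    then obtain e where e: "e \<in> edges G" "v \<in> e" "concentrate x (Inr e) \<noteq> 0" by auto
    have "f = e" if f: "f \<in> edges G" "v \<in> f" "concentrate x (Inr f) \<noteq> 0" for f
    proof (rule ccontr)
      assume "f \<noteq> e"
      \<comment> \<open>Two edge vertices with more than one half each would exceed the total mass
        1.\<close>
      have "(\<Sum>g\<in>{e, f}. x (Inr g)) \<le> (\<Sum>g\<in>?E. x (Inr g))"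
        by (rule sum_mono2[OF finE]) (use e f ge0 in auto)
      with \<open>f \<noteq> e\<close> half[OF e] half[OF f] total ge0[of "Inl v"] show False by simp
    qed
    then have "{w. concentrate x w \<noteq> 0} \<subseteq> insert (Inr e) (Inl ` e)"
      using supp' e by blast
    with e(1) show ?thesis by (auto simp: flat_def)
  next
    case False
    have "w = Inl v" if w: "concentrate x w \<noteq> 0" for w
    proof -
      have "w \<in> insert (Inl v) (Inr ` ?E)" using supp' w by auto
      with False w show ?thesis by auto
    qed
    then have "{w. concentrate x w \<noteq> 0} \<subseteq> Inl ` {v}"
      by auto
    with vertex_in_clique_complex[OF v] show ?thesis unfolding flat_def by blast
  qed
qed

text \<open>Outside the stars nothing has to be computed: without edge vertices there is no mass to
  move, and with a single one the mass moves to its endpoints, inside the same simplex.\<close>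

lemma concentrate_step:
  assumes x: "x \<in> topspace (realization skeleton)"
  shows "\<exists>S\<in>skeleton. {w. x w \<noteq> 0} \<union> {w. concentrate x w \<noteq> 0} \<subseteq> S"
    and "flat (concentrate x)"
proof -
  have "(\<exists>S\<in>skeleton. {w. x w \<noteq> 0} \<union> {w. concentrate x w \<noteq> 0} \<subseteq> S) \<and> flat (concentrate x)"
    using skeleton_point(2)[OF x]
  proof (cases rule: skeleton_cases)
    case (vertices \<tau>)
    have sub: "{w. concentrate x w \<noteq> 0} \<subseteq> Inl ` \<tau>"
      unfolding concentrate_def
      by (rule push_support[OF _ shift_zero]) (use vertices(2) in auto)
    with vertices(1) have "flat (concentrate x)"
      unfolding flat_def by (intro disjI1 bexI[of _ \<tau>])
    with sub vertices(2) vertices_in_skeleton[OF vertices(1)] show ?thesis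
      by (intro conjI bexI[of _ "Inl ` \<tau>"] Un_least) simp_all
  next
    case (edge e)
    have sub: "{w. concentrate x w \<noteq> 0} \<subseteq> insert (Inr e) (Inl ` e)"
      unfolding concentrate_def
      by (rule push_support[OF _ shift_zero]) (use edge(2) in auto)
    with edge(1) have "flat (concentrate x)"
      unfolding flat_def by (intro disjI2 bexI[of _ e])
    with sub edge(2) edge_in_skeleton[OF edge(1)] show ?thesis
      by (intro conjI bexI[of _ "insert (Inr e) (Inl ` e)"] Un_least)
  next
    case (star v)
    show ?thesis
      by (intro conjI bexI[OF _ star_in_skeleton[OF star(1)]] Un_least star(2) concentrate_star[OF x star])
  qed
  then show "\<exists>S\<in>skeleton. {w. x w \<noteq> 0} \<union> {w. concentrate x w \<noteq> 0} \<subseteq> S" "flat (concentrate x)"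
    by auto
qed

lemma concentrate_in_skeleton:
  assumes x: "x \<in> topspace (realization skeleton)"
  shows "concentrate x \<in> topspace (realization skeleton)"
proof -
  obtain S where S: "S \<in> skeleton" "{w. concentrate x w \<noteq> 0} \<subseteq> S"
    using concentrate_step(1)[OF x] by auto
  then show ?thesis
    unfolding concentrate_def
    by (intro push_in_skeleton[OF x S(1)] shift_nonneg shift_zero sum_shift_le skeleton_point(1)[OF x]) auto
qed

lemma halve_Inr:
  assumes x: "x \<in> topspace (realization skeleton)"
  shows "halve x (Inr e) = 0"
  using card_edge[of e] skeleton_point(4)[OF x, of e]
  by (cases "e \<in> edges G") (auto simp: halve_def push_def)

lemma halve_step:
  assumes x: "x \<in> topspace (realization skeleton)" and "flat x"
  shows "\<exists>S\<in>skeleton. {w. x w \<noteq> 0} \<union> {w. halve x w \<noteq> 0} \<subseteq> S"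
    and "\<exists>\<tau>\<in>clique_complex G. {w. halve x w \<noteq> 0} \<subseteq> Inl ` \<tau>"
proof -
  have Inl: "w \<in> Inl ` UNIV" if "halve x w \<noteq> 0" for w
    using that halve_Inr[OF x] by (cases w) auto
  have "(\<exists>S\<in>skeleton. {w. x w \<noteq> 0} \<union> {w. halve x w \<noteq> 0} \<subseteq> S) \<and>
      (\<exists>\<tau>\<in>clique_complex G. {w. halve x w \<noteq> 0} \<subseteq> Inl ` \<tau>)"
    using \<open>flat x\<close> unfolding flat_def
  proof (elim disjE bexE)
    fix \<tau> assume \<tau>: "\<tau> \<in> clique_complex G" "{w. x w \<noteq> 0} \<subseteq> Inl ` \<tau>"
    have "{w. halve x w \<noteq> 0} \<subseteq> Inl ` \<tau>"
      unfolding halve_def by (rule push_support[OF \<tau>(2)]) (use \<tau>(2) in auto)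
    with \<tau> vertices_in_skeleton[OF \<tau>(1)] show ?thesis
      by (intro conjI bexI[of _ "Inl ` \<tau>"] bexI[of _ \<tau>] Un_least)
  next
    fix e assume e: "e \<in> edges G" "{w. x w \<noteq> 0} \<subseteq> insert (Inr e) (Inl ` e)"
    have sub: "{w. halve x w \<noteq> 0} \<subseteq> insert (Inr e) (Inl ` e)"
      unfolding halve_def by (rule push_support[OF e(2)]) (use e(2) in auto)
    have "{w. halve x w \<noteq> 0} \<subseteq> Inl ` e"
    proof
      fix w assume w: "w \<in> {w. halve x w \<noteq> 0}"
      then have "w \<in> insert (Inr e) (Inl ` e)" using sub by auto
      with w Inl[of w] show "w \<in> Inl ` e" by auto
    qed
    with sub e show ?thesis
      by (intro conjI bexI[OF _ edge_in_skeleton[OF e(1)]] bexI[OF _ edge_in_clique_complex[OF e(1)]] Un_least)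
  qed
  then show "\<exists>S\<in>skeleton. {w. x w \<noteq> 0} \<union> {w. halve x w \<noteq> 0} \<subseteq> S"
    "\<exists>\<tau>\<in>clique_complex G. {w. halve x w \<noteq> 0} \<subseteq> Inl ` \<tau>"
    by auto
qed

lemma halve_in_skeleton:
  assumes x: "x \<in> topspace (realization skeleton)" and "flat x"
  shows "halve x \<in> topspace (realization skeleton)"
proof -
  obtain S where S: "S \<in> skeleton" "{w. halve x w \<noteq> 0} \<subseteq> S"
    using halve_step(1)[OF assms] by auto
  then show ?thesis
    unfolding halve_def
    by (intro push_in_skeleton[OF x S(1)]) (auto simp: skeleton_point(1)[OF x] card_edge)
qed

lemma continuous_map_push:
  assumes m: "\<And>e v. finite e \<Longrightarrow> continuous_map Z euclideanreal (\<lambda>z. m z e v)"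
    and f: "\<And>w. continuous_map Z euclideanreal (\<lambda>z. f z w)"
  shows "continuous_map Z euclideanreal (\<lambda>z. push (m z) (f z) w)"
proof (cases w)
  case (Inl v)
  then show ?thesis
    using finite_edges finite_edge m
    by (auto simp: push_def intro!: continuous_map_add continuous_map_sum f)
next
  \<comment> \<open>For an infinite \<open>e\<close> the sum in \<open>push\<close> is 0 by
    convention, so continuity of \<open>m\<close> is needed for finite \<open>e\<close>
    only.\<close>
  case (Inr e)
  then show ?thesis
    using f m by (cases "finite e") (auto simp: push_def intro!: continuous_map_diff continuous_map_sum)
qed

lemma continuous_map_weight: "continuous_map (realization skeleton) euclideanreal (\<lambda>x. weight x v)"
  unfolding weight_def
  using finite_edges by (intro continuous_map_add continuous_map_sum continuous_map_coordinate) auto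

lemma continuous_map_concentrate:
  "continuous_map (realization skeleton) (realization skeleton) concentrate"
  unfolding continuous_map_realization_iff
proof (intro conjI allI ballI concentrate_in_skeleton)
  show "continuous_map (realization skeleton) euclideanreal (\<lambda>x. concentrate x w)" for w
    unfolding concentrate_def
  proof (rule continuous_map_push[OF _ continuous_map_coordinate])
    show "continuous_map (realization skeleton) euclideanreal (\<lambda>x. shift x e v)" if "finite e" for e v
      unfolding shift_def using that
      by (intro continuous_map_real_max continuous_map_real_min continuous_map_diff continuous_map_sum
          continuous_map_weight continuous_map_coordinate) auto
  qed
qed

lemma continuous_map_halve_concentrate:
  "continuous_map (realization skeleton) (realization skeleton) (halve \<circ> concentrate)"
  unfolding continuous_map_realization_iff
proof (intro conjI allI ballI)
  have conc: "continuous_map (realization skeleton) euclideanreal (\<lambda>x. concentrate x w)" for w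
    using continuous_map_concentrate unfolding continuous_map_realization_iff by blast
  show "continuous_map (realization skeleton) euclideanreal (\<lambda>x. (halve \<circ> concentrate) x w)" for w
    unfolding halve_def o_def
    by (rule continuous_map_push) (auto intro!: continuous_map_real_divide conc)
qed (simp add: halve_in_skeleton concentrate_in_skeleton concentrate_step(2))

section \<open>The retraction onto the clique complex of the graph\<close>

text \<open>The inclusion of \<open>Cl G\<close> as the subcomplex on the original vertices.\<close>

definition extend :: "('a \<Rightarrow> real) \<Rightarrow> 'a + 'a set \<Rightarrow> real" where
  "extend y w = (case w of Inl v \<Rightarrow> y v | Inr e \<Rightarrow> 0)"

definition collapse :: "('a + 'a set \<Rightarrow> real) \<Rightarrow> 'a \<Rightarrow> real" where
  "collapse x v = halve (concentrate x) (Inl v)"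

lemma extend_support: "{w. extend y w \<noteq> 0} = Inl ` {v. y v \<noteq> 0}"
proof -
  have "extend y w \<noteq> 0 \<longleftrightarrow> w \<in> Inl ` {v. y v \<noteq> 0}" for w
    by (cases w) (auto simp: extend_def)
  then show ?thesis by blast
qed

lemma extend_in_skeleton:
  assumes "y \<in> topspace (Cl G)"
  shows "extend y \<in> topspace (realization skeleton)"
proof -
  have "{v. y v \<noteq> 0} \<in> clique_complex G" "sum y {v. y v \<noteq> 0} = 1" "\<And>v. 0 \<le> y v"
    using assms by (auto simp: realization_iff)
  moreover have "sum (extend y) (Inl ` {v. y v \<noteq> 0}) = sum y {v. y v \<noteq> 0}"
    by (simp add: sum.reindex extend_def)
  moreover have "0 \<le> extend y w" for w
    using \<open>\<And>v. 0 \<le> y v\<close> by (cases w) (auto simp: extend_def)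
  ultimately show ?thesis
    unfolding realization_iff extend_support by (simp add: vertices_in_skeleton)
qed

lemma continuous_map_extend: "continuous_map (Cl G) (realization skeleton) extend"
  unfolding continuous_map_realization_iff
proof (intro conjI allI ballI extend_in_skeleton)
  show "continuous_map (Cl G) euclideanreal (\<lambda>y. extend y w)" for w
    by (cases w) (auto simp: extend_def continuous_map_coordinate)
qed

lemma push_extend: "(\<And>e v. m e v = 0) \<Longrightarrow> push m (extend y) = extend y"
  by (rule ext) (simp add: push_def extend_def split: sum.split)

lemma concentrate_extend: "concentrate (extend y) = extend y"
  unfolding concentrate_def by (rule push_extend) (simp add: shift_def extend_def)

lemma halve_extend: "halve (extend y) = extend y"
  unfolding halve_def by (rule push_extend) (simp add: extend_def)

lemma collapse_extend: "collapse (extend y) = y"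
  by (rule ext) (simp add: collapse_def concentrate_extend halve_extend extend_def)

lemma extend_collapse:
  assumes "x \<in> topspace (realization skeleton)"
  shows "extend (collapse x) = halve (concentrate x)"
proof
  fix w show "extend (collapse x) w = halve (concentrate x) w"
    using halve_Inr[OF concentrate_in_skeleton[OF assms]]
    by (cases w) (auto simp: extend_def collapse_def)
qed

lemma collapse_in_Cl:
  assumes "x \<in> topspace (realization skeleton)"
  shows "collapse x \<in> topspace (Cl G)"
proof -
  let ?y = "collapse x"
  obtain \<tau> where \<tau>: "\<tau> \<in> clique_complex G" "{w. extend ?y w \<noteq> 0} \<subseteq> Inl ` \<tau>"
    using halve_step(2)[OF concentrate_in_skeleton[OF assms] concentrate_step(2)[OF assms]]
    unfolding extend_collapse[OF assms] by blast
  then have supp: "{v. ?y v \<noteq> 0} \<subseteq> \<tau>" unfolding extend_support by auto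
  have fin: "finite \<tau>" using \<tau>(1) by (simp add: clique_complex_def)
  have mem: "extend ?y \<in> topspace (realization skeleton)"
    unfolding extend_collapse[OF assms]
    using halve_in_skeleton concentrate_in_skeleton concentrate_step(2) assms by blast
  show ?thesis
  proof (rule realizationI[OF simplicial_complex_clique_complex \<tau>(1) supp _ _ fin supp])
    show "0 \<le> ?y v" for v
      using skeleton_point(1)[OF mem, of "Inl v"] by (simp add: extend_def)
    have "sum (extend ?y) (Inl ` \<tau>) = 1"
      by (rule realization_sum_eq_1[OF mem \<tau>(2)]) (use fin in simp)
    then show "sum ?y \<tau> = 1" by (simp add: sum.reindex extend_def)
  qed
qed

lemma continuous_map_collapse: "continuous_map (realization skeleton) (Cl G) collapse"
  unfolding continuous_map_realization_iff
proof (intro conjI allI ballI collapse_in_Cl)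
  show "continuous_map (realization skeleton) euclideanreal (\<lambda>x. collapse x v)" for v
    using continuous_map_halve_concentrate unfolding continuous_map_realization_iff collapse_def o_def by blast
qed

text \<open>Both stages are contiguous to what precedes them, and neither moves a point without mass
  on edge vertices. The result is a strong deformation retraction, as the comparison of cone
  attachments demands.\<close>

lemma skeleton_deformation:
  "homotopic_with (\<lambda>k. \<forall>y\<in>topspace (Cl G). k (extend y) = extend y)
     (realization skeleton) (realization skeleton) id (extend \<circ> collapse)"
proof -
  let ?R = "realization skeleton"
  let ?P = "\<lambda>k. \<forall>y\<in>topspace (Cl G). k (extend y) = extend y"
  have "homotopic_with (\<lambda>k. \<forall>z\<in>range extend. k z = id z) ?R ?R id concentrate"
  proof (rule contiguous_imp_homotopic[OF simplicial_complex_skeleton _ continuous_map_concentrate])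
    show "\<exists>\<sigma>\<in>skeleton. {w. id x w \<noteq> 0} \<union> {w. concentrate x w \<noteq> 0} \<subseteq> \<sigma>" if "x \<in> topspace ?R" for x
      using concentrate_step(1)[OF that] by simp
  qed (auto simp: concentrate_extend)
  then have 1: "homotopic_with ?P ?R ?R id concentrate"
    by (rule homotopic_with_mono) auto
  have "homotopic_with (\<lambda>k. \<forall>z\<in>range extend. k z = concentrate z) ?R ?R concentrate (halve \<circ> concentrate)"
  proof (rule contiguous_imp_homotopic[OF simplicial_complex_skeleton continuous_map_concentrate
        continuous_map_halve_concentrate])
    show "\<exists>\<sigma>\<in>skeleton. {w. concentrate x w \<noteq> 0} \<union> {w. (halve \<circ> concentrate) x w \<noteq> 0} \<subseteq> \<sigma>"
      if "x \<in> topspace ?R" for x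
      using halve_step(1)[OF concentrate_in_skeleton[OF that] concentrate_step(2)[OF that]] by simp
  qed (auto simp: concentrate_extend halve_extend)
  then have "homotopic_with ?P ?R ?R concentrate (halve \<circ> concentrate)"
    by (rule homotopic_with_mono) (auto simp: concentrate_extend)
  \<comment> \<open>The two maps are known to agree on the realization only, so the side condition
    must depend on values there; \<open>extend\<close> maps \<open>Cl G\<close> into it.\<close>
  then have 2: "homotopic_with ?P ?R ?R concentrate (extend \<circ> collapse)"
  proof (rule homotopic_with_eq)
    show "?P h \<longleftrightarrow> ?P k" if "\<And>x. x \<in> topspace ?R \<Longrightarrow> h x = k x" for h k
      using that extend_in_skeleton by simp
  qed (simp_all add: extend_collapse)
  show ?thesis
    by (rule homotopic_with_trans[OF 1 2])
qed

end

section \<open>The discs spanned by the edges of triangles\<close>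

lemma closedin_disjoint_sum_imp:
  assumes "closedin (disjoint_sum X Y) C"
  shows "closedin X (Inl -` C)" "closedin Y (Inr -` C)"
proof -
  have "C \<subseteq> topspace X <+> topspace Y" and op: "openin (disjoint_sum X Y) (topspace X <+> topspace Y - C)"
    using assms by (auto simp: closedin_def)
  moreover have "Inl -` (topspace X <+> topspace Y - C) = topspace X - Inl -` C"
    "Inr -` (topspace X <+> topspace Y - C) = topspace Y - Inr -` C"
    by auto
  ultimately show "closedin X (Inl -` C)" "closedin Y (Inr -` C)"
    by (auto simp: closedin_def openin_disjoint_sum)
qed

text \<open>The index set is left open: it will be the set of triangles itself for arbitrary
  attaching points, and an initial segment of the naturals for the wedge. The map
  \<open>side\<close> numbers the three edges, matching them with the coordinates of
  \<open>real ^ 3\<close>.\<close>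

locale indexed_triangles = simple_graph G for G :: "'a graph" +
  fixes I :: "'i set" and tri :: "'i \<Rightarrow> 'a set" and side :: "'i \<Rightarrow> 3 \<Rightarrow> 'a set"
  assumes bij_tri: "bij_betw tri I (triangles G)"
    and bij_side: "i \<in> I \<Longrightarrow> bij_betw (side i) UNIV {e. e \<subseteq> tri i \<and> card e = 2}"
begin

lemma tri_in: "i \<in> I \<Longrightarrow> tri i \<in> triangles G"
  using bij_tri by (auto simp: bij_betw_def)

lemma medial_triangles: "medial ` triangles G = (\<lambda>i. medial (tri i)) ` I"
  by (simp add: bij_betw_imp_surj_on[OF bij_tri, symmetric] image_image)

lemma finite_I: "finite I"
  using finite_triangles bij_betw_finite[OF bij_tri] by simp

lemma inj_side: "i \<in> I \<Longrightarrow> side i k = side i l \<longleftrightarrow> k = l"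
  using bij_side[of i] by (auto simp: bij_betw_def inj_on_def)

lemma medial_eq: "i \<in> I \<Longrightarrow> medial (tri i) = range (\<lambda>k. Inr (side i k))"
  unfolding medial_def by (simp add: bij_betw_imp_surj_on[OF bij_side, symmetric] image_image)

text \<open>The affine chart of the simplex \<open>medial (tri i)\<close>. At most one summand is
  nonzero for \<open>i \<in> I\<close>; writing a sum instead of an inverse of \<open>side\<close>
  makes the value 0 elsewhere and the continuity evident.\<close>

definition place :: "'i \<Rightarrow> real ^ 3 \<Rightarrow> 'a + 'a set \<Rightarrow> real" where
  "place i y w = (\<Sum>k\<in>UNIV. if w = Inr (side i k) then y $ k else 0)"

lemma place_side: "i \<in> I \<Longrightarrow> place i y (Inr (side i k)) = y $ k"
  by (simp add: place_def inj_side)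

lemma place_other: "w \<notin> range (\<lambda>k. Inr (side i k)) \<Longrightarrow> place i y w = 0"
  unfolding place_def by (intro sum.neutral) auto

lemma place_support:
  assumes "i \<in> I"
  shows "{w. place i y w \<noteq> 0} = (\<lambda>k. Inr (side i k)) ` {k. y $ k \<noteq> 0}"
proof -
  have "place i y w \<noteq> 0 \<longleftrightarrow> w \<in> (\<lambda>k. Inr (side i k)) ` {k. y $ k \<noteq> 0}" for w
  proof (cases "w \<in> range (\<lambda>k. Inr (side i k))")
    case True
    with place_side[OF assms] inj_side[OF assms] show ?thesis by auto
  next
    case False
    with place_other show ?thesis by auto
  qed
  then show ?thesis by blast
qed

lemma place_in_total:
  assumes i: "i \<in> I" and y: "\<And>k. 0 \<le> y $ k" "(\<Sum>k\<in>UNIV. y $ k) = 1"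
  shows "place i y \<in> topspace (Cl (total_graph G))"
proof -
  have supp: "{w. place i y w \<noteq> 0} \<subseteq> medial (tri i)"
    unfolding place_support[OF i] medial_eq[OF i] by auto
  have "sum (place i y) (medial (tri i)) = (\<Sum>k\<in>UNIV. y $ k)"
    unfolding medial_eq[OF i]
    by (subst sum.reindex) (auto simp: inj_on_def inj_side[OF i] place_side[OF i])
  then show ?thesis
    using y(2)
    by (intro realizationI[OF simplicial_complex_clique_complex medial_clique[OF tri_in[OF i]] supp _ _ _ supp])
      (auto simp: place_def y(1) medial_eq[OF i] intro!: sum_nonneg)
qed

section \<open>The skeleton as a closed subspace\<close>

lemma skeleton_topspace:
  "topspace (realization skeleton) =
     {x \<in> topspace (Cl (total_graph G)). {w. x w \<noteq> 0} \<notin> medial ` triangles G}"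
  by (auto simp: realization_iff skeleton_def)

text \<open>The open medial discs are described by the nonvanishing of a product of coordinates, so
  they are open. If all three coordinates are nonzero, the support contains a medial simplex, and as
  the skeleton is closed under faces the support is not in it.\<close>

lemma skeleton_topspace_prod:
  "topspace (realization skeleton) = topspace (Cl (total_graph G)) -
     (\<Union>i\<in>I. {x \<in> topspace (Cl (total_graph G)). (\<Prod>k\<in>UNIV. x (Inr (side i k))) \<in> - {0}})"
proof -
  have "{w. x w \<noteq> 0} \<in> medial ` triangles G \<longleftrightarrow> (\<exists>i\<in>I. (\<Prod>k\<in>UNIV. x (Inr (side i k))) \<noteq> 0)"
    if x: "x \<in> topspace (Cl (total_graph G))" for x
  proof
    assume "{w. x w \<noteq> 0} \<in> medial ` triangles G"
    then obtain i where i: "i \<in> I" "{w. x w \<noteq> 0} = medial (tri i)"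
      unfolding medial_triangles by auto
    then have "x (Inr (side i k)) \<noteq> 0" for k
      using medial_eq[OF i(1)] by blast
    with i(1) show "\<exists>i\<in>I. (\<Prod>k\<in>UNIV. x (Inr (side i k))) \<noteq> 0" by auto
  next
    assume "\<exists>i\<in>I. (\<Prod>k\<in>UNIV. x (Inr (side i k))) \<noteq> 0"
    then obtain i where i: "i \<in> I" "\<And>k. x (Inr (side i k)) \<noteq> 0" by auto
    then have sub: "medial (tri i) \<subseteq> {w. x w \<noteq> 0}" by (auto simp: medial_eq)
    show "{w. x w \<noteq> 0} \<in> medial ` triangles G"
    proof (rule ccontr)
      assume "{w. x w \<noteq> 0} \<notin> medial ` triangles G"
      with x have "{w. x w \<noteq> 0} \<in> skeleton" by (simp add: skeleton_def realization_iff)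
      with sub have "medial (tri i) \<in> skeleton"
        using simplicial_complex_skeleton medial_nonempty[OF tri_in[OF i(1)]]
        unfolding simplicial_complex_def by auto
      with tri_in[OF i(1)] show False by (simp add: skeleton_def)
    qed
  qed
  then show ?thesis
    unfolding skeleton_topspace by auto
qed

lemma closedin_skeleton: "closedin (Cl (total_graph G)) (topspace (realization skeleton))"
  unfolding skeleton_topspace_prod
proof (intro closedin_diff closedin_topspace openin_Union ballI, clarify)
  fix i assume "i \<in> I"
  have "continuous_map (Cl (total_graph G)) euclideanreal (\<lambda>x. \<Prod>k\<in>UNIV. x (Inr (side i k)))"
    by (intro continuous_map_prod continuous_map_coordinate) simp
  then show "openin (Cl (total_graph G))
      {x \<in> topspace (Cl (total_graph G)). (\<Prod>k\<in>UNIV. x (Inr (side i k))) \<in> - {0}}"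
    by (rule openin_continuous_map_preimage) (simp add: open_Compl)
qed

lemma realization_skeleton_subtopology:
  "realization skeleton = subtopology (Cl (total_graph G)) (topspace (realization skeleton))"
proof -
  have "topspace (realization skeleton) \<subseteq> topspace (Cl (total_graph G))"
    unfolding skeleton_topspace by auto
  then show ?thesis
    by (simp add: realization_def subtopology_subtopology Int_absorb1)
qed

text \<open>If a coordinate vanishes, the support misses one side of \<open>tri i\<close>. It could
  still be removed only as \<open>medial t\<close> for a triangle \<open>t\<close> inside
  \<open>tri i\<close>, but then \<open>t = tri i\<close> by cardinality.\<close>

lemma place_in_skeleton:
  assumes i: "i \<in> I" and y: "\<And>k. 0 \<le> y $ k" "(\<Sum>k\<in>UNIV. y $ k) = 1"
  shows "place i y \<in> topspace (realization skeleton) \<longleftrightarrow> (\<exists>k. y $ k = 0)"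
proof
  assume sk: "place i y \<in> topspace (realization skeleton)"
  show "\<exists>k. y $ k = 0"
  proof (rule ccontr)
    assume "\<nexists>k. y $ k = 0"
    then have "{w. place i y w \<noteq> 0} = medial (tri i)"
      unfolding place_support[OF i] medial_eq[OF i] by auto
    with sk tri_in[OF i] show False
      unfolding skeleton_topspace by auto
  qed
next
  assume "\<exists>k. y $ k = 0"
  then obtain k where k: "y $ k = 0" ..
  have "{w. place i y w \<noteq> 0} \<noteq> medial t" if t: "t \<in> triangles G" for t
  proof
    assume eq: "{w. place i y w \<noteq> 0} = medial t"
    have "medial t \<subseteq> medial (tri i)"
      unfolding eq[symmetric] place_support[OF i] medial_eq[OF i] by auto
    then have "\<Union>(Inr -` medial t) \<subseteq> \<Union>(Inr -` medial (tri i))" by blast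
    then have "t \<subseteq> tri i"
      unfolding Union_medial[OF t] Union_medial[OF tri_in[OF i]] .
    moreover have "card t = 3" "card (tri i) = 3"
      using t tri_in[OF i] by (auto simp: triangles_def)
    ultimately have "t = tri i"
      by (metis card_subset_eq card.infinite zero_neq_numeral)
    then have "Inr (side i k) \<in> {w. place i y w \<noteq> 0}"
      using eq medial_eq[OF i] by auto
    with k place_side[OF i] show False by simp
  qed
  with place_in_total[OF i y] show "place i y \<in> topspace (realization skeleton)"
    unfolding skeleton_topspace by auto
qed

section \<open>The cells and the gluing\<close>

definition cell :: "('i \<times> (real ^ 3)) \<times> real \<Rightarrow> 'a + 'a set \<Rightarrow> real" where
  "cell = (\<lambda>((i, a), r). place i (triangle_center + r *\<^sub>R (a - triangle_center)))"

abbreviation boundaries :: "('i \<times> (real ^ 3)) topology" where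
  "boundaries \<equiv> prod_topology (discrete_topology I) (top_of_set triangle_boundary)"

definition attaching :: "'i \<times> (real ^ 3) \<Rightarrow> 'a + 'a set \<Rightarrow> real" where
  "attaching = (\<lambda>(i, a). place i a)"

lemma cone_coordinate:
  "(triangle_center + r *\<^sub>R (a - triangle_center)) $ k = (1 - r) / 3 + r * a $ k"
  by (simp add: triangle_center_def algebra_simps diff_divide_distrib)

text \<open>For \<open>r < 1\<close> every coordinate is at least \<open>(1 - r) / 3\<close>, so the
  open cone is the interior of the simplex.\<close>

lemma cone_point:
  assumes "a \<in> triangle_boundary" "0 \<le> r" "r \<le> 1"
  shows "0 \<le> (triangle_center + r *\<^sub>R (a - triangle_center)) $ k"
    and "(\<Sum>k\<in>UNIV. (triangle_center + r *\<^sub>R (a - triangle_center)) $ k) = 1"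
    and "r < 1 \<Longrightarrow> 0 < (triangle_center + r *\<^sub>R (a - triangle_center)) $ k"
proof -
  have a: "\<And>k. 0 \<le> a $ k" "(\<Sum>k\<in>UNIV. a $ k) = 1"
    using assms(1) by (auto simp: triangle_boundary_def)
  show "0 \<le> (triangle_center + r *\<^sub>R (a - triangle_center)) $ k"
    "r < 1 \<Longrightarrow> 0 < (triangle_center + r *\<^sub>R (a - triangle_center)) $ k"
    unfolding cone_coordinate using assms(2,3) a(1) by (simp_all add: add_pos_nonneg)
  show "(\<Sum>k\<in>UNIV. (triangle_center + r *\<^sub>R (a - triangle_center)) $ k) = 1"
    unfolding cone_coordinate using a(2)
    by (simp add: sum.distrib flip: sum_distrib_left) (simp add: field_simps)
qed

text \<open>The radius can be read off the point: its smallest coordinate is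
  \<open>(1 - r) / 3\<close>, attained where \<open>a\<close> vanishes.\<close>

lemma cone_point_inj:
  assumes a: "a \<in> triangle_boundary" "a' \<in> triangle_boundary" and r: "0 \<le> r" "0 \<le> r'"
    and eq: "triangle_center + r *\<^sub>R (a - triangle_center) = triangle_center + r' *\<^sub>R (a' - triangle_center)"
  shows "r = r'" "a = a' \<or> r = 0"
proof -
  have le: "r \<le> r'" if h: "a \<in> triangle_boundary" "a' \<in> triangle_boundary" "0 \<le> r'"
    "triangle_center + r *\<^sub>R (a - triangle_center) = triangle_center + r' *\<^sub>R (a' - triangle_center)" for a a' r r'
  proof -
    obtain k where k: "a $ k = 0" using h(1) by (auto simp: triangle_boundary_def)
    have "(1 - r) / 3 + r * a $ k = (1 - r') / 3 + r' * a' $ k"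
      using h(4) unfolding cone_coordinate[symmetric] by simp
    moreover have "0 \<le> r' * a' $ k" using h(2,3) by (simp add: triangle_boundary_def)
    ultimately obtain d where "(1 - r) / 3 = (1 - r') / 3 + d" "0 \<le> d" using k by simp
    then show ?thesis by (simp add: field_simps)
  qed
  show "r = r'"
    using le[OF a r(2) eq] le[OF a(2,1) r(1) eq[symmetric]] by simp
  with eq show "a = a' \<or> r = 0" by auto
qed

lemma continuous_map_place:
  assumes "\<And>k. continuous_map Z euclideanreal (\<lambda>z. f z $ k)"
  shows "continuous_map Z euclideanreal (\<lambda>z. place i (f z) w)"
  unfolding place_def
  by (intro continuous_map_sum continuous_map_if assms) auto

lemma continuous_map_attaching: "continuous_map boundaries (realization skeleton) attaching"
  unfolding continuous_map_realization_iff
proof (intro conjI allI ballI)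
  show "continuous_map boundaries euclideanreal (\<lambda>z. attaching z w)" for w
    unfolding attaching_def case_prod_unfold
  proof (rule continuous_map_from_discrete_factor[OF continuous_map_fst])
    show "continuous_map boundaries euclideanreal (\<lambda>z. place i (snd z) w)" for i
    proof (rule continuous_map_place)
      show "continuous_map boundaries euclideanreal (\<lambda>z. snd z $ k)" for k
        using continuous_map_compose[OF continuous_map_snd, of "top_of_set triangle_boundary" euclideanreal "\<lambda>a. a $ k"]
        by (simp add: o_def continuous_on_component)
    qed
  qed
  show "attaching z \<in> topspace (realization skeleton)" if "z \<in> topspace boundaries" for z
    using that place_in_skeleton[of "fst z" "snd z"]
    by (auto simp: attaching_def triangle_boundary_def)
qed

lemma continuous_map_cell:
  "continuous_map (prod_topology boundaries unit_interval) (Cl (total_graph G)) cell"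
  unfolding continuous_map_realization_iff
proof (intro conjI allI ballI)
  let ?P = "prod_topology boundaries unit_interval"
  have p: "continuous_map ?P (discrete_topology I) (\<lambda>z. fst (fst z))"
    using continuous_map_compose[OF continuous_map_fst continuous_map_fst] by (fastforce simp: o_def)
  have a: "continuous_map ?P (top_of_set triangle_boundary) (\<lambda>z. snd (fst z))"
    using continuous_map_compose[OF continuous_map_fst continuous_map_snd] by (fastforce simp: o_def)
  have r: "continuous_map ?P euclideanreal snd"
    by (rule continuous_map_into_fulltopology[OF continuous_map_snd])
  show "continuous_map ?P euclideanreal (\<lambda>z. cell z w)" for w
    unfolding cell_def case_prod_unfold
  proof (rule continuous_map_from_discrete_factor[OF p])
    show "continuous_map ?P euclideanreal
        (\<lambda>z. place i (triangle_center + snd z *\<^sub>R (snd (fst z) - triangle_center)) w)" for i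
    proof (rule continuous_map_place)
      show "continuous_map ?P euclideanreal
          (\<lambda>z. (triangle_center + snd z *\<^sub>R (snd (fst z) - triangle_center)) $ k)" for k
      proof -
        have "continuous_map ?P euclideanreal (\<lambda>z. snd (fst z) $ k)"
          using continuous_map_compose[OF a, of euclideanreal "\<lambda>a. a $ k"]
          by (simp add: o_def continuous_on_component)
        then show ?thesis
          unfolding cone_coordinate
          by (intro continuous_map_add continuous_map_real_mult continuous_map_real_divide
              continuous_map_diff r) auto
      qed
    qed
  qed
  show "cell z \<in> topspace (Cl (total_graph G))" if "z \<in> topspace ?P" for z
    using that cone_point by (auto simp: cell_def intro!: place_in_total)
qed

text \<open>A point in the interior of a medial simplex lies on a segment from the centre to the
  boundary, found by prolonging the ray through it.\<close>

lemma total_point_cases: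
  assumes x: "x \<in> topspace (Cl (total_graph G))"
  shows "x \<in> topspace (realization skeleton) \<or> x \<in> cell ` topspace (prod_topology boundaries unit_interval)"
proof (cases "{w. x w \<noteq> 0} \<in> medial ` triangles G")
  case False
  with x show ?thesis unfolding skeleton_topspace by simp
next
  case True
  then obtain i where i: "i \<in> I" and supp: "{w. x w \<noteq> 0} = medial (tri i)"
    unfolding medial_triangles by auto
  define y :: "real ^ 3" where "y = (\<chi> k. x (Inr (side i k)))"
  have pos: "0 < y $ k" for k
  proof -
    have "x (Inr (side i k)) \<noteq> 0" using supp medial_eq[OF i] by blast
    with x show ?thesis by (simp add: y_def realization_iff less_le)
  qed
  have "sum x (medial (tri i)) = 1"
    by (rule realization_sum_eq_1[OF x]) (use supp medial_eq[OF i] in auto)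
  then have sum1: "(\<Sum>k\<in>UNIV. y $ k) = 1"
    unfolding medial_eq[OF i] by (simp add: sum.reindex inj_on_def inj_side[OF i] y_def)
  have x_eq: "x = place i y"
  proof
    fix w show "x w = place i y w"
    proof (cases "w \<in> range (\<lambda>k. Inr (side i k))")
      case True
      then show ?thesis using place_side[OF i] by (auto simp: y_def)
    next
      case False
      then have "x w = 0" using supp medial_eq[OF i] by auto
      with place_other[OF False] show ?thesis by simp
    qed
  qed
  obtain a r where a: "a \<in> triangle_boundary" and r: "0 \<le> r" "r \<le> 1"
    and y_eq: "y = triangle_center + r *\<^sub>R (a - triangle_center)"
  proof (cases "y = triangle_center")
    case True
    have "axis 1 1 \<in> triangle_boundary"
      by (auto simp: triangle_boundary_def axis_def intro: exI[of _ 2])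
    with True that[of "axis 1 1" 0] show thesis by simp
  next
    case False
    have "(\<Sum>k\<in>UNIV. (y - triangle_center) $ k) = 0"
      using sum1 by (simp add: sum_subtractf triangle_center_def)
    then obtain c where c: "0 < c" "triangle_center + c *\<^sub>R (y - triangle_center) \<in> triangle_boundary"
      using triangle_boundary_ray[of "y - triangle_center"] False by auto
    obtain k where "(triangle_center + c *\<^sub>R (y - triangle_center)) $ k = 0"
      using c(2) by (auto simp: triangle_boundary_def)
    then have "(1 - c) / 3 + c * y $ k = 0" unfolding cone_coordinate .
    moreover have "0 < c * y $ k" using c(1) pos by simp
    \<comment> \<open>All coordinates of \<open>y\<close> are positive, so the ray leaves the
      simplex beyond \<open>y\<close>; hence \<open>c\<close> exceeds 1 and \<open>1 / c\<close> is
      a legitimate radius.\<close>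
    ultimately have "(1 - c) / 3 < 0" by (metis add_pos_nonneg less_irrefl add.commute linorder_not_less)
    then have "1 \<le> c" by simp
    with c that[OF c(2), of "1 / c"] show thesis by simp
  qed
  have "x = cell ((i, a), r)" by (simp add: cell_def x_eq y_eq)
  moreover have "((i, a), r) \<in> topspace (prod_topology boundaries unit_interval)"
    using i a r by simp
  ultimately show ?thesis by blast
qed

lemma compact_boundaries: "compact_space (prod_topology boundaries unit_interval)"
  using finite_I compact_triangle_boundary
  by (simp add: compact_space_prod_topology compact_space_discrete_topology compact_space_subtopology)

text \<open>There are finitely many triangles, so the cones form a compact space and
  \<open>cell\<close> is closed; the skeleton is a closed subspace. A continuous closed surjection
  is a quotient map.\<close>

lemma quotient_map_total:
  "quotient_map (disjoint_sum (realization skeleton) (prod_topology boundaries unit_interval))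
     (Cl (total_graph G)) (case_sum id cell)"
proof (rule continuous_closed_imp_quotient_map)
  let ?R = "realization skeleton" and ?P = "prod_topology boundaries unit_interval"
  have "continuous_map ?R (Cl (total_graph G)) id"
    by (metis continuous_map_from_subtopology continuous_map_id realization_skeleton_subtopology)
  then show "continuous_map (disjoint_sum ?R ?P) (Cl (total_graph G)) (case_sum id cell)"
    by (intro continuous_map_disjoint_sum) (simp_all add: o_def continuous_map_cell id_def)
  show "closed_map (disjoint_sum ?R ?P) (Cl (total_graph G)) (case_sum id cell)"
    unfolding closed_map_def
  proof (intro allI impI)
    fix C assume "closedin (disjoint_sum ?R ?P) C"
    note C = closedin_disjoint_sum_imp[OF this]
    have "case_sum id cell ` C = Inl -` C \<union> cell ` (Inr -` C)"
      by (force simp: image_iff split: sum.splits)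
    moreover have "closedin (Cl (total_graph G)) (Inl -` C)"
      using C(1) closedin_skeleton realization_skeleton_subtopology by (metis closedin_trans_full)
    moreover have "closedin (Cl (total_graph G)) (cell ` (Inr -` C))"
      using continuous_imp_closed_map[OF continuous_map_cell compact_boundaries Hausdorff_space_realization] C(2)
      by (simp add: closed_map_def)
    ultimately show "closedin (Cl (total_graph G)) (case_sum id cell ` C)"
      by (simp only: closedin_Un)
  qed
  show "case_sum id cell ` topspace (disjoint_sum ?R ?P) = topspace (Cl (total_graph G))"
  proof
    show "case_sum id cell ` topspace (disjoint_sum ?R ?P) \<subseteq> topspace (Cl (total_graph G))"
      using continuous_map_cell by (auto simp: continuous_map_def skeleton_topspace)
    show "topspace (Cl (total_graph G)) \<subseteq> case_sum id cell ` topspace (disjoint_sum ?R ?P)"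
    proof
      fix x assume "x \<in> topspace (Cl (total_graph G))"
      from total_point_cases[OF this]
      show "x \<in> case_sum id cell ` topspace (disjoint_sum ?R ?P)"
      proof
        assume "x \<in> topspace ?R"
        then show ?thesis by (intro image_eqI[of _ _ "Inl x"]) auto
      next
        assume "x \<in> cell ` topspace ?P"
        then obtain z where "x = cell z" "z \<in> topspace ?P" by blast
        then show ?thesis by (intro image_eqI[of _ _ "Inr z"]) (simp_all add: InrI)
      qed
    qed
  qed
qed

lemma cone_attachment_total:
  "cone_attachment (Cl (total_graph G)) (realization skeleton) boundaries attaching fst id cell"
proof
  show "quotient_map (disjoint_sum (realization skeleton) (prod_topology boundaries unit_interval))
     (Cl (total_graph G)) (case_sum id cell)"
    by (rule quotient_map_total)
  show "continuous_map boundaries (realization skeleton) attaching"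
    by (rule continuous_map_attaching)
  show "inj_on id (topspace (realization skeleton))" by simp
  show "id l = cell (z, r) \<longleftrightarrow> r = 1 \<and> l = attaching z"
    if l: "l \<in> topspace (realization skeleton)" and z: "z \<in> topspace boundaries" and r: "0 \<le> r" "r \<le> 1"
    for l z r
  proof -
    obtain i a where [simp]: "z = (i, a)" and i: "i \<in> I" and a: "a \<in> triangle_boundary"
      using z by auto
    \<comment> \<open>A cone point with \<open>r < 1\<close> has all coordinates positive, so it
      lies outside the skeleton.\<close>
    have "r = 1" if "l = cell (z, r)"
    proof (rule ccontr)
      assume "r \<noteq> 1"
      then have "\<nexists>k. (triangle_center + r *\<^sub>R (a - triangle_center)) $ k = 0"
        using cone_point(3)[OF a r] r by (metis less_irrefl less_le)
      then have "place i (triangle_center + r *\<^sub>R (a - triangle_center)) \<notin> topspace (realization skeleton)"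
        using place_in_skeleton[OF i] cone_point(1,2)[OF a r] by blast
      with l that show False by (simp add: cell_def)
    qed
    then show ?thesis by (auto simp: cell_def attaching_def)
  qed
  show "cell (z, r) = cell (z', r') \<longleftrightarrow> r = r' \<and> (z = z' \<or> r = 0 \<and> fst z = fst z')"
    if z: "z \<in> topspace boundaries" "z' \<in> topspace boundaries" and r: "0 \<le> r" "r < 1" "0 \<le> r'" "r' < 1"
    for z z' r r'
  proof
    obtain i a where [simp]: "z = (i, a)" and i: "i \<in> I" and a: "a \<in> triangle_boundary"
      using z(1) by auto
    obtain i' a' where [simp]: "z' = (i', a')" and i': "i' \<in> I" and a': "a' \<in> triangle_boundary"
      using z(2) by auto
    let ?y = "triangle_center + r *\<^sub>R (a - triangle_center)"
    let ?y' = "triangle_center + r' *\<^sub>R (a' - triangle_center)"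
    assume "cell (z, r) = cell (z', r')"
    then have eq: "place i ?y = place i' ?y'" by (simp add: cell_def)
    have full: "{w. place i (triangle_center + r *\<^sub>R (a - triangle_center)) w \<noteq> 0} = medial (tri i)"
      if "i \<in> I" "a \<in> triangle_boundary" "0 \<le> r" "r < 1" for i a r
    proof -
      have "(triangle_center + r *\<^sub>R (a - triangle_center)) $ k \<noteq> 0" for k
        using cone_point(3)[OF that(2,3) _ that(4), of k] that(4) by simp
      then show ?thesis
        unfolding place_support[OF that(1)] medial_eq[OF that(1)] by simp
    qed
    \<comment> \<open>Below radius 1 the support is the whole medial simplex, and it determines the
      triangle and thereby the index.\<close>
    have "medial (tri i) = medial (tri i')"
      using full[OF i a r(1,2)] full[OF i' a' r(3,4)] eq by simp
    from arg_cong[OF this, of "\<lambda>S. \<Union>(Inr -` S)"] have "tri i = tri i'"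
      unfolding Union_medial[OF tri_in[OF i]] Union_medial[OF tri_in[OF i']] .
    then have ii: "i = i'" using bij_tri i i' by (auto simp: bij_betw_def inj_on_def)
    have "?y = ?y'"
      unfolding vec_eq_iff
    proof
      fix k
      show "?y $ k = ?y' $ k"
        using fun_cong[OF eq, of "Inr (side i k)"] place_side[OF i] unfolding ii[symmetric] by metis
    qed
    from cone_point_inj[OF a a' r(1,3) this] ii show "r = r' \<and> (z = z' \<or> r = 0 \<and> fst z = fst z')"
      by auto
  next
    assume "r = r' \<and> (z = z' \<or> r = 0 \<and> fst z = fst z')"
    then show "cell (z, r) = cell (z', r')"
      by (cases z; cases z') (auto simp: cell_def)
  qed
qed

text \<open>Three homotopies are joined: the deformation of the skeleton applied to the boundary
  circle, a contraction to a corner inside the simplex \<open>tri i\<close>, and a motion along a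
  path from that corner to \<open>b i\<close>.\<close>

lemma attaching_homotopic:
  assumes b: "\<And>i v. \<lbrakk>i \<in> I; v \<in> tri i\<rbrakk> \<Longrightarrow> path_component_of (Cl G) (vertex_point v) (b i)"
  shows "homotopic_with (\<lambda>k. True) boundaries (realization skeleton) attaching (extend \<circ> (b \<circ> fst))"
proof -
  let ?R = "realization skeleton"
  have tri_clique: "tri i \<in> clique_complex G" if i: "i \<in> I" for i
  proof -
    have "clique G (tri i)" "card (tri i) = 3" using tri_in[OF i] by (auto simp: triangles_def)
    moreover from this have "finite (tri i)" "tri i \<noteq> {}"
      by (metis card.infinite zero_neq_numeral, auto)
    ultimately show ?thesis by (simp add: clique_complex_def)
  qed
  define v where "v i = (SOME v. v \<in> tri i)" for i
  have v: "v i \<in> tri i" if "i \<in> I" for i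
    using tri_clique[OF that] unfolding v_def by (metis (mono_tags) clique_complex_def equals0I mem_Collect_eq someI)
  have v_verts: "v i \<in> verts G" if "i \<in> I" for i
    using v[OF that] tri_clique[OF that] by (auto simp: clique_complex_def clique_def)
  have "homotopic_with (\<lambda>k. True) boundaries ?R (id \<circ> attaching) ((extend \<circ> collapse) \<circ> attaching)"
    by (rule homotopic_with_compose_continuous_map_right[OF skeleton_deformation continuous_map_attaching]) simp
  then have 1: "homotopic_with (\<lambda>k. True) boundaries ?R attaching ((extend \<circ> collapse) \<circ> attaching)"
    by simp
  have vertex_cont: "continuous_map boundaries ?R (\<lambda>z. extend (vertex_point (v (fst z))))"
  proof -
    have "continuous_map (discrete_topology I) ?R (\<lambda>i. extend (vertex_point (v i)))"
      by (simp add: extend_in_skeleton vertex_point_in_Cl[OF v_verts] Pi_iff)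
    from continuous_map_compose[OF continuous_map_fst this] show ?thesis by (simp add: o_def)
  qed
  have "homotopic_with (\<lambda>k. \<forall>z\<in>{}. k z = ((extend \<circ> collapse) \<circ> attaching) z) boundaries ?R
      ((extend \<circ> collapse) \<circ> attaching) (\<lambda>z. extend (vertex_point (v (fst z))))"
  proof (rule contiguous_imp_homotopic[OF simplicial_complex_skeleton _ vertex_cont])
    show "continuous_map boundaries ?R ((extend \<circ> collapse) \<circ> attaching)"
      using homotopic_with_imp_continuous_maps[OF 1] by blast
    fix z assume z: "z \<in> topspace boundaries"
    obtain i a where [simp]: "z = (i, a)" and i: "i \<in> I" and a: "a \<in> triangle_boundary"
      using z by auto
    let ?x = "place i a"
    have x: "?x \<in> topspace ?R"
      using a by (subst place_in_skeleton[OF i]) (auto simp: triangle_boundary_def)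
    define S where "S = Inl ` tri i \<union> Inr ` {e. e \<subseteq> tri i}"
    have push_S: "{w. push m y w \<noteq> 0} \<subseteq> S"
      if "{w. y w \<noteq> 0} \<subseteq> S" "\<And>e v. y (Inr e) = 0 \<Longrightarrow> v \<in> e \<Longrightarrow> m e v = 0" for m y
    proof (rule push_support[OF that])
      fix e u assume "u \<in> e" "y (Inr e) \<noteq> 0"
      then have "Inr e \<in> S" using that(1) by auto
      with \<open>u \<in> e\<close> show "Inl u \<in> S" by (auto simp: S_def)
    qed
    have "{w. ?x w \<noteq> 0} \<subseteq> medial (tri i)"
      unfolding place_support[OF i] medial_eq[OF i] by auto
    also have "\<dots> \<subseteq> S" by (auto simp: medial_def S_def)
    finally have "{w. halve (concentrate ?x) w \<noteq> 0} \<subseteq> S"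
      unfolding halve_def concentrate_def by (intro push_S) (auto simp: shift_zero)
    then have "w \<in> Inl ` tri i" if "halve (concentrate ?x) w \<noteq> 0" for w
      using that halve_Inr[OF concentrate_in_skeleton[OF x]] by (cases w) (auto simp: S_def)
    moreover have "Inl (v i) \<in> Inl ` tri i" using v[OF i] by simp
    moreover have "{w. extend (vertex_point (v i)) w \<noteq> 0} = {Inl (v i)}"
      unfolding extend_support by (auto simp: vertex_point_def)
    ultimately have "{w. halve (concentrate ?x) w \<noteq> 0} \<union> {w. extend (vertex_point (v i)) w \<noteq> 0} \<subseteq> Inl ` tri i"
      by auto
    then show "\<exists>\<sigma>\<in>skeleton. {w. ((extend \<circ> collapse) \<circ> attaching) z w \<noteq> 0}
        \<union> {w. extend (vertex_point (v (fst z))) w \<noteq> 0} \<subseteq> \<sigma>"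
      using vertices_in_skeleton[OF tri_clique[OF i]]
      by (intro bexI[of _ "Inl ` tri i"]) (simp_all add: attaching_def extend_collapse[OF x])
  qed simp
  then have 2: "homotopic_with (\<lambda>k. True) boundaries ?R
      ((extend \<circ> collapse) \<circ> attaching) (\<lambda>z. extend (vertex_point (v (fst z))))"
    by (rule homotopic_with_mono) simp
  \<comment> \<open>One path is chosen for each index; as the index space is discrete, they form a
    single homotopy.\<close>
  have "\<exists>\<gamma>. \<forall>i\<in>I. continuous_map unit_interval (Cl G) (\<gamma> i) \<and> \<gamma> i 0 = vertex_point (v i) \<and> \<gamma> i 1 = b i"
    using b v by (intro bchoice ballI) (auto simp: path_component_of_def pathin_def)
  then obtain \<gamma> where \<gamma>: "\<And>i. i \<in> I \<Longrightarrow> continuous_map unit_interval (Cl G) (\<gamma> i)"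
    "\<And>i. i \<in> I \<Longrightarrow> \<gamma> i 0 = vertex_point (v i)" "\<And>i. i \<in> I \<Longrightarrow> \<gamma> i 1 = b i"
    by blast
  have 3: "homotopic_with (\<lambda>k. True) boundaries ?R (\<lambda>z. extend (vertex_point (v (fst z)))) (extend \<circ> (b \<circ> fst))"
  proof -
    define h where "h z = extend (\<gamma> (fst (snd z)) (fst z))" for z :: "real \<times> 'i \<times> (real ^ 3)"
    have "continuous_map (prod_topology unit_interval boundaries) ?R h"
      unfolding h_def
    proof (rule continuous_map_from_discrete_factor[where F = "\<lambda>i z. extend (\<gamma> i (fst z))" and I = I])
      show "continuous_map (prod_topology unit_interval boundaries) (discrete_topology I) (\<lambda>z. fst (snd z))"
        using continuous_map_compose[OF continuous_map_snd continuous_map_fst] by (fastforce simp: o_def)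
      show "continuous_map (prod_topology unit_interval boundaries) ?R (\<lambda>z. extend (\<gamma> i (fst z)))"
        if "i \<in> I" for i
        using continuous_map_compose[OF continuous_map_compose[OF continuous_map_fst \<gamma>(1)[OF that]]
            continuous_map_extend] by (simp add: o_def)
    qed
    then show ?thesis
      by (subst homotopic_with) (auto intro!: exI[of _ h] simp: h_def \<gamma>)
  qed
  show ?thesis
    by (rule homotopic_with_trans[OF 1 homotopic_with_trans[OF 2 3]])
qed

end

section \<open>The homotopy type of the total graph complex\<close>

text \<open>Both spaces are cone attachments over \<open>boundaries\<close>, with bases the skeleton
  and \<open>Cl G\<close> related by \<open>extend\<close> and \<open>collapse\<close>, and with
  attaching maps homotopic after \<open>extend\<close>.\<close>

lemma (in indexed_triangles) total_homotopy_equivalent: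
  fixes s :: "real ^ 3"
  assumes s: "norm s = 1"
    and b: "\<And>i v. \<lbrakk>i \<in> I; v \<in> tri i\<rbrakk> \<Longrightarrow> path_component_of (Cl G) (vertex_point v) (b i)"
  shows "Cl (total_graph G) homotopy_equivalent_space attach_copies (Cl G) I b S2 s"
proof -
  obtain \<kappa> where \<kappa>:
    "quotient_map (prod_topology (top_of_set triangle_boundary) unit_interval) S2 \<kappa>"
    "\<forall>a\<in>triangle_boundary. \<forall>r\<in>{0..1}. \<kappa> (a, r) = s \<longleftrightarrow> r = 1"
    "\<forall>a\<in>triangle_boundary. \<forall>a'\<in>triangle_boundary. \<forall>r\<in>{0..<1}. \<forall>r'\<in>{0..<1}.
      \<kappa> (a, r) = \<kappa> (a', r') \<longleftrightarrow> r = r' \<and> (a = a' \<or> r = 0)"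
    using sphere_as_cone[OF s] by blast
  have "b i \<in> topspace (Cl G)" if i: "i \<in> I" for i
  proof -
    obtain u v w where "tri i = {u, v, w}" using triangleE[OF tri_in[OF i]] by metis
    then have "u \<in> tri i" by simp
    from path_component_of_equiv[THEN iffD1, OF b[OF i this]] show ?thesis by blast
  qed
  then have b_in: "b \<in> I \<rightarrow> topspace (Cl G)" by blast
  have "cone_attachment (attach_copies (Cl G) I b S2 s) (Cl G) boundaries (b \<circ> fst) fst Inl
      (\<lambda>((t, a), r). if r = 1 then Inl (b t) else Inr (t, \<kappa> (a, r)))"
    by (rule cone_attachment_attach_copies[OF \<kappa>(1) _ _ b_in]) (simp_all add: \<kappa>)
  from cone_attachment_homotopy_equivalent[OF cone_attachment_total this continuous_map_extend
      continuous_map_collapse collapse_extend skeleton_deformation attaching_homotopic[OF b]]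
  show ?thesis by simp
qed

section \<open>Connected graphs and the choice of indices\<close>

text \<open>A path is a homotopy between maps from a one-point space, so this is an instance of
  contiguity.\<close>

lemma contiguous_imp_path_component:
  assumes K: "simplicial_complex K" and \<sigma>: "\<sigma> \<in> K"
    and f: "f \<in> topspace (realization K)" "{v. f v \<noteq> 0} \<subseteq> \<sigma>"
    and g: "g \<in> topspace (realization K)" "{v. g v \<noteq> 0} \<subseteq> \<sigma>"
  shows "path_component_of (realization K) f g"
proof -
  have "homotopic_with (\<lambda>k. \<forall>z\<in>{}. k z = f) (discrete_topology {()}) (realization K) (\<lambda>_. f) (\<lambda>_. g)"
    by (rule contiguous_imp_homotopic[OF K]) (use f g \<sigma> in auto)
  then obtain h where h: "continuous_map (prod_topology unit_interval (discrete_topology {()})) (realization K) h"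
    "\<And>z. h (0, z) = f" "\<And>z. h (1, z) = g"
    unfolding homotopic_with_def by auto
  have "continuous_map unit_interval (prod_topology unit_interval (discrete_topology {()})) (\<lambda>t. (t, ()))"
    by (intro continuous_map_pairedI) (simp_all add: continuous_map_id[unfolded id_def])
  from continuous_map_compose[OF this h(1)] show ?thesis
    unfolding path_component_of_def pathin_def
    by (intro exI[of _ "\<lambda>t. h (t, ())"]) (simp add: h o_def)
qed

context simple_graph
begin

lemma vertex_point_support: "{w. vertex_point v w \<noteq> 0} = {v}"
  by (auto simp: vertex_point_def)

text \<open>A walk in \<open>G\<close> is a path of edges in \<open>Cl G\<close>, and any point is
  joined inside its own simplex to a vertex of its support.\<close>

lemma connected_path_component:
  assumes conn: "connected_graph G" and x: "x \<in> topspace (Cl G)" and v: "v \<in> verts G"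
  shows "path_component_of (Cl G) (vertex_point v) x"
proof -
  have walk: "(u, w) \<in> {(x, y). adj G x y} ^^ n \<Longrightarrow> u \<in> verts G
      \<Longrightarrow> path_component_of (Cl G) (vertex_point u) (vertex_point w)" for u w n
  proof (induction n arbitrary: w)
    case 0
    then show ?case by (simp add: path_component_of_refl vertex_point_in_Cl)
  next
    case (Suc n)
    then obtain y where y: "(u, y) \<in> {(x, y). adj G x y} ^^ n" "adj G y w" by auto
    have e: "{y, w} \<in> edges G" using y(2) by (simp add: adj_def)
    have "path_component_of (Cl G) (vertex_point y) (vertex_point w)"
      by (rule contiguous_imp_path_component[OF simplicial_complex_clique_complex edge_in_clique_complex[OF e]])
        (use adj_imp_edge[OF y(2)] in \<open>simp_all add: vertex_point_in_Cl vertex_point_support\<close>)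
    with Suc.IH[OF y(1) Suc.prems(2)] show ?case by (rule path_component_of_trans)
  qed
  have supp: "{w. x w \<noteq> 0} \<in> clique_complex G" using x by (simp add: realization_iff)
  then have "{w. x w \<noteq> 0} \<noteq> {}" by (simp add: clique_complex_def)
  then obtain u where u: "x u \<noteq> 0" by auto
  then have uG: "u \<in> verts G" using supp by (auto simp: clique_complex_def clique_def)
  have "graph_dist G v u \<noteq> \<infinity>" using conn v uG by (simp add: connected_graph_def)
  then have "{n. (v, u) \<in> {(x, y). adj G x y} ^^ n} \<noteq> {}"
    unfolding graph_dist_def by (metis Inf_empty image_empty top_enat_def)
  then obtain n where "(v, u) \<in> {(x, y). adj G x y} ^^ n" by blast
  from walk[OF this v] have "path_component_of (Cl G) (vertex_point v) (vertex_point u)" .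
  moreover have "path_component_of (Cl G) (vertex_point u) x"
    by (rule contiguous_imp_path_component[OF simplicial_complex_clique_complex supp])
      (use u uG x in \<open>simp_all add: vertex_point_in_Cl vertex_point_support\<close>)
  ultimately show ?thesis by (rule path_component_of_trans)
qed

lemma exists_sides:
  assumes "t \<in> triangles G"
  shows "\<exists>f. bij_betw f (UNIV :: 3 set) {e. e \<subseteq> t \<and> card e = 2}"
proof -
  obtain a b c where abc: "t = {a, b, c}" "a \<noteq> b" "b \<noteq> c" "a \<noteq> c"
    using triangleE[OF assms] .
  have "card {{a, b}, {b, c}, {a, c}} = 3"
    using abc by (simp add: doubleton_eq_iff)
  then show ?thesis
    unfolding abc(1) medial_triangle[OF abc(2-4)] by (intro finite_same_card_bij) simp_all
qed

text \<open>The numbering of the sides serves only to set up charts; it is chosen here and is absent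
  from the conclusion.\<close>

lemma total_homotopy_equivalent_indexed:
  fixes s :: "real ^ 3"
  assumes s: "norm s = 1" and tri: "bij_betw tri I (triangles G)"
    and b: "\<And>i v. \<lbrakk>i \<in> I; v \<in> tri i\<rbrakk> \<Longrightarrow> path_component_of (Cl G) (vertex_point v) (b i)"
  shows "Cl (total_graph G) homotopy_equivalent_space attach_copies (Cl G) I b S2 s"
proof -
  have "\<forall>i\<in>I. \<exists>f. bij_betw f (UNIV :: 3 set) {e. e \<subseteq> tri i \<and> card e = 2}"
    using bij_betwE[OF tri] exists_sides by blast
  then obtain side where "\<forall>i\<in>I. bij_betw (side i) (UNIV :: 3 set) {e. e \<subseteq> tri i \<and> card e = 2}"
    using bchoice by metis
  then interpret indexed_triangles G I tri side
    by unfold_locales (use tri in auto)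
  show ?thesis using s b by (rule total_homotopy_equivalent)
qed

end

theorem theorem5p1:
  fixes G :: "'a graph" and s :: "real ^ 3"
  assumes "finite_simple_graph G"
    and "s \<in> topspace S2"
  shows "(\<forall>b. admissible_attaching G b \<longrightarrow>
            Cl (total_graph G) homotopy_equivalent_space
              attach_copies (Cl G) (triangles G) b S2 s) \<and>
         (connected_graph G \<longrightarrow>
            (\<forall>x \<in> topspace (Cl G).
              Cl (total_graph G) homotopy_equivalent_space
                wedge_copies (Cl G) x (card (triangles G)) S2 s))"
proof (intro conjI allI impI ballI)
  interpret simple_graph G by unfold_locales fact
  have s: "norm s = 1" using assms(2) by simp
  \<comment> \<open>Here each triangle is its own index.\<close>
  show "Cl (total_graph G) homotopy_equivalent_space attach_copies (Cl G) (triangles G) b S2 s"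
    if "admissible_attaching G b" for b
    by (rule total_homotopy_equivalent_indexed[OF s bij_betw_id])
      (use that in \<open>auto simp: admissible_attaching_def\<close>)
  fix x assume conn: "connected_graph G" and x: "x \<in> topspace (Cl G)"
  \<comment> \<open>Numbering the triangles turns the wedge into an attachment at the constant point
    \<open>x\<close>; connectedness supplies the path from every corner to \<open>x\<close>.\<close>
  obtain tri where tri: "bij_betw tri {..<card (triangles G)} (triangles G)"
    using ex_bij_betw_nat_finite[OF finite_triangles] unfolding lessThan_atLeast0 by blast
  show "Cl (total_graph G) homotopy_equivalent_space wedge_copies (Cl G) x (card (triangles G)) S2 s"
    unfolding wedge_copies_def
  proof (rule total_homotopy_equivalent_indexed[OF s tri])
    fix i v assume "i \<in> {..<card (triangles G)}" "v \<in> tri i"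
    then have "v \<in> verts G"
      using tri by (auto simp: bij_betw_def triangles_def clique_def)
    with conn x show "path_component_of (Cl G) (vertex_point v) x"
      by (rule connected_path_component)
  qed
qed

end
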